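(* Let $K$ be a field, $H\subseteq K[x_0,\dots,x_{n-1}]$ a homogeneous ideal, and $\prec,\prec'$ two term orders on the terms in $x_0,\dots,x_{n-1}$. Let $\mathfrak h_0\subset K[C]$ and $\mathfrak h_0'\subset K[C']$ be the ideals constructed from $(H,\prec)$ and $(H,\prec')$, and let $\phi: K[C'][x_0,\dots,x_n]\to K[C][x_0,\dots,x_n]$ be the $K$-algebra morphism described in the context, which fixes $x_0,\dots,x_n$ and sends each $C'_{\beta\gamma}$ to the coefficient of $x_nx^\gamma$ in the polynomial $q'_\beta$. Then $\phi$ induces an isomorphism of $K$-algebras between $K[C']/\mathfrak h'_0$ and $K[C]/\mathfrak h_0$.
   Context: Notation: $\mathbf x=\{x_0,\dots,x_{n-1}\}$. A term is a monic monomial $x^\alpha$, $|\alpha|$ its degree. Given a term order $\prec$ on terms in $\mathbf x$, $\prec_n$ is the graded term order on terms in $\mathbf x,x_n$ such that for terms of the same degree $x^\alpha\prec_n x^\beta$ iff $\alpha_n>\beta_n$, or $\alpha_n=\beta_n$ and $x^\alpha/x_n^{\alpha_n}\prec x^\beta/x_n^{\beta_n}$. Construction of $\mathfrak h_0$ from $(H,\prec)$: let $\{f_\alpha\}_\alpha$ be the reduced Gröbner basis of $H$ w.r.t. $\prec$, where $f_\alpha$ has head term $x^\alpha$ and $x^\alpha$ runs over the minimal monomial generators of $\mathrm{in}_\prec(H)$. Let $J=\mathrm{in}_\prec(H)K[\mathbf x,x_n]$, $\mathcal N(J)$ the set of terms in $\mathbf x,x_n$ not in $J$, $\mathcal N(J)_d$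 its subset of terms of degree $d$. Put $g_\alpha=\sum_{x_nx^\gamma\in\mathcal N(J)_{|\alpha|}}C_{\alpha\gamma}\,x_nx^\gamma$ with new variables $C=\{C_{\alpha\gamma}\}$ (here $x^\gamma$ is a term in $\mathbf x,x_n$), and $\mathcal G=\{f_\alpha+g_\alpha\}_\alpha\subset K[C][\mathbf x,x_n]$. Fix a term order on $K[C]$ and extend $\prec_n$ to the elimination order of $\mathbf x,x_n$ on $K[C][\mathbf x,x_n]$ (terms are compared first by their $\mathbf x,x_n$-part via $\prec_n$, then by the order on $K[C]$), still denoted $\prec_n$. Then $\mathfrak h_0\subseteq K[C]$ is the ideal generated by the coefficients (in $K[C]$) of the terms in $\mathbf x,x_n$ in a complete reduction by $\mathcal G$ w.r.t. $\prec_n$ of the $S$-polynomial $S(f_\alpha+g_\alpha,f_{\alpha'}+g_{\alpha'})$, for all pairs $\alpha,\alpha'$ (it does not depend on the chosen reductions). Let $\mathcal H$ be the reduced Gröbner basis of $\mathfrak h_0$. Similarly, from $(H,\prec')$: $\{f'_\beta\}_\beta$ is the reduced Gröbner basis of $H$ w.r.t. $\prec'$ (with $f'_\beta$ of head term $x^\beta$), $J'=\mathrm{in}_{\prec'}(H)K[\mathbf x,x_n]$, $g'_\beta=\sum_{x_nx^\gamma\in\mathcal N(J')_{|\beta|}}C'_{\beta\gamma}x_nx^\gamma$, and $\mathfrak h'_0\subset K[C']$ is obtained in the same way. Definition of $\phi$: since $\{f_\alpha\}$ generates $H$, write $f'_\beta=\sum_\alpha h_{\alpha\beta}f_\alpha$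 with $h_{\alpha\beta}\in K[\mathbf x]$ homogeneous (of degree $|\beta|-|\alpha|$), and put $p'_\beta=\sum_\alpha h_{\alpha\beta}(f_\alpha+g_\alpha)\in K[C][\mathbf x,x_n]$. Extend $\prec'_n$ to an elimination order of $\mathbf x,x_n$ on $K[C][\mathbf x,x_n]$ using the same fixed term order on $K[C]$. The set $\{p'_\beta\}_\beta\cup\mathcal H$ is a monic Gröbner basis w.r.t. $\prec_n'$ of the ideal $(\mathcal G\cup\mathcal H)$ in $K[C][\mathbf x,x_n]$; interreducing gives the reduced Gröbner basis $\{q'_\beta\}_\beta\cup\mathcal H$, where $q'_\beta$ is the reduced form of $p'_\beta$, and $q'_\beta=f'_\beta+x_nm_\beta$, where the terms in $\mathbf x,x_n$ occurring in $m_\beta$ (with coefficients in $K[C]$) lie in $\mathcal N(J')$. The morphism $\phi$ is the $K$-algebra morphism with $\phi(x_i)=x_i$ for $i=0,\dots,n$ and $\phi(C'_{\beta\gamma})$ equal to the coefficient in $K[C]$ of $x_nx^\gamma$ in $q'_\beta$ (i.e. it is obtained by comparing $f'_\beta+g'_\beta$ with $q'_\beta$). *)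

theory Defs
  imports "HOL-Algebra.QuotRing" "HOL-Library.Poly_Mapping" "HOL-Library.Product_Plus"
begin

text \<open>
  A term in variables of type \<open>'v\<close> is its exponent vector, of type \<open>'v \<Rightarrow>\<^sub>0 nat\<close>, so terms are
  written additively: \<open>0\<close> is the term \<open>1\<close> and \<open>s + t\<close> is the product of \<open>s\<close> and \<open>t\<close>.
  Polynomials over a field \<open>'k\<close> with terms of type \<open>'m\<close> have the type \<open>'m \<Rightarrow>\<^sub>0 'k\<close>.  The
  notions about Groebner bases are stated for a cancellative commutative monoid \<open>'m\<close> of terms,
  because they are needed for \<open>K[x]\<close>, for \<open>K[C]\<close>, and for \<open>K[C][x]\<close>, where a term is a pair
  consisting of a term in \<open>x\<close> and a term in \<open>C\<close>.
\<close>

type_synonym xterm = "nat \<Rightarrow>\<^sub>0 nat"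
  \<comment> \<open>the new variable \<open>C\<^sub>\<alpha>\<^sub>\<gamma>\<close> is the pair \<open>(\<alpha>, \<gamma>)\<close>\<close>
type_synonym cvar = "xterm \<times> xterm"
type_synonym cterm = "cvar \<Rightarrow>\<^sub>0 nat"


subsection \<open>Terms and term orders\<close>

definition terms_in :: "'v set \<Rightarrow> ('v \<Rightarrow>\<^sub>0 nat) set" where
  "terms_in V = {t. Poly_Mapping.keys t \<subseteq> V}"

definition tdeg :: "('v \<Rightarrow>\<^sub>0 nat) \<Rightarrow> nat" where
  "tdeg t = (\<Sum>v\<in>Poly_Mapping.keys t. Poly_Mapping.lookup t v)"

definition tdvd :: "'m::comm_monoid_add \<Rightarrow> 'm \<Rightarrow> bool" where
  "tdvd s t \<longleftrightarrow> (\<exists>u. t = s + u)"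

text \<open>
  Subtraction of exponent vectors (and of pairs of such) is pointwise and truncated, so the
  exponents of the following term are the maxima of the exponents of \<open>s\<close> and \<open>t\<close>.
\<close>
definition term_lcm :: "'m::cancel_comm_monoid_add \<Rightarrow> 'm \<Rightarrow> 'm" where
  "term_lcm s t = s + (t - s)"

text \<open>Term orders are given as strict orders, on a submonoid \<open>M\<close> of all terms of the type.\<close>
definition term_order :: "'m::comm_monoid_add set \<Rightarrow> ('m \<Rightarrow> 'm \<Rightarrow> bool) \<Rightarrow> bool" where
  "term_order M prec \<longleftrightarrow>
     (\<forall>s\<in>M. \<not> prec s s) \<and>
     (\<forall>s\<in>M. \<forall>t\<in>M. \<forall>u\<in>M. prec s t \<longrightarrow> prec t u \<longrightarrow> prec s u) \<and>
     (\<forall>s\<in>M. \<forall>t\<in>M. s \<noteq> t \<longrightarrow> prec s t \<or> prec t s) \<and>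
     (\<forall>t\<in>M. t \<noteq> 0 \<longrightarrow> prec 0 t) \<and>
     (\<forall>s\<in>M. \<forall>t\<in>M. \<forall>u\<in>M. prec s t \<longrightarrow> prec (s + u) (t + u))"

text \<open>The order \<open>\<prec>\<^sub>n\<close>; \<open>Poly_Mapping.update n 0 s\<close> is \<open>s\<close> divided by its power of \<open>x\<^sub>n\<close>.\<close>
definition graded_ext :: "nat \<Rightarrow> (xterm \<Rightarrow> xterm \<Rightarrow> bool) \<Rightarrow> xterm \<Rightarrow> xterm \<Rightarrow> bool" where
  "graded_ext n prec s t \<longleftrightarrow>
     tdeg s < tdeg t \<or>
     tdeg s = tdeg t \<and>
       (Poly_Mapping.lookup s n > Poly_Mapping.lookup t n \<or>
        Poly_Mapping.lookup s n = Poly_Mapping.lookup t n \<and>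
          prec (Poly_Mapping.update n 0 s) (Poly_Mapping.update n 0 t))"

definition elim_order ::
  "('a \<Rightarrow> 'a \<Rightarrow> bool) \<Rightarrow> ('b \<Rightarrow> 'b \<Rightarrow> bool) \<Rightarrow> 'a \<times> 'b \<Rightarrow> 'a \<times> 'b \<Rightarrow> bool" where
  "elim_order precX precC s t \<longleftrightarrow>
     precX (fst s) (fst t) \<or> fst s = fst t \<and> precC (snd s) (snd t)"


subsection \<open>Polynomial rings and Groebner bases\<close>

definition poly_ring :: "'m::comm_monoid_add set \<Rightarrow> ('m \<Rightarrow>\<^sub>0 'k::field) ring" where
  "poly_ring M =
     \<lparr>carrier = {p. Poly_Mapping.keys p \<subseteq> M}, mult = (*), one = 1, zero = 0, add = (+)\<rparr>"

definition homogeneous :: "nat \<Rightarrow> (('v \<Rightarrow>\<^sub>0 nat) \<Rightarrow>\<^sub>0 'k::field) \<Rightarrow> bool" where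
  "homogeneous d p \<longleftrightarrow> (\<forall>t\<in>Poly_Mapping.keys p. tdeg t = d)"

definition homogeneous_ideal ::
  "('v \<Rightarrow>\<^sub>0 nat) set \<Rightarrow> (('v \<Rightarrow>\<^sub>0 nat) \<Rightarrow>\<^sub>0 'k::field) set \<Rightarrow> bool" where
  "homogeneous_ideal M I \<longleftrightarrow> ideal I (poly_ring M) \<and>
     (\<exists>S \<subseteq> carrier (poly_ring M). (\<forall>p\<in>S. \<exists>d. homogeneous d p) \<and> I = Idl\<^bsub>poly_ring M\<^esub> S)"

definition head_term :: "('m \<Rightarrow> 'm \<Rightarrow> bool) \<Rightarrow> ('m \<Rightarrow>\<^sub>0 'k::field) \<Rightarrow> 'm" where
  "head_term prec p =
     (THE t. t \<in> Poly_Mapping.keys p \<and> (\<forall>s\<in>Poly_Mapping.keys p. s \<noteq> t \<longrightarrow> prec s t))"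

definition head_coeff :: "('m \<Rightarrow> 'm \<Rightarrow> bool) \<Rightarrow> ('m \<Rightarrow>\<^sub>0 'k::field) \<Rightarrow> 'k" where
  "head_coeff prec p = Poly_Mapping.lookup p (head_term prec p)"

definition initial_ideal ::
  "'m::comm_monoid_add set \<Rightarrow> ('m \<Rightarrow> 'm \<Rightarrow> bool) \<Rightarrow> ('m \<Rightarrow>\<^sub>0 'k::field) set \<Rightarrow> ('m \<Rightarrow>\<^sub>0 'k) set" where
  "initial_ideal M prec I =
     Idl\<^bsub>poly_ring M\<^esub> {Poly_Mapping.single (head_term prec p) 1 | p. p \<in> I \<and> p \<noteq> 0}"

definition groebner_basis ::
  "'m::comm_monoid_add set \<Rightarrow> ('m \<Rightarrow> 'm \<Rightarrow> bool) \<Rightarrow> ('m \<Rightarrow>\<^sub>0 'k::field) set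
    \<Rightarrow> ('m \<Rightarrow>\<^sub>0 'k) set \<Rightarrow> bool" where
  "groebner_basis M prec I G \<longleftrightarrow> finite G \<and> G \<subseteq> I \<and> 0 \<notin> G \<and>
     Idl\<^bsub>poly_ring M\<^esub> {Poly_Mapping.single (head_term prec g) 1 | g. g \<in> G} = initial_ideal M prec I"

definition reduced_groebner_basis ::
  "'m::comm_monoid_add set \<Rightarrow> ('m \<Rightarrow> 'm \<Rightarrow> bool) \<Rightarrow> ('m \<Rightarrow>\<^sub>0 'k::field) set
    \<Rightarrow> ('m \<Rightarrow>\<^sub>0 'k) set \<Rightarrow> bool" where
  "reduced_groebner_basis M prec I G \<longleftrightarrow> groebner_basis M prec I G \<and>
     (\<forall>g\<in>G. head_coeff prec g = 1) \<and>
     (\<forall>g\<in>G. \<forall>g'\<in>G - {g}. \<forall>t\<in>Poly_Mapping.keys g. \<not> tdvd (head_term prec g') t)"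

definition spoly ::
  "('m::cancel_comm_monoid_add \<Rightarrow> 'm \<Rightarrow> bool) \<Rightarrow> ('m \<Rightarrow>\<^sub>0 'k::field) \<Rightarrow> ('m \<Rightarrow>\<^sub>0 'k) \<Rightarrow> ('m \<Rightarrow>\<^sub>0 'k)" where
  "spoly prec p q =
     (let s = head_term prec p; t = head_term prec q; l = term_lcm s t in
        Poly_Mapping.single (l - s) (1 / head_coeff prec p) * p -
        Poly_Mapping.single (l - t) (1 / head_coeff prec q) * q)"

definition red_step ::
  "('m::comm_monoid_add \<Rightarrow> 'm \<Rightarrow> bool) \<Rightarrow> ('m \<Rightarrow>\<^sub>0 'k::field) set
    \<Rightarrow> ('m \<Rightarrow>\<^sub>0 'k) \<Rightarrow> ('m \<Rightarrow>\<^sub>0 'k) \<Rightarrow> bool" where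
  "red_step prec G p q \<longleftrightarrow>
     (\<exists>g\<in>G. \<exists>u. g \<noteq> 0 \<and> u + head_term prec g \<in> Poly_Mapping.keys p \<and>
        q = p - Poly_Mapping.single u
                  (Poly_Mapping.lookup p (u + head_term prec g) / head_coeff prec g) * g)"

text \<open>\<open>r\<close> is a result of completely reducing \<open>p\<close> by \<open>G\<close> (not only its head term).\<close>
definition complete_reduction ::
  "('m::comm_monoid_add \<Rightarrow> 'm \<Rightarrow> bool) \<Rightarrow> ('m \<Rightarrow>\<^sub>0 'k::field) set
    \<Rightarrow> ('m \<Rightarrow>\<^sub>0 'k) \<Rightarrow> ('m \<Rightarrow>\<^sub>0 'k) \<Rightarrow> bool" where
  "complete_reduction prec G p r \<longleftrightarrow>
     (red_step prec G)\<^sup>*\<^sup>* p r \<and> \<not> (\<exists>r'. red_step prec G r r')"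

text \<open>The terms that form the minimal generating set of a monomial ideal \<open>I\<close>.\<close>
definition min_gens :: "'m::comm_monoid_add set \<Rightarrow> ('m \<Rightarrow>\<^sub>0 'k::field) set \<Rightarrow> 'm set" where
  "min_gens M I = {t \<in> M. Poly_Mapping.single t 1 \<in> I \<and>
     (\<forall>s\<in>M. Poly_Mapping.single s 1 \<in> I \<longrightarrow> tdvd s t \<longrightarrow> s = t)}"

definition normal_terms :: "'m::comm_monoid_add set \<Rightarrow> ('m \<Rightarrow>\<^sub>0 'k::field) set \<Rightarrow> 'm set" where
  "normal_terms M J = {t \<in> M. Poly_Mapping.single t 1 \<notin> J}"

definition alg_hom ::
  "'m::comm_monoid_add set \<Rightarrow> 'm set \<Rightarrow> (('m \<Rightarrow>\<^sub>0 'k::field) \<Rightarrow> ('m \<Rightarrow>\<^sub>0 'k)) \<Rightarrow> bool" where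
  "alg_hom M N \<phi> \<longleftrightarrow> \<phi> \<in> ring_hom (poly_ring M) (poly_ring N) \<and>
     (\<forall>c. \<phi> (Poly_Mapping.single 0 c) = Poly_Mapping.single 0 c)"


subsection \<open>The rings \<open>K[x]\<close>, \<open>K[C]\<close> and \<open>K[C][x]\<close>\<close>

definition emb_x :: "(xterm \<Rightarrow>\<^sub>0 'k::field) \<Rightarrow> (xterm \<times> cterm \<Rightarrow>\<^sub>0 'k)" where
  "emb_x p = (\<Sum>t\<in>Poly_Mapping.keys p. Poly_Mapping.single (t, 0) (Poly_Mapping.lookup p t))"

definition emb_c :: "(cterm \<Rightarrow>\<^sub>0 'k::field) \<Rightarrow> (xterm \<times> cterm \<Rightarrow>\<^sub>0 'k)" where
  "emb_c p = (\<Sum>u\<in>Poly_Mapping.keys p. Poly_Mapping.single (0, u) (Poly_Mapping.lookup p u))"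

text \<open>The coefficient, an element of \<open>K[C]\<close>, of the \<open>x\<close>-term \<open>t\<close>.\<close>
definition coeff_x :: "(xterm \<times> cterm \<Rightarrow>\<^sub>0 'k::field) \<Rightarrow> xterm \<Rightarrow> (cterm \<Rightarrow>\<^sub>0 'k)" where
  "coeff_x p t = Poly_Mapping.map_key (Pair t) p"


subsection \<open>The construction from \<open>(H, \<prec>)\<close>\<close>

abbreviation xvar :: "nat \<Rightarrow> xterm" where
  "xvar i \<equiv> Poly_Mapping.single i 1"

definition in_gens ::
  "nat \<Rightarrow> (xterm \<Rightarrow> xterm \<Rightarrow> bool) \<Rightarrow> (xterm \<Rightarrow>\<^sub>0 'k::field) set \<Rightarrow> xterm set" where
  "in_gens n prec H = min_gens (terms_in {..<n}) (initial_ideal (terms_in {..<n}) prec H)"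

text \<open>The terms outside \<open>J = in(H) K[x\<^sub>0,\<dots>,x\<^sub>n]\<close>.\<close>
definition normal_ext ::
  "nat \<Rightarrow> (xterm \<Rightarrow> xterm \<Rightarrow> bool) \<Rightarrow> (xterm \<Rightarrow>\<^sub>0 'k::field) set \<Rightarrow> xterm set" where
  "normal_ext n prec H =
     normal_terms (terms_in {..n})
       (Idl\<^bsub>poly_ring (terms_in {..n})\<^esub> (initial_ideal (terms_in {..<n}) prec H))"

text \<open>The terms \<open>\<gamma>\<close> that index the parameters \<open>C\<^sub>\<alpha>\<^sub>\<gamma>\<close> for a given \<open>\<alpha>\<close>.\<close>
definition param_terms ::
  "nat \<Rightarrow> (xterm \<Rightarrow> xterm \<Rightarrow> bool) \<Rightarrow> (xterm \<Rightarrow>\<^sub>0 'k::field) set \<Rightarrow> xterm \<Rightarrow> xterm set" where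
  "param_terms n prec H \<alpha> =
     {\<gamma> \<in> terms_in {..n}. xvar n + \<gamma> \<in> normal_ext n prec H \<and> tdeg (xvar n + \<gamma>) = tdeg \<alpha>}"

definition params ::
  "nat \<Rightarrow> (xterm \<Rightarrow> xterm \<Rightarrow> bool) \<Rightarrow> (xterm \<Rightarrow>\<^sub>0 'k::field) set \<Rightarrow> cvar set" where
  "params n prec H = {(\<alpha>, \<gamma>). \<alpha> \<in> in_gens n prec H \<and> \<gamma> \<in> param_terms n prec H \<alpha>}"

abbreviation param_ring ::
  "nat \<Rightarrow> (xterm \<Rightarrow> xterm \<Rightarrow> bool) \<Rightarrow> (xterm \<Rightarrow>\<^sub>0 'k::field) set \<Rightarrow> (cterm \<Rightarrow>\<^sub>0 'k) ring" where
  "param_ring n prec H \<equiv> poly_ring (terms_in (params n prec H))"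

definition g_poly ::
  "nat \<Rightarrow> (xterm \<Rightarrow> xterm \<Rightarrow> bool) \<Rightarrow> (xterm \<Rightarrow>\<^sub>0 'k::field) set \<Rightarrow> xterm
    \<Rightarrow> (xterm \<times> cterm \<Rightarrow>\<^sub>0 'k)" where
  "g_poly n prec H \<alpha> =
     (\<Sum>\<gamma>\<in>param_terms n prec H \<alpha>.
        Poly_Mapping.single (xvar n + \<gamma>, Poly_Mapping.single (\<alpha>, \<gamma>) 1) 1)"

text \<open>\<open>f \<alpha>\<close> is the element with head term \<open>\<alpha>\<close> of the reduced Groebner basis of \<open>H\<close>.\<close>
definition reduced_gb_family ::
  "nat \<Rightarrow> (xterm \<Rightarrow> xterm \<Rightarrow> bool) \<Rightarrow> (xterm \<Rightarrow>\<^sub>0 'k::field) set \<Rightarrow> (xterm \<Rightarrow> (xterm \<Rightarrow>\<^sub>0 'k)) \<Rightarrow> bool"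
  where
  "reduced_gb_family n prec H f \<longleftrightarrow>
     reduced_groebner_basis (terms_in {..<n}) prec H (f ` in_gens n prec H) \<and>
     (\<forall>\<alpha>\<in>in_gens n prec H. head_term prec (f \<alpha>) = \<alpha>)"

definition fg_poly ::
  "nat \<Rightarrow> (xterm \<Rightarrow> xterm \<Rightarrow> bool) \<Rightarrow> (xterm \<Rightarrow>\<^sub>0 'k::field) set \<Rightarrow> (xterm \<Rightarrow> (xterm \<Rightarrow>\<^sub>0 'k))
    \<Rightarrow> xterm \<Rightarrow> (xterm \<times> cterm \<Rightarrow>\<^sub>0 'k)" where
  "fg_poly n prec H f \<alpha> = emb_x (f \<alpha>) + g_poly n prec H \<alpha>"

text \<open>
  \<open>h0\<close> is the ideal of \<open>K[C]\<close> generated by the coefficients of some complete reductions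
  \<open>\<rho> \<alpha> \<alpha>'\<close> of the S-polynomials.  The ideal does not depend on the choice of \<open>\<rho>\<close>.
\<close>
definition constructed_ideal ::
  "nat \<Rightarrow> (xterm \<Rightarrow> xterm \<Rightarrow> bool) \<Rightarrow> (cterm \<Rightarrow> cterm \<Rightarrow> bool) \<Rightarrow> (xterm \<Rightarrow>\<^sub>0 'k::field) set
    \<Rightarrow> (xterm \<Rightarrow> (xterm \<Rightarrow>\<^sub>0 'k)) \<Rightarrow> (cterm \<Rightarrow>\<^sub>0 'k) set \<Rightarrow> bool" where
  "constructed_ideal n prec precC H f h0 \<longleftrightarrow>
     (let A = in_gens n prec H; F = fg_poly n prec H f;
          ord = elim_order (graded_ext n prec) precC
      in \<exists>\<rho>. (\<forall>\<alpha>\<in>A. \<forall>\<alpha>'\<in>A. complete_reduction ord (F ` A) (spoly ord (F \<alpha>) (F \<alpha>')) (\<rho> \<alpha> \<alpha>')) \<and>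
           h0 = Idl\<^bsub>param_ring n prec H\<^esub>
                  {coeff_x (\<rho> \<alpha> \<alpha>') t | \<alpha> \<alpha>' t. \<alpha> \<in> A \<and> \<alpha>' \<in> A \<and> t \<in> terms_in {..n}})"

definition p_poly ::
  "nat \<Rightarrow> (xterm \<Rightarrow> xterm \<Rightarrow> bool) \<Rightarrow> (xterm \<Rightarrow>\<^sub>0 'k::field) set \<Rightarrow> (xterm \<Rightarrow> (xterm \<Rightarrow>\<^sub>0 'k))
    \<Rightarrow> (xterm \<Rightarrow> xterm \<Rightarrow> (xterm \<Rightarrow>\<^sub>0 'k)) \<Rightarrow> xterm \<Rightarrow> (xterm \<times> cterm \<Rightarrow>\<^sub>0 'k)" where
  "p_poly n prec H f h \<beta> = (\<Sum>\<alpha>\<in>in_gens n prec H. emb_x (h \<alpha> \<beta>) * fg_poly n prec H f \<alpha>)"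

end

theory Submission
  imports Defs "HOL.Modules"
begin

text \<open>
  The ring \<open>K[C]/h0\<close> represents a functor in which no term order occurs.  For a ring \<open>R\<close> of parameters, consider the
  homogeneous ideals of \<open>R[x\<^sub>0,\<dots>,x\<^sub>n]\<close> modulo which \<open>x\<^sub>n\<close> is a nonzerodivisor and which become the extension of
  \<open>H\<close> for \<open>x\<^sub>n = 0\<close>; such an ideal is called a lifting of \<open>H\<close> here.  The polynomials \<open>f \<alpha> + g \<alpha>\<close> generate the universal
  lifting, over \<open>K[C]/h0\<close>.  Two term orders give two universal objects of the same functor, and \<open>\<phi>\<close> is the
  comparison between them.

  The proof makes this concrete and passes to quotients only at the very end: polynomials have coefficients in the
  ring \<open>R = K[C]\<close>, and statements are made modulo an ideal \<open>\<aa>\<close> of \<open>R\<close>.  The ideal \<open>lifted_ideal\<close> of \<open>R[x\<^sub>0,\<dots>,x\<^sub>n]\<close> is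
  generated by the \<open>f \<alpha> + g \<alpha>\<close> and by \<open>\<aa>\<close>.  The steps that carry the argument are these.

  \<^item> Buchberger's criterion modulo \<open>\<aa>\<close> (\<open>buchberger_modulo\<close>): an element of \<open>lifted_ideal\<close> that is, modulo \<open>\<aa>\<close>, a combination
    of normal terms is zero modulo \<open>\<aa>\<close>.  Normality does not depend on the power of \<open>x\<^sub>n\<close>, so \<open>x\<^sub>n\<close> is a
    nonzerodivisor (\<open>xvar_nonzerodivisor\<close>).

  \<^item> Both halves of the decomposition into ideal and normal terms pass to every other order \<open>\<prec>'\<close>.
    The polynomials of \<open>K[x]\<close> are the direct sum of \<open>H\<close> and the span of the \<open>\<prec>'\<close>-normal terms; this
    decomposition is applied at \<open>x\<^sub>n = 0\<close>, and then \<open>x\<^sub>n\<close> is divided out, by induction on the degree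
    (\<open>complement\<close>, \<open>normal_elements_vanish\<close>).

  \<^item> Hence a homomorphism of parameter rings that sends the generators \<open>f' \<beta> + g' \<beta>\<close> for \<open>\<prec>'\<close> into \<open>lifted_ideal\<close> kills
    \<open>h0'\<close> modulo \<open>\<aa>\<close>: the reduced S-polynomials generating \<open>h0'\<close> become \<open>\<prec>'\<close>-normal elements of \<open>lifted_ideal\<close>
    (\<open>h0_killed\<close>).  Such homomorphisms exist in both directions (\<open>parameters_exist\<close>), and \<open>\<phi>\<close> is one of them
    (\<open>reduced_parameters\<close>).

  \<^item> A composite of two such homomorphisms maps the universal lifting into itself.  The parameters are the
    coefficients of normal terms, so the vanishing of normal elements shows that the composite is the identity modulo
    \<open>h0\<close> (\<open>endomorphism_identity\<close>).
\<close>

section \<open>Polynomials as modules and as evaluation targets\<close>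

text \<open>Keeps \<open>xvar n\<close> in the form in which it is written.\<close>
declare One_nat_def [simp del]

abbreviation lookup :: "('m \<Rightarrow>\<^sub>0 'r::zero) \<Rightarrow> 'm \<Rightarrow> 'r" where "lookup \<equiv> Poly_Mapping.lookup"
abbreviation keys :: "('m \<Rightarrow>\<^sub>0 'r::zero) \<Rightarrow> 'm set" where "keys \<equiv> Poly_Mapping.keys"
abbreviation single :: "'m \<Rightarrow> 'r::zero \<Rightarrow> 'm \<Rightarrow>\<^sub>0 'r" where "single \<equiv> Poly_Mapping.single"

definition smul :: "'r::comm_ring_1 \<Rightarrow> ('m::comm_monoid_add \<Rightarrow>\<^sub>0 'r) \<Rightarrow> ('m \<Rightarrow>\<^sub>0 'r)" where
  "smul c p = single 0 c * p"

global_interpretation pm: module "smul :: 'r::comm_ring_1 \<Rightarrow> ('m::comm_monoid_add \<Rightarrow>\<^sub>0 'r) \<Rightarrow> _"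
  by unfold_locales
    (simp_all add: smul_def algebra_simps single_add mult_single flip: mult.assoc)

lemma lookup_smul [simp]: "lookup (smul c p) t = c * lookup p t"
  unfolding smul_def mult_map_scale_conv_mult[symmetric]
  by (simp add: Poly_Mapping.map.rep_eq when_def)

lemma smul_mult: "smul c (p * q) = p * smul c q"
  by (simp add: smul_def ac_simps)

lemma single_mult_smul: "single u c * p = smul c (single u 1 * p)"
  by (simp add: smul_def mult_single flip: mult.assoc)

lemma lookup_single_mult:
  fixes u t :: "'m::cancel_comm_monoid_add"
  shows "lookup (single u c * p) (u + t) = c * lookup p t"
proof -
  have "lookup (single u c * p) (u + t)
      = (\<Sum>l. lookup (single u c) l * (\<Sum>q. lookup p q when u + t = l + q))"
    by (simp add: lookup_mult)
  also have "\<dots> = (\<Sum>l. c * (\<Sum>q. lookup p q when u + t = l + q) when u = l)"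
    by (rule Sum_any.cong) (simp add: lookup_single when_mult)
  also have "\<dots> = c * (\<Sum>q. lookup p q when u + t = u + q)" by simp
  also have "(\<Sum>q. lookup p q when u + t = u + q) = (\<Sum>q. lookup p q when t = q)" by simp
  also have "\<dots> = lookup p t" by simp
  finally show ?thesis .
qed

lemma keys_single_mult: "keys (single u c * p) \<subseteq> (+) u ` keys p"
proof -
  have "keys (single u c * p) \<subseteq> {a + b |a b. a \<in> keys (single u c) \<and> b \<in> keys p}"
    by (rule keys_mult)
  also have "\<dots> \<subseteq> (+) u ` keys p" by (auto split: if_splits)
  finally show ?thesis .
qed

lemma lookup_single_mult_eq_0: "(\<And>s. t \<noteq> u + s) \<Longrightarrow> lookup (single u c * p) t = 0"
  using keys_single_mult[of u c p] by (metis (no_types, lifting) image_iff in_keys_iff subsetD)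

lemma keys_minus_subset: "keys (p - q) \<subseteq> keys p \<union> keys (q :: 'm \<Rightarrow>\<^sub>0 'r::ab_group_add)"
  by (auto simp: in_keys_iff lookup_minus)

lemma poly_eq_sum_single: "p = (\<Sum>t\<in>keys p. single t (lookup p t))"
proof (rule poly_mapping_eqI)
  fix s
  have "lookup (\<Sum>t\<in>keys p. single t (lookup p t)) s = (\<Sum>t\<in>keys p. if t = s then lookup p t else 0)"
    by (auto simp: lookup_sum lookup_single when_def intro!: sum.cong)
  also have "\<dots> = lookup p s" by (simp add: in_keys_iff)
  finally show "lookup p s = lookup (\<Sum>t\<in>keys p. single t (lookup p t)) s" by simp
qed

lemma poly_induct [case_names zero add]:
  assumes "P 0" and "\<And>t c p. P p \<Longrightarrow> P (single t c + p)"
  shows "P (p :: 'm \<Rightarrow>\<^sub>0 'r::comm_monoid_add)"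
proof -
  have "finite B \<Longrightarrow> P (\<Sum>t\<in>B. single t (lookup p t))" for B
    by (induction B rule: finite_induct) (auto intro: assms)
  from this[of "keys p"] show ?thesis using poly_eq_sum_single[of p] by simp
qed

text \<open>
  The polynomial types contain the polynomials in all variables, so homomorphisms and ideals of a whole type are
  given by plain predicates, without carriers.
\<close>
definition ring_map :: "('r::comm_ring_1 \<Rightarrow> 's::comm_ring_1) \<Rightarrow> bool" where
  "ring_map \<theta> \<longleftrightarrow> \<theta> 1 = 1 \<and> (\<forall>x y. \<theta> (x + y) = \<theta> x + \<theta> y) \<and> (\<forall>x y. \<theta> (x * y) = \<theta> x * \<theta> y)"

lemma ring_mapD:
  assumes "ring_map \<theta>"
  shows ring_map_1: "\<theta> 1 = 1" and ring_map_add: "\<theta> (x + y) = \<theta> x + \<theta> y"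
    and ring_map_mult: "\<theta> (x * y) = \<theta> x * \<theta> y" and ring_map_0: "\<theta> 0 = 0"
    and ring_map_diff: "\<theta> (x - y) = \<theta> x - \<theta> y"
    and ring_map_sum: "\<theta> (sum g A) = (\<Sum>i\<in>A. \<theta> (g i))"
proof -
  interpret additive \<theta> using assms by unfold_locales (simp add: ring_map_def)
  show "\<theta> 0 = 0" "\<theta> (x - y) = \<theta> x - \<theta> y" "\<theta> (sum g A) = (\<Sum>i\<in>A. \<theta> (g i))"
    by (rule zero diff sum)+
  show "\<theta> 1 = 1" "\<theta> (x + y) = \<theta> x + \<theta> y" "\<theta> (x * y) = \<theta> x * \<theta> y"
    using assms by (auto simp: ring_map_def)
qed

lemma ring_map_comp: "ring_map \<theta> \<Longrightarrow> ring_map \<eta> \<Longrightarrow> ring_map (\<lambda>x. \<theta> (\<eta> x))"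
  by (simp add: ring_map_def)

lemma ring_map_single: "ring_map (single 0 :: 'r::comm_ring_1 \<Rightarrow> 'm::comm_monoid_add \<Rightarrow>\<^sub>0 'r)"
  by (simp add: ring_map_def single_add mult_single)

text \<open>
  All homomorphisms out of a polynomial ring that occur below are evaluations: the embeddings of
  \<open>K[x]\<close> and \<open>K[C]\<close> into \<open>K[C][x]\<close>, substitutions, and the change of coefficients.
\<close>
definition poly_eval ::
  "('r::comm_ring_1 \<Rightarrow> 's::comm_ring_1) \<Rightarrow> ('m \<Rightarrow> 's) \<Rightarrow> ('m::comm_monoid_add \<Rightarrow>\<^sub>0 'r) \<Rightarrow> 's" where
  "poly_eval \<theta> \<mu> p = (\<Sum>t\<in>keys p. \<theta> (lookup p t) * \<mu> t)"

lemma poly_eval_superset: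
  assumes "ring_map \<theta>" "finite B" "keys p \<subseteq> B"
  shows "poly_eval \<theta> \<mu> p = (\<Sum>t\<in>B. \<theta> (lookup p t) * \<mu> t)"
  unfolding poly_eval_def
  by (rule sum.mono_neutral_left) (use assms in \<open>auto simp: in_keys_iff ring_map_0\<close>)

lemma poly_eval_single [simp]: "ring_map \<theta> \<Longrightarrow> poly_eval \<theta> \<mu> (single t c) = \<theta> c * \<mu> t"
  by (subst poly_eval_superset[of _ "{t}"]) auto

lemma poly_eval_add: 
  assumes "ring_map \<theta>"
  shows "poly_eval \<theta> \<mu> (p + q) = poly_eval \<theta> \<mu> p + poly_eval \<theta> \<mu> q"
  using keys_add[of p q] assms
  by (simp add: poly_eval_superset[of _ "keys p \<union> keys q"] lookup_add ring_map_add
      distrib_right sum.distrib)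

lemma poly_eval_ring_map:
  fixes \<mu> :: "'m::comm_monoid_add \<Rightarrow> 's::comm_ring_1"
  assumes \<theta>: "ring_map \<theta>" and \<mu>: "\<mu> 0 = 1" "\<And>s t. \<mu> (s + t) = \<mu> s * \<mu> t"
  shows "ring_map (poly_eval \<theta> \<mu>)"
proof -
  note add = poly_eval_add[OF \<theta>, of \<mu>]
  have 0: "poly_eval \<theta> \<mu> 0 = 0" by (simp add: poly_eval_def)
  have 1: "poly_eval \<theta> \<mu> (single t c * q) = \<theta> c * \<mu> t * poly_eval \<theta> \<mu> q" for t c q
    by (induction q rule: poly_induct)
      (simp_all add: 0 add distrib_left mult_single \<theta> \<mu> ring_map_mult[OF \<theta>] ac_simps)
  have "poly_eval \<theta> \<mu> (p * q) = poly_eval \<theta> \<mu> p * poly_eval \<theta> \<mu> q" for p q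
    by (induction p rule: poly_induct) (simp_all add: 0 add distrib_right 1 \<theta>)
  moreover have "poly_eval \<theta> \<mu> 1 = 1"
    using poly_eval_single[OF \<theta>, of \<mu> 0 1] by (simp add: \<mu> ring_map_1[OF \<theta>])
  ultimately show ?thesis by (simp add: ring_map_def add)
qed

definition map_coeffs :: "('r::comm_ring_1 \<Rightarrow> 's::comm_ring_1) \<Rightarrow> ('m::comm_monoid_add \<Rightarrow>\<^sub>0 'r) \<Rightarrow> 'm \<Rightarrow>\<^sub>0 's"
  where "map_coeffs \<theta> = poly_eval (\<lambda>c. single 0 (\<theta> c)) (\<lambda>t. single t 1)"

lemma map_coeffs_ring_map: "ring_map \<theta> \<Longrightarrow> ring_map (map_coeffs \<theta>)"
  unfolding map_coeffs_def
  by (rule poly_eval_ring_map) (auto simp: ring_map_comp ring_map_single mult_single)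

lemma map_coeffs_single: "ring_map \<theta> \<Longrightarrow> map_coeffs \<theta> (single t c) = single t (\<theta> c)"
  unfolding map_coeffs_def by (simp add: ring_map_comp ring_map_single mult_single)

lemma lookup_map_coeffs [simp]: "ring_map \<theta> \<Longrightarrow> lookup (map_coeffs \<theta> p) t = \<theta> (lookup p t)"
  unfolding map_coeffs_def poly_eval_def
  by (simp add: lookup_sum mult_single lookup_single when_def in_keys_iff ring_map_0 if_distrib cong: if_cong)

lemma keys_map_coeffs: "ring_map \<theta> \<Longrightarrow> keys (map_coeffs \<theta> p) \<subseteq> keys p"
  by (auto simp: in_keys_iff ring_map_0)

lemma map_coeffs_smul: "ring_map \<theta> \<Longrightarrow> map_coeffs \<theta> (smul c p) = smul (\<theta> c) (map_coeffs \<theta> p)"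
  by (rule poly_mapping_eqI) (simp add: ring_map_mult)

text \<open>
  This covers multiplication by a monomial, with \<open>\<theta>\<close> the identity, as well as the change of coefficients.
\<close>
lemma span_semilinear:
  assumes "\<And>x y. \<Phi> (x + y) = \<Phi> x + \<Phi> y" "\<And>c x. \<Phi> (smul c x) = smul (\<theta> c) (\<Phi> x)" "\<Phi> 0 = 0"
    and "\<And>b. b \<in> B \<Longrightarrow> \<Phi> b \<in> pm.span B'" and "x \<in> pm.span B"
  shows "\<Phi> x \<in> pm.span B'"
  using assms(5)
proof (induction rule: pm.span_induct_alt)
  case base
  show ?case by (simp add: assms pm.span_zero)
next
  case (step c x y)
  then show ?case using assms(4)[of x] by (simp add: assms(1,2) pm.span_add pm.span_scale)
qed

definition is_ideal :: "'r::comm_ring_1 set \<Rightarrow> bool" where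
  "is_ideal \<aa> \<longleftrightarrow> 0 \<in> \<aa> \<and> (\<forall>x\<in>\<aa>. \<forall>y\<in>\<aa>. x + y \<in> \<aa>) \<and> (\<forall>c. \<forall>x\<in>\<aa>. c * x \<in> \<aa>)"

lemma is_idealD:
  assumes "is_ideal \<aa>"
  shows is_ideal_0: "0 \<in> \<aa>" and is_ideal_add: "x \<in> \<aa> \<Longrightarrow> y \<in> \<aa> \<Longrightarrow> x + y \<in> \<aa>"
    and is_ideal_mult: "x \<in> \<aa> \<Longrightarrow> c * x \<in> \<aa>" and is_ideal_diff: "x \<in> \<aa> \<Longrightarrow> y \<in> \<aa> \<Longrightarrow> x - y \<in> \<aa>"
    and is_ideal_sum: "(\<And>i. i \<in> A \<Longrightarrow> g i \<in> \<aa>) \<Longrightarrow> sum g A \<in> \<aa>"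
proof -
  show "0 \<in> \<aa>" and add: "\<And>x y. x \<in> \<aa> \<Longrightarrow> y \<in> \<aa> \<Longrightarrow> x + y \<in> \<aa>" 
    and m: "\<And>c x. x \<in> \<aa> \<Longrightarrow> c * x \<in> \<aa>"
    using assms by (auto simp: is_ideal_def)
  show "x \<in> \<aa> \<Longrightarrow> y \<in> \<aa> \<Longrightarrow> x - y \<in> \<aa>" using add[of x "- y"] m[of y "-1"] by simp
  show "(\<And>i. i \<in> A \<Longrightarrow> g i \<in> \<aa>) \<Longrightarrow> sum g A \<in> \<aa>"
    by (induction A rule: infinite_finite_induct) (auto intro: add \<open>0 \<in> \<aa>\<close>)
qed

text \<open>
  The elements \<open>w t\<close> are monic at their pivots \<open>t\<close>, and \<open>w s\<close> contains another pivot \<open>t\<close> only if \<open>t\<close> precedes \<open>s\<close>.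
  In a linear combination, the coefficient at a maximal pivot among those whose scalars are outside \<open>\<aa>\<close> is this scalar
  modulo \<open>\<aa>\<close>.  So if all pivot coefficients lie in \<open>\<aa>\<close>, then all scalars do.
\<close>
lemma echelon_coeffs:
  fixes w :: "'m::comm_monoid_add \<Rightarrow> ('m \<Rightarrow>\<^sub>0 'r::comm_ring_1)"
  assumes \<aa>: "is_ideal \<aa>"
    and irrefl: "\<And>t. t \<in> I \<Longrightarrow> \<not> r t t"
    and trans: "\<And>s t u. s \<in> I \<Longrightarrow> t \<in> I \<Longrightarrow> u \<in> I \<Longrightarrow> r s t \<Longrightarrow> r t u \<Longrightarrow> r s u"
    and one: "\<And>t. t \<in> I \<Longrightarrow> lookup (w t) t = 1"
    and piv: "\<And>s t. s \<in> I \<Longrightarrow> t \<in> I \<Longrightarrow> s \<noteq> t \<Longrightarrow> lookup (w s) t \<noteq> 0 \<Longrightarrow> r t s"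
    and p: "p \<in> pm.span (w ` I)" "\<And>t. t \<in> I \<Longrightarrow> lookup p t \<in> \<aa>"
  shows "lookup p t \<in> \<aa>"
proof -
  from p(1) obtain c' B where B: "finite B" "B \<subseteq> w ` I" and pe': "p = (\<Sum>b\<in>B. smul (c' b) b)"
    unfolding pm.span_explicit by blast
  obtain J where J: "J \<subseteq> I" "inj_on w J" "B = w ` J"
    using iffD1[OF subset_image_inj B(2)] by blast
  define c where "c = (\<lambda>t. c' (w t))"
  have finJ: "finite J" by (rule finite_imageD[OF _ J(2)]) (use B(1) J(3) in simp)
  have lp: "lookup p s = (\<Sum>t\<in>J. c t * lookup (w t) s)" for s
    unfolding pe' lookup_sum J(3) by (simp add: sum.reindex[OF J(2)] c_def)
  define Z where "Z = {t \<in> J. c t \<notin> \<aa>}"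
  have fin: "finite Z" and ZJ: "Z \<subseteq> J" using finJ by (auto simp: Z_def)
  have "Z = {}"
  proof (rule ccontr)
    assume ne: "Z \<noteq> {}"
    have ZI: "Z \<subseteq> I" using J(1) ZJ by (rule order_trans[rotated])
    have "\<exists>t\<in>Z. \<forall>s\<in>Z. s \<noteq> t \<longrightarrow> \<not> r t s"
    proof (rule Finite_Set.bex_max_element[OF fin _ _ ne])
      show "transp_on Z r" by (rule transp_onI) (meson trans subsetD[OF ZI])
      show "asymp_on Z r" by (rule asymp_onI) (meson trans irrefl subsetD[OF ZI])
    qed
    then obtain m where m: "m \<in> Z" "\<forall>s\<in>Z. s \<noteq> m \<longrightarrow> \<not> r m s" by (rule bexE)
    have "\<forall>s\<in>Z. \<not> r m s"
    proof
      fix s assume "s \<in> Z"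
      then show "\<not> r m s" using m irrefl[OF subsetD[OF ZI]] by (cases "s = m") simp_all
    qed
    with m(1) have "\<exists>t\<in>Z. \<forall>s\<in>Z. \<not> r t s" by (rule bexI[rotated])
    then obtain t where t: "t \<in> Z" "\<forall>s\<in>Z. \<not> r t s" by (rule bexE)
    have tJ: "t \<in> J" using t(1) ZJ by (rule rev_subsetD)
    have tI: "t \<in> I" using tJ J(1) by (rule rev_subsetD)
    have "c s * lookup (w s) t \<in> \<aa>" if "s \<in> J - {t}" for s
    proof (cases "c s \<in> \<aa>")
      case True
      then show ?thesis using is_ideal_mult[OF \<aa>, of "c s" "lookup (w s) t"] by (simp add: mult.commute)
    next
      case False
      then have "s \<in> Z" using that by (auto simp: Z_def)
      then have "\<not> r t s" using t(2) by simp
      moreover have "s \<in> I" "s \<noteq> t" using that J(1) by auto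
      ultimately have "lookup (w s) t = 0" using piv[OF _ tI] by metis
      then show ?thesis by (simp add: is_ideal_0[OF \<aa>])
    qed
    then have "(\<Sum>s\<in>J - {t}. c s * lookup (w s) t) \<in> \<aa>" by (rule is_ideal_sum[OF \<aa>])
    moreover have "lookup p t = c t + (\<Sum>s\<in>J - {t}. c s * lookup (w s) t)"
      unfolding lp using sum.remove[OF finJ tJ, of "\<lambda>s. c s * lookup (w s) t"] one[OF tI] by simp
    ultimately have "c t \<in> \<aa>" using p(2)[OF tI] is_ideal_diff[OF \<aa>, of "lookup p t"] by fastforce
    then show False using t by (simp add: Z_def)
  qed
  then have "c s * lookup (w s) t \<in> \<aa>" if "s \<in> J" for s
    using that is_ideal_mult[OF \<aa>, of "c s" "lookup (w s) t"] by (auto simp: Z_def mult.commute)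
  then show ?thesis unfolding lp by (rule is_ideal_sum[OF \<aa>])
qed

section \<open>Terms and term orders\<close>

lemma terms_in_0 [simp]: "0 \<in> terms_in V"
  by (simp add: terms_in_def)

lemma keys_plus_nat: "keys (s + t :: 'v \<Rightarrow>\<^sub>0 nat) = keys s \<union> keys t"
  by (auto simp: in_keys_iff lookup_add)

lemma terms_in_add [simp]: "s + t \<in> terms_in V \<longleftrightarrow> s \<in> terms_in V \<and> t \<in> terms_in V"
  by (auto simp: terms_in_def keys_plus_nat)

lemma terms_in_minus: "s \<in> terms_in V \<Longrightarrow> s - t \<in> terms_in V"
  by (auto simp: terms_in_def in_keys_iff lookup_minus subset_iff)

lemma terms_in_single: "v \<in> V \<Longrightarrow> single v k \<in> terms_in V"
  by (auto simp: terms_in_def split: if_splits)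

lemma terms_in_mono: "V \<subseteq> W \<Longrightarrow> terms_in V \<subseteq> terms_in W"
  by (auto simp: terms_in_def)

lemma tdeg_superset: "finite B \<Longrightarrow> keys t \<subseteq> B \<Longrightarrow> tdeg t = (\<Sum>v\<in>B. lookup t v)"
  unfolding tdeg_def by (rule sum.mono_neutral_left) (auto simp: in_keys_iff)

lemma tdeg_0 [simp]: "tdeg 0 = 0" by (simp add: tdeg_def)

lemma tdeg_add [simp]: "tdeg (s + t) = tdeg s + tdeg t"
  using tdeg_superset[of "keys s \<union> keys t"]
  by (simp add: keys_plus_nat lookup_add sum.distrib)

lemma tdeg_single [simp]: "tdeg (single v k) = k"
  using tdeg_superset[of "{v}" "single v k"] by (auto split: if_splits)

lemma tdeg_eq_0 [simp]: "tdeg t = 0 \<longleftrightarrow> t = 0"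
  by (auto simp: tdeg_def in_keys_iff intro!: poly_mapping_eqI)

lemma lookup_le_tdeg: "lookup t v \<le> tdeg t"
proof (cases "v \<in> keys t")
  case True
  then show ?thesis unfolding tdeg_def by (intro member_le_sum) auto
qed (simp add: in_keys_iff)

lemma tdvd_imp_minus:
  assumes "tdvd s (t :: 'v \<Rightarrow>\<^sub>0 nat)" shows "t = s + (t - s)"
  using assms unfolding tdvd_def by auto

lemma tdvd_same_tdeg: "tdvd s t \<Longrightarrow> tdeg s = tdeg t \<Longrightarrow> s = t"
  unfolding tdvd_def by auto

lemma tdvd_trans: "tdvd s t \<Longrightarrow> tdvd t (u :: 'm::comm_monoid_add) \<Longrightarrow> tdvd s u"
  unfolding tdvd_def by (metis add.assoc)

lemma tdvd_add: "tdvd s t \<Longrightarrow> tdvd s (u + t :: 'm::comm_monoid_add)"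
  unfolding tdvd_def by (metis add.left_commute)

lemma finite_terms_tdeg_le:
  assumes "finite V" shows "finite {t \<in> terms_in V. tdeg t \<le> d}"
proof (rule finite_imageD)
  show "finite ((\<lambda>t. restrict (lookup t) V) ` {t \<in> terms_in V. tdeg t \<le> d})"
    by (rule finite_subset[OF _ finite_PiE[OF assms, of "\<lambda>_. {..d}"]])
      (auto intro: order_trans[OF lookup_le_tdeg])
  show "inj_on (\<lambda>t. restrict (lookup t) V) {t \<in> terms_in V. tdeg t \<le> d}"
  proof (rule inj_onI, rule poly_mapping_eqI)
    fix s t v
    assume *: "s \<in> {t \<in> terms_in V. tdeg t \<le> d}" "t \<in> {t \<in> terms_in V. tdeg t \<le> d}"
      "restrict (lookup s) V = restrict (lookup t) V"
    show "lookup s v = lookup t v"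
    proof (cases "v \<in> V")
      case True then show ?thesis using fun_cong[OF *(3), of v] by simp
    next
      case False
      then have "v \<notin> keys s" "v \<notin> keys t" using *(1,2) by (auto simp: terms_in_def)
      then show ?thesis by (simp add: in_keys_iff)
    qed
  qed
qed

text \<open>
  Only finitely many terms have a given degree, so orders that respect the degree have finite sets of predecessors,
  and these are enough for induction.
\<close>
lemma finite_predecessors_induct:
  assumes fin: "\<And>t. t \<in> M \<Longrightarrow> finite {s \<in> M. r s t}"
    and irrefl: "\<And>t. t \<in> M \<Longrightarrow> \<not> r t t"
    and trans: "\<And>s t u. s \<in> M \<Longrightarrow> t \<in> M \<Longrightarrow> u \<in> M \<Longrightarrow> r s t \<Longrightarrow> r t u \<Longrightarrow> r s u"
    and step: "\<And>t. t \<in> M \<Longrightarrow> (\<And>s. s \<in> M \<Longrightarrow> r s t \<Longrightarrow> P s) \<Longrightarrow> P t"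
    and t: "t \<in> M"
  shows "P t"
  using t
proof (induction "card {s \<in> M. r s t}" arbitrary: t rule: less_induct)
  case less
  show ?case
  proof (rule step[OF less.prems])
    fix s assume s: "s \<in> M" "r s t"
    then have "{u \<in> M. r u s} \<subset> {u \<in> M. r u t}"
      using trans[OF _ s(1) less.prems] irrefl[OF s(1)] by blast
    then show "P s" using less.hyps[OF psubset_card_mono[OF fin[OF less.prems]]] s by blast
  qed
qed

lemma term_orderD:
  assumes "term_order M prec"
  shows term_order_irrefl: "s \<in> M \<Longrightarrow> \<not> prec s s"
    and term_order_trans: "s \<in> M \<Longrightarrow> t \<in> M \<Longrightarrow> u \<in> M \<Longrightarrow> prec s t \<Longrightarrow> prec t u \<Longrightarrow> prec s u"
    and term_order_total: "s \<in> M \<Longrightarrow> t \<in> M \<Longrightarrow> s \<noteq> t \<Longrightarrow> prec s t \<or> prec t s"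
    and term_order_zero: "t \<in> M \<Longrightarrow> t \<noteq> 0 \<Longrightarrow> prec 0 t"
    and term_order_add: "s \<in> M \<Longrightarrow> t \<in> M \<Longrightarrow> u \<in> M \<Longrightarrow> prec s t \<Longrightarrow> prec (s + u) (t + u)"
  using assms unfolding term_order_def by blast+

lemma update_0_add: "Poly_Mapping.update n 0 (s + t :: 'v \<Rightarrow>\<^sub>0 nat)
    = Poly_Mapping.update n 0 s + Poly_Mapping.update n 0 t"
  by (rule poly_mapping_eqI) (simp add: lookup_update lookup_add)

lemma update_0_id: "lookup t n = 0 \<Longrightarrow> Poly_Mapping.update n 0 t = t"
  by (rule poly_mapping_eqI) (auto simp add: lookup_update)

lemma terms_lessThan_iff: "t \<in> terms_in {..<n::nat} \<longleftrightarrow> t \<in> terms_in {..n} \<and> lookup t n = 0"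
proof
  assume "t \<in> terms_in {..<n}"
  then have *: "keys t \<subseteq> {..<n}" by (simp add: terms_in_def)
  then have "n \<notin> keys t" by auto
  moreover have "keys t \<subseteq> {..n}" using * by (rule order_trans) auto
  ultimately show "t \<in> terms_in {..n} \<and> lookup t n = 0"
    by (simp add: terms_in_def not_in_keys_iff_lookup_eq_zero)
next
  assume *: "t \<in> terms_in {..n} \<and> lookup t n = 0"
  then have "n \<notin> keys t" by (simp add: in_keys_iff)
  show "t \<in> terms_in {..<n}"
    unfolding terms_in_def
  proof (rule CollectI, rule subsetI)
    fix v assume v: "v \<in> keys t"
    then have "v \<le> n" using * by (auto simp: terms_in_def)
    then show "v \<in> {..<n}" using v \<open>n \<notin> keys t\<close> le_neq_implies_less by blast
  qed
qed

lemma update_0_terms: "t \<in> terms_in {..n::nat} \<Longrightarrow> Poly_Mapping.update n 0 t \<in> terms_in {..<n}"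
  unfolding terms_lessThan_iff by (auto simp: terms_in_def keys_update lookup_update)

context
  fixes n :: nat and prec :: "xterm \<Rightarrow> xterm \<Rightarrow> bool"
  assumes ord: "term_order (terms_in {..<n}) prec"
begin

lemma graded_ext_irrefl: "t \<in> terms_in {..n} \<Longrightarrow> \<not> graded_ext n prec t t"
  unfolding graded_ext_def using term_order_irrefl[OF ord update_0_terms[of t n]] by blast

lemma graded_ext_trans:
  "\<lbrakk>s \<in> terms_in {..n}; t \<in> terms_in {..n}; u \<in> terms_in {..n};
    graded_ext n prec s t; graded_ext n prec t u\<rbrakk> \<Longrightarrow> graded_ext n prec s u"
  unfolding graded_ext_def
  using term_order_trans[OF ord update_0_terms update_0_terms update_0_terms, of s t u] by auto

lemma graded_ext_add:
  "\<lbrakk>s \<in> terms_in {..n}; t \<in> terms_in {..n}; u \<in> terms_in {..n}; graded_ext n prec s t\<rbrakk>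
    \<Longrightarrow> graded_ext n prec (u + s) (u + t)"
  unfolding graded_ext_def update_0_add lookup_add
  using term_order_add[OF ord update_0_terms update_0_terms update_0_terms, of s t u]
  by (auto simp: add.commute)

lemma graded_ext_induct:
  assumes "t \<in> terms_in {..n}"
    and "\<And>t. t \<in> terms_in {..n} \<Longrightarrow> (\<And>s. s \<in> terms_in {..n} \<Longrightarrow> graded_ext n prec s t \<Longrightarrow> P s) \<Longrightarrow> P t"
  shows "P t"
proof (rule finite_predecessors_induct[of "terms_in {..n}" "graded_ext n prec"])
  show "finite {s \<in> terms_in {..n}. graded_ext n prec s t}" for t
    by (rule finite_subset[OF _ finite_terms_tdeg_le[of "{..n}" "tdeg t"]])
      (auto simp: graded_ext_def)
qed (rule graded_ext_irrefl graded_ext_trans assms; assumption)+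

lemma degreewise_induct:
  assumes "t \<in> terms_in {..<n}"
    and "\<And>t. t \<in> terms_in {..<n} \<Longrightarrow>
       (\<And>s. s \<in> terms_in {..<n} \<Longrightarrow> tdeg s = tdeg t \<Longrightarrow> prec s t \<Longrightarrow> P s) \<Longrightarrow> P t"
  shows "P t"
proof (rule finite_predecessors_induct[of "terms_in {..<n}" "\<lambda>s t. tdeg s = tdeg t \<and> prec s t"])
  show "finite {s \<in> terms_in {..<n}. tdeg s = tdeg t \<and> prec s t}" for t
    by (rule finite_subset[OF _ finite_terms_tdeg_le[of "{..<n}" "tdeg t"]]) auto
  show "\<not> (tdeg t = tdeg t \<and> prec t t)" if "t \<in> terms_in {..<n}" for t
    using term_order_irrefl[OF ord that] by simp
  show "tdeg s = tdeg u \<and> prec s u"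
    if "s \<in> terms_in {..<n}" "t \<in> terms_in {..<n}" "u \<in> terms_in {..<n}"
      "tdeg s = tdeg t \<and> prec s t" "tdeg t = tdeg u \<and> prec t u" for s t u
    using term_order_trans[OF ord that(1-3)] that(4,5) by simp
qed (use assms in auto)

end

lemma head_termI:
  assumes "t \<in> keys p" "\<And>s. s \<in> keys p \<Longrightarrow> s \<noteq> t \<Longrightarrow> prec s t \<and> \<not> prec t s"
  shows "head_term prec p = t"
  unfolding head_term_def by (rule the_equality) (use assms in metis)+

lemma head_term_exists:
  assumes ord: "term_order M prec" and p: "keys p \<subseteq> M" "p \<noteq> 0"
  shows "head_term prec p \<in> keys p" "\<And>s. s \<in> keys p \<Longrightarrow> s \<noteq> head_term prec p \<Longrightarrow> prec s (head_term prec p)"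
proof -
  have "\<exists>t\<in>keys p. \<forall>s\<in>keys p. s \<noteq> t \<longrightarrow> prec s t"
  proof -
    have "finite B \<Longrightarrow> B \<noteq> {} \<Longrightarrow> B \<subseteq> M \<Longrightarrow> \<exists>t\<in>B. \<forall>s\<in>B. s \<noteq> t \<longrightarrow> prec s t" for B
    proof (induction B rule: finite_ne_induct)
      case (insert x B)
      then obtain t where t: "t \<in> B" "\<And>s. s \<in> B \<Longrightarrow> s \<noteq> t \<Longrightarrow> prec s t" by auto
      show ?case
      proof (cases "prec x t")
        case True then show ?thesis using t by auto
      next
        case False
        have "prec t x" using False insert t term_order_total[OF ord, of x t] by auto
        then have "prec s x" if "s \<in> B" for s
          using t that insert term_order_trans[OF ord, of s t x] by (cases "s = t") auto
        then show ?thesis by auto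
      qed
    qed auto
    then show ?thesis using p by simp
  qed
  then obtain t where t: "t \<in> keys p" "\<And>s. s \<in> keys p \<Longrightarrow> s \<noteq> t \<Longrightarrow> prec s t" by blast
  have "head_term prec p = t"
  proof (rule head_termI[OF t(1)])
    fix s assume s: "s \<in> keys p" "s \<noteq> t"
    then show "prec s t \<and> \<not> prec t s"
      using t p term_order_irrefl[OF ord] term_order_trans[OF ord, of s t s] by blast
  qed
  then show "head_term prec p \<in> keys p" "\<And>s. s \<in> keys p \<Longrightarrow> s \<noteq> head_term prec p \<Longrightarrow> prec s (head_term prec p)"
    using t by auto
qed

section \<open>Reduced Groebner bases of a homogeneous ideal\<close>

definition add_closed :: "'m::comm_monoid_add set \<Rightarrow> bool" where
  "add_closed M \<longleftrightarrow> 0 \<in> M \<and> (\<forall>s\<in>M. \<forall>t\<in>M. s + t \<in> M)"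

lemma add_closed_terms_in [simp]: "add_closed (terms_in V)"
  by (simp add: add_closed_def)

lemma keys_mult_subset: "add_closed M \<Longrightarrow> keys p \<subseteq> M \<Longrightarrow> keys q \<subseteq> M \<Longrightarrow> keys (p * q) \<subseteq> M"
  using keys_mult[of p q] unfolding add_closed_def by blast

lemma keys_add_subset: "keys p \<subseteq> M \<Longrightarrow> keys q \<subseteq> M \<Longrightarrow> keys (p + q) \<subseteq> M"
  using keys_add[of p q] by blast

lemma keys_diff_subset: "keys p \<subseteq> M \<Longrightarrow> keys (q :: 'm \<Rightarrow>\<^sub>0 'r::ab_group_add) \<subseteq> M \<Longrightarrow> keys (p - q) \<subseteq> M"
  using keys_minus_subset[of p q] by blast

lemma poly_ring_simps [simp]:
  "carrier (poly_ring M) = {p. keys p \<subseteq> M}" "mult (poly_ring M) = (*)" "one (poly_ring M) = 1"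
  "zero (poly_ring M) = 0" "add (poly_ring M) = (+)"
  by (simp_all add: poly_ring_def)

lemma cring_poly_ring: "add_closed M \<Longrightarrow> cring (poly_ring M :: ('m::comm_monoid_add \<Rightarrow>\<^sub>0 'k::field) ring)"
proof -
  assume M: "add_closed M"
  then have 0: "0 \<in> M" by (simp add: add_closed_def)
  let ?R = "poly_ring M :: ('m \<Rightarrow>\<^sub>0 'k) ring"
  have "abelian_group ?R"
  proof (rule abelian_groupI)
    fix x assume "x \<in> carrier ?R"
    then show "\<exists>y\<in>carrier ?R. y \<oplus>\<^bsub>?R\<^esub> x = \<zero>\<^bsub>?R\<^esub>" by (intro bexI[of _ "- x"]) auto
  qed (simp_all add: keys_add_subset ac_simps)
  moreover have "comm_monoid ?R"
    by (rule comm_monoidI) (simp_all add: 0 ac_simps keys_mult_subset[OF M])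
  ultimately show "cring ?R" by (rule cringI) (simp add: distrib_right)
qed

text \<open>Monomials suffice as multipliers, because every polynomial is a sum of monomials.\<close>
lemma ideal_poly_ringI:
  assumes M: "add_closed M" and I: "\<And>p. p \<in> I \<Longrightarrow> keys p \<subseteq> M" "0 \<in> I"
    "\<And>p q. p \<in> I \<Longrightarrow> q \<in> I \<Longrightarrow> p + q \<in> I"
    "\<And>u c p. u \<in> M \<Longrightarrow> p \<in> I \<Longrightarrow> single u c * p \<in> I"
  shows "ideal I (poly_ring M)"
proof -
  interpret cring "poly_ring M" by (rule cring_poly_ring[OF M])
  have mult: "q * p \<in> I" if "p \<in> I" "keys q \<subseteq> M" for p q
  proof -
    have "finite B \<Longrightarrow> B \<subseteq> M \<Longrightarrow> (\<Sum>t\<in>B. single t (lookup q t) * p) \<in> I" for B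
      by (induction B rule: finite_induct) (use I that in auto)
    from this[of "keys q"] show ?thesis
      using that poly_eq_sum_single[of q] by (simp flip: sum_distrib_right)
  qed
  have neg: "- p \<in> I" if "p \<in> I" for p
    using mult[OF that, of "-1"] M by (simp add: add_closed_def)
  have "subgroup I (add_monoid (poly_ring M))"
  proof (rule group.subgroupI[OF add.is_group])
    show "inv\<^bsub>add_monoid (poly_ring M)\<^esub> a \<in> I" if "a \<in> I" for a
    proof -
      have "\<ominus>\<^bsub>poly_ring M\<^esub> a = - a"
        by (rule minus_equality) (use I neg[OF that] that in auto)
      then show ?thesis using neg[OF that] by (simp add: a_inv_def)
    qed
  qed (use I in auto)
  then show ?thesis
    by (rule idealI[OF ring_axioms]) (use I mult in \<open>auto simp: mult.commute\<close>)
qed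

lemma ideal_poly_ringD:
  assumes "ideal I (poly_ring M)"
  shows ideal_keys: "p \<in> I \<Longrightarrow> keys p \<subseteq> M" and ideal_zero: "0 \<in> I"
    and ideal_add: "p \<in> I \<Longrightarrow> q \<in> I \<Longrightarrow> p + q \<in> I"
    and ideal_mult: "p \<in> I \<Longrightarrow> keys q \<subseteq> M \<Longrightarrow> q * p \<in> I"
proof -
  interpret ideal I "poly_ring M" by fact
  show "p \<in> I \<Longrightarrow> keys p \<subseteq> M" "0 \<in> I" "p \<in> I \<Longrightarrow> q \<in> I \<Longrightarrow> p + q \<in> I"
    using a_Hcarr additive_subgroup.zero_closed[OF is_additive_subgroup]
      additive_subgroup.a_closed[OF is_additive_subgroup] by auto
  show "p \<in> I \<Longrightarrow> keys q \<subseteq> M \<Longrightarrow> q * p \<in> I" using I_l_closed[of p q] by simp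
qed

lemma ideal_single_mult: "ideal I (poly_ring M) \<Longrightarrow> p \<in> I \<Longrightarrow> u \<in> M \<Longrightarrow> single u c * p \<in> I"
  by (rule ideal_mult) auto

lemma ideal_subspace: "ideal I (poly_ring M) \<Longrightarrow> 0 \<in> M \<Longrightarrow> pm.subspace I"
  by (rule pm.subspaceI) (auto simp: smul_def ideal_zero ideal_add ideal_single_mult)

lemma genideal_poly_ring:
  assumes "add_closed M" "S \<subseteq> carrier (poly_ring M)"
  shows "ideal (Idl\<^bsub>poly_ring M\<^esub> S) (poly_ring M)" "S \<subseteq> Idl\<^bsub>poly_ring M\<^esub> S"
    "\<And>I. ideal I (poly_ring M) \<Longrightarrow> S \<subseteq> I \<Longrightarrow> Idl\<^bsub>poly_ring M\<^esub> S \<subseteq> I"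
proof -
  interpret cring "poly_ring M" by (rule cring_poly_ring[OF assms(1)])
  show "ideal (Idl\<^bsub>poly_ring M\<^esub> S) (poly_ring M)" "S \<subseteq> Idl\<^bsub>poly_ring M\<^esub> S"
    "\<And>I. ideal I (poly_ring M) \<Longrightarrow> S \<subseteq> I \<Longrightarrow> Idl\<^bsub>poly_ring M\<^esub> S \<subseteq> I"
    using genideal_ideal[OF assms(2)] genideal_self[OF assms(2)] by (simp_all add: genideal_minimal)
qed

text \<open>
  These ideals bound the monomial ideals generated by \<open>S\<close> from above: all their elements have only terms divisible
  by \<open>S\<close>.
\<close>
lemma divisible_ideal:
  "add_closed M \<Longrightarrow> ideal {p. keys p \<subseteq> M \<and> (\<forall>t\<in>keys p. \<exists>s\<in>S. tdvd s t)} (poly_ring M)"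
proof (rule ideal_poly_ringI, goal_cases)
  case (4 p q)
  then show ?case using keys_add[of p q] by blast
next
  case (5 u c p)
  have "u + t \<in> M" "\<exists>s\<in>S. tdvd s (u + t)" if "t \<in> keys p" for t
    using 5 that tdvd_add unfolding add_closed_def by blast+
  then show ?case using keys_single_mult[of u c p] by blast
qed auto

lemma initial_ideal_heads:
  assumes M: "add_closed M" and heads: "\<And>p. p \<in> I \<Longrightarrow> p \<noteq> 0 \<Longrightarrow> head_term prec p \<in> M"
  shows "ideal (initial_ideal M prec I) (poly_ring M)"
    and "p \<in> I \<Longrightarrow> p \<noteq> 0 \<Longrightarrow> single (head_term prec p) 1 \<in> initial_ideal M prec I"
    and "initial_ideal M prec I
        \<subseteq> {q. keys q \<subseteq> M \<and> (\<forall>t\<in>keys q. \<exists>s\<in>{head_term prec p |p. p \<in> I \<and> p \<noteq> 0}. tdvd s t)}"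
proof -
  have sub: "{single (head_term prec p) 1 | p. p \<in> I \<and> p \<noteq> 0} \<subseteq> carrier (poly_ring M)"
    using heads by auto
  note gen = genideal_poly_ring[OF M sub]
  show "ideal (initial_ideal M prec I) (poly_ring M)" unfolding initial_ideal_def by (rule gen)
  show "p \<in> I \<Longrightarrow> p \<noteq> 0 \<Longrightarrow> single (head_term prec p) 1 \<in> initial_ideal M prec I"
    unfolding initial_ideal_def using gen(2) by blast
  show "initial_ideal M prec I
        \<subseteq> {q. keys q \<subseteq> M \<and> (\<forall>t\<in>keys q. \<exists>s\<in>{head_term prec p |p. p \<in> I \<and> p \<noteq> 0}. tdvd s t)}"
    unfolding initial_ideal_def
  proof (rule gen(3)[OF divisible_ideal[OF M]], clarsimp)
    fix p assume "p \<in> I" "p \<noteq> 0"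
    moreover have "tdvd t t" for t :: 'a unfolding tdvd_def by (rule exI[of _ 0]) simp
    ultimately show "head_term prec p \<in> M \<and>
       (\<exists>s. (\<exists>p. s = head_term prec p \<and> p \<in> I \<and> p \<noteq> 0) \<and> tdvd s (head_term prec p))"
      using heads by blast
  qed
qed

lemma min_gens_divides:
  fixes t :: "'v \<Rightarrow>\<^sub>0 nat"
  assumes "t \<in> M" "single t 1 \<in> I"
  shows "\<exists>s\<in>min_gens M I. tdvd s t"
  using assms
proof (induction "tdeg t" arbitrary: t rule: less_induct)
  case less
  show ?case
  proof (cases "t \<in> min_gens M I")
    case True
    then show ?thesis unfolding tdvd_def by (metis add.right_neutral)
  next
    case False
    then obtain s where s: "s \<in> M" "single s 1 \<in> I" "tdvd s t" "s \<noteq> t"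
      using less.prems by (auto simp: min_gens_def)
    obtain u where u: "t = s + u" using s(3) unfolding tdvd_def by blast
    have "tdeg u \<noteq> 0" using s(4) u by auto
    then have "0 < tdeg u" by blast
    then have "tdeg s < tdeg t" by (simp add: u del: tdeg_eq_0)
    then show ?thesis using less.hyps[of s] s tdvd_trans by blast
  qed
qed

definition part :: "('m \<Rightarrow> bool) \<Rightarrow> ('m \<Rightarrow>\<^sub>0 'r::comm_ring_1) \<Rightarrow> ('m \<Rightarrow>\<^sub>0 'r)" where
  "part P p = (\<Sum>t\<in>keys p. single t (lookup p t when P t))"

lemma lookup_part [simp]: "lookup (part P p) t = (lookup p t when P t)"
proof -
  have "lookup (part P p) t = (\<Sum>s\<in>keys p. if s = t then (lookup p t when P t) else 0)"
    unfolding part_def by (auto simp: lookup_sum lookup_single when_def intro!: sum.cong)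
  also have "\<dots> = (lookup p t when P t)" by (simp add: in_keys_iff)
  finally show ?thesis .
qed

lemma keys_part: "keys (part P p) = {t \<in> keys p. P t}"
  by (auto simp: in_keys_iff)

abbreviation hom_component :: "nat \<Rightarrow> (('v \<Rightarrow>\<^sub>0 nat) \<Rightarrow>\<^sub>0 'r::comm_ring_1) \<Rightarrow> (('v \<Rightarrow>\<^sub>0 nat) \<Rightarrow>\<^sub>0 'r)" where
  "hom_component d \<equiv> part (\<lambda>t. tdeg t = d)"

text \<open>
  The polynomials all of whose components lie in \<open>I\<close> form an ideal, and it contains the homogeneous
  generators of \<open>I\<close>.
\<close>
lemma homogeneous_ideal_component:
  assumes "homogeneous_ideal (terms_in V) I" "p \<in> I"
  shows "hom_component d p \<in> I"
proof -
  obtain S where S: "S \<subseteq> carrier (poly_ring (terms_in V))" "\<forall>p\<in>S. \<exists>d. homogeneous d p"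
      "I = Idl\<^bsub>poly_ring (terms_in V)\<^esub> S" and I: "ideal I (poly_ring (terms_in V))"
    using assms unfolding homogeneous_ideal_def by blast
  note idl = genideal_poly_ring[OF add_closed_terms_in S(1)]
  let ?Q = "{p. keys p \<subseteq> terms_in V \<and> (\<forall>d. hom_component d p \<in> I)}"
  have "ideal ?Q (poly_ring (terms_in V))"
  proof (rule ideal_poly_ringI[OF add_closed_terms_in])
    have "hom_component d 0 = (0 :: ('a \<Rightarrow>\<^sub>0 nat) \<Rightarrow>\<^sub>0 'b)" for d by (rule poly_mapping_eqI) simp
    then show "0 \<in> ?Q" by (simp add: ideal_zero[OF I])
  next
    fix p q assume pq: "p \<in> ?Q" "q \<in> ?Q"
    have "hom_component d (p + q) = hom_component d p + hom_component d q" for d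
      by (rule poly_mapping_eqI) (simp add: lookup_add when_add_distrib)
    then show "p + q \<in> ?Q" using pq by (auto simp: ideal_add[OF I] keys_add_subset)
  next
    fix u c p assume u: "u \<in> terms_in V" and p: "p \<in> ?Q"
    have "hom_component d (single u c * p) \<in> I" for d
    proof (cases "tdeg u \<le> d")
      case True
      have "hom_component d (single u c * p) = single u c * hom_component (d - tdeg u) p"
      proof (rule poly_mapping_eqI)
        fix t
        show "lookup (hom_component d (single u c * p)) t = lookup (single u c * hom_component (d - tdeg u) p) t"
        proof (cases "\<exists>s. t = u + s")
          case True
          then show ?thesis using \<open>tdeg u \<le> d\<close> by (auto simp: lookup_single_mult when_def)
        next
          case False
          then have "lookup (single u c * q) t = 0" for q by (intro lookup_single_mult_eq_0) auto
          then show ?thesis by simp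
        qed
      qed
      then show ?thesis using p u ideal_single_mult[OF I] by auto
    next
      case False
      have "hom_component d (single u c * p) = 0"
      proof (rule poly_mapping_eqI)
        fix t
        show "lookup (hom_component d (single u c * p)) t = lookup 0 t"
          using False lookup_single_mult_eq_0[of t u c p] by (auto simp: when_def) (metis le_add1 tdeg_add)
      qed
      then show ?thesis by (simp add: ideal_zero[OF I])
    qed
    moreover have "keys (single u c * p) \<subseteq> terms_in V"
      using u p by (intro keys_mult_subset) auto
    ultimately show "single u c * p \<in> ?Q" by simp
  qed auto
  moreover have "S \<subseteq> ?Q"
  proof
    fix p assume p: "p \<in> S"
    then obtain e where e: "homogeneous e p" using S by blast
    have "hom_component d p = (if d = e then p else 0)" for d
      by (rule poly_mapping_eqI) (use e in \<open>auto simp: homogeneous_def in_keys_iff when_def\<close>)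
    then show "p \<in> ?Q" using p S idl(2) by (auto simp: ideal_zero[OF I])
  qed
  ultimately have "I \<subseteq> ?Q" using idl(3) S(3) by blast
  then show ?thesis using assms(2) by blast
qed

text \<open>
  The main theorem instantiates this setting twice, for two orders and the same \<open>H\<close>.
\<close>
locale homogeneous_gb =
  fixes n :: nat and prec :: "xterm \<Rightarrow> xterm \<Rightarrow> bool" and H :: "(xterm \<Rightarrow>\<^sub>0 'k::field) set"
    and f :: "xterm \<Rightarrow> (xterm \<Rightarrow>\<^sub>0 'k)"
  assumes H: "homogeneous_ideal (terms_in {..<n}) H"
    and ord: "term_order (terms_in {..<n}) prec"
    and f: "reduced_gb_family n prec H f"
begin

abbreviation A :: "xterm set" where "A \<equiv> in_gens n prec H"

definition normal :: "xterm \<Rightarrow> bool" where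
  "normal t \<longleftrightarrow> (\<forall>\<alpha>\<in>A. \<not> tdvd \<alpha> t)"

lemma H_ideal: "ideal H (poly_ring (terms_in {..<n}))"
  using H by (simp add: homogeneous_ideal_def)

lemma keys_H: "p \<in> H \<Longrightarrow> keys p \<subseteq> terms_in {..<n}"
  by (rule ideal_keys[OF H_ideal])

lemma H_subspace: "pm.subspace H"
  by (rule ideal_subspace[OF H_ideal]) simp

lemma H_head: "p \<in> H \<Longrightarrow> p \<noteq> 0 \<Longrightarrow> head_term prec p \<in> keys p"
  "p \<in> H \<Longrightarrow> s \<in> keys p \<Longrightarrow> s \<noteq> head_term prec p \<Longrightarrow> prec s (head_term prec p)"
  using head_term_exists[OF ord keys_H, of p] by (cases "p = 0"; auto)+

lemma H_head_terms: "p \<in> H \<Longrightarrow> p \<noteq> 0 \<Longrightarrow> head_term prec p \<in> terms_in {..<n}"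
  using H_head(1) keys_H by blast

lemma in_H:
  shows "ideal (initial_ideal (terms_in {..<n}) prec H) (poly_ring (terms_in {..<n}))"
    and "p \<in> H \<Longrightarrow> p \<noteq> 0 \<Longrightarrow> single (head_term prec p) 1 \<in> initial_ideal (terms_in {..<n}) prec H"
    and "initial_ideal (terms_in {..<n}) prec H \<subseteq> {q. keys q \<subseteq> terms_in {..<n} \<and>
        (\<forall>t\<in>keys q. \<exists>s\<in>{head_term prec p |p. p \<in> H \<and> p \<noteq> 0}. tdvd s t)}"
  using initial_ideal_heads[of "terms_in {..<n}" H prec] H_head_terms by simp_all

lemma A_terms: "\<alpha> \<in> A \<Longrightarrow> \<alpha> \<in> terms_in {..<n}"
  by (simp add: in_gens_def min_gens_def)

lemma head_term_divisible:
  assumes "p \<in> H" "p \<noteq> 0" shows "\<not> normal (head_term prec p)"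
  using min_gens_divides[OF H_head_terms[OF assms] in_H(2)[OF assms]]
  by (auto simp: normal_def in_gens_def)

lemma normal_H_eq_0: "p \<in> H \<Longrightarrow> (\<And>t. t \<in> keys p \<Longrightarrow> normal t) \<Longrightarrow> p = 0"
  using head_term_divisible H_head(1) by blast

lemma initial_ideal_divisible: "p \<in> initial_ideal (terms_in {..<n}) prec H \<Longrightarrow> t \<in> keys p \<Longrightarrow> \<not> normal t"
proof -
  assume "p \<in> initial_ideal (terms_in {..<n}) prec H" "t \<in> keys p"
  then obtain h where h: "h \<in> H" "h \<noteq> 0" "tdvd (head_term prec h) t" using in_H(3) by blast
  then show "\<not> normal t" using head_term_divisible[OF h(1,2)] tdvd_trans unfolding normal_def by blast
qed

lemma normal_ext_iff: "t \<in> normal_ext n prec H \<longleftrightarrow> t \<in> terms_in {..n} \<and> normal t"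
proof -
  let ?I = "initial_ideal (terms_in {..<n}) prec H"
  have T: "terms_in {..<n} \<subseteq> terms_in {..n}" by (rule terms_in_mono) auto
  have "?I \<subseteq> carrier (poly_ring (terms_in {..n}))"
    using T ideal_keys[OF in_H(1)] by auto
  note gen = genideal_poly_ring[OF add_closed_terms_in this]
  have "?I \<subseteq> {p. keys p \<subseteq> terms_in {..n} \<and> (\<forall>t\<in>keys p. \<exists>s\<in>A. tdvd s t)}"
    using T ideal_keys[OF in_H(1)] initial_ideal_divisible unfolding normal_def by fastforce
  from gen(3)[OF divisible_ideal[OF add_closed_terms_in] this]
  have 1: "\<not> normal t" if "single t 1 \<in> Idl\<^bsub>poly_ring (terms_in {..n})\<^esub> ?I"
    using that by (auto simp: normal_def)
  have 2: "single t 1 \<in> Idl\<^bsub>poly_ring (terms_in {..n})\<^esub> ?I" if t: "t \<in> terms_in {..n}" "\<not> normal t"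
  proof -
    obtain \<alpha> u where \<alpha>: "\<alpha> \<in> A" "t = \<alpha> + u" using t(2) by (auto simp: normal_def tdvd_def)
    then have "single \<alpha> 1 \<in> Idl\<^bsub>poly_ring (terms_in {..n})\<^esub> ?I"
      using gen(2) by (auto simp: in_gens_def min_gens_def)
    from ideal_single_mult[OF gen(1) this, of u 1] show ?thesis
      using t \<alpha> by (simp add: mult_single add.commute)
  qed
  show ?thesis using 1 2 by (auto simp: normal_ext_def normal_terms_def)
qed

lemma f_props:
  assumes \<alpha>: "\<alpha> \<in> A"
  shows f_in_H: "f \<alpha> \<in> H"
    and f_less: "\<And>s. s \<in> keys (f \<alpha>) \<Longrightarrow> s \<noteq> \<alpha> \<Longrightarrow> prec s \<alpha>"
    and f_lc: "lookup (f \<alpha>) \<alpha> = 1"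
    and f_reduced: "\<And>s. s \<in> keys (f \<alpha>) \<Longrightarrow> s \<noteq> \<alpha> \<Longrightarrow> normal s"
proof -
  have gb: "f ` A \<subseteq> H" and lc: "head_coeff prec (f \<alpha>) = 1"
    and red: "\<forall>g\<in>f ` A. \<forall>g'\<in>f ` A - {g}. \<forall>t\<in>keys g. \<not> tdvd (head_term prec g') t"
    and ht: "\<And>\<alpha>. \<alpha> \<in> A \<Longrightarrow> head_term prec (f \<alpha>) = \<alpha>"
    using f \<alpha> by (auto simp: reduced_gb_family_def reduced_groebner_basis_def groebner_basis_def)
  show fH: "f \<alpha> \<in> H" using gb \<alpha> by auto
  show less: "prec s \<alpha>" if "s \<in> keys (f \<alpha>)" "s \<noteq> \<alpha>" for s
    using H_head(2)[OF fH that(1)] ht[OF \<alpha>] that by simp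
  show "lookup (f \<alpha>) \<alpha> = 1" using lc ht[OF \<alpha>] by (simp add: head_coeff_def)
  show "normal s" if s: "s \<in> keys (f \<alpha>)" "s \<noteq> \<alpha>" for s
    unfolding normal_def
  proof
    fix \<alpha>' assume \<alpha>': "\<alpha>' \<in> A"
    show "\<not> tdvd \<alpha>' s"
    proof (cases "\<alpha>' = \<alpha>")
      case True
      \<comment> \<open>Reducedness compares \<open>f \<alpha>\<close> only with the other elements; a proper multiple of \<open>\<alpha>\<close> is greater than \<open>\<alpha>\<close>.\<close>
      show ?thesis
      proof
        assume "tdvd \<alpha>' s"
        then obtain u where u: "s = \<alpha> + u" unfolding tdvd_def True by blast
        have sT: "s \<in> terms_in {..<n}" using keys_H[OF fH] s by blast
        then have uT: "u \<in> terms_in {..<n}" "u \<noteq> 0" using u s by auto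
        from term_order_add[OF ord _ uT(1) A_terms[OF \<alpha>] term_order_zero[OF ord uT]]
        have "prec \<alpha> s" by (simp add: u add.commute)
        then show False using less[OF s] term_order_trans[OF ord sT A_terms[OF \<alpha>] sT]
            term_order_irrefl[OF ord sT] by blast
      qed
    next
      case False
      then have "f \<alpha>' \<noteq> f \<alpha>" using ht[OF \<alpha>] ht[OF \<alpha>'] by metis
      then have "f \<alpha>' \<in> f ` A - {f \<alpha>}" using \<alpha>' by simp
      from red[THEN bspec, OF imageI[OF \<alpha>], THEN bspec, OF this, THEN bspec, OF s(1)]
      show ?thesis by (simp add: ht[OF \<alpha>'])
    qed
  qed
qed

lemma keys_f: "\<alpha> \<in> A \<Longrightarrow> keys (f \<alpha>) \<subseteq> terms_in {..<n}"
  using keys_H[OF f_in_H] .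

text \<open>
  The part of \<open>f \<alpha>\<close> outside degree \<open>|\<alpha>|\<close> lies in \<open>H\<close>, but all its terms are normal, so it is zero.
\<close>
lemma f_homogeneous:
  assumes \<alpha>: "\<alpha> \<in> A" and s: "s \<in> keys (f \<alpha>)" shows "tdeg s = tdeg \<alpha>"
proof -
  let ?g = "f \<alpha> - hom_component (tdeg \<alpha>) (f \<alpha>)"
  have "?g \<in> H"
    by (rule pm.subspace_diff[OF H_subspace f_in_H[OF \<alpha>] homogeneous_ideal_component[OF H f_in_H[OF \<alpha>]]])
  moreover have "normal t" if "t \<in> keys ?g" for t
    using that f_reduced[OF \<alpha>, of t] by (auto simp: in_keys_iff lookup_minus when_def split: if_splits)
  ultimately have "?g = 0" by (rule normal_H_eq_0)
  then have "lookup ?g s = 0" by simp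
  then show ?thesis using s by (auto simp: lookup_minus when_def in_keys_iff split: if_splits)
qed

definition f_multiples :: "nat \<Rightarrow> (xterm \<Rightarrow>\<^sub>0 'k) set" where
  "f_multiples d = {single u 1 * f \<alpha> | u \<alpha>. u \<in> terms_in {..<n} \<and> \<alpha> \<in> A \<and> tdeg (u + \<alpha>) = d}"

definition normal_monomials :: "nat \<Rightarrow> (xterm \<Rightarrow>\<^sub>0 'k) set" where
  "normal_monomials d = {single t 1 | t. t \<in> terms_in {..<n} \<and> normal t \<and> tdeg t = d}"

lemma f_multiples_H: "pm.span (f_multiples d) \<subseteq> H"
  by (rule pm.span_minimal[OF _ H_subspace])
    (auto simp: f_multiples_def intro!: ideal_single_mult[OF H_ideal] f_in_H)

lemma f_multiples_tdeg: "p \<in> f_multiples d \<Longrightarrow> t \<in> keys p \<Longrightarrow> tdeg t = d"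
  using keys_single_mult f_homogeneous by (fastforce simp: f_multiples_def)

lemma normal_monomials_span:
  assumes "p \<in> pm.span (normal_monomials d)" "t \<in> keys p"
  shows "t \<in> terms_in {..<n}" "normal t" "tdeg t = d"
proof -
  have "p \<in> {p. \<forall>t\<in>keys p. t \<in> terms_in {..<n} \<and> normal t \<and> tdeg t = d}" (is "_ \<in> ?Q")
    using assms(1)
  proof (rule rev_subsetD[OF _ pm.span_minimal])
    show "normal_monomials d \<subseteq> ?Q" by (auto simp: normal_monomials_def)
    show "pm.subspace ?Q"
    proof (rule pm.subspaceI)
      show "x + y \<in> ?Q" if "x \<in> ?Q" "y \<in> ?Q" for x y using that keys_add[of x y] by blast
      show "smul c x \<in> ?Q" if "x \<in> ?Q" for c x using that by (auto simp: in_keys_iff)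
    qed auto
  qed
  then show "t \<in> terms_in {..<n}" "normal t" "tdeg t = d" using assms(2) by auto
qed

text \<open>
  Division by the \<open>f \<alpha>\<close> stays within one degree.  There it ends for any term order, because only
  finitely many terms are available.
\<close>
lemma division:
  assumes "t \<in> terms_in {..<n}"
  shows "single t 1 \<in> pm.span (f_multiples (tdeg t) \<union> normal_monomials (tdeg t))"
  using assms
proof (induction t rule: degreewise_induct[OF ord, consumes 1, case_names step])
  case (step t)
  show ?case
  proof (cases "normal t")
    case True
    then show ?thesis using step by (intro pm.span_base) (auto simp: normal_monomials_def)
  next
    case False
    then obtain \<alpha> u where \<alpha>: "\<alpha> \<in> A" and t: "t = \<alpha> + u" by (auto simp: normal_def tdvd_def)
    have uT: "u \<in> terms_in {..<n}" using step t by simp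
    let ?S = "f_multiples (tdeg t) \<union> normal_monomials (tdeg t)"
    let ?q = "f \<alpha> - single \<alpha> 1"
    have "single u 1 * ?q = (\<Sum>s\<in>keys ?q. smul (lookup ?q s) (single (u + s) 1))"
      by (subst poly_eq_sum_single[of ?q]) (simp add: sum_distrib_left mult_single smul_def)
    also have "\<dots> \<in> pm.span ?S"
    proof (intro pm.span_sum pm.span_scale)
      fix s assume "s \<in> keys ?q"
      then have s: "s \<in> keys (f \<alpha>)" "s \<noteq> \<alpha>"
        using f_lc[OF \<alpha>] by (auto simp: in_keys_iff lookup_minus lookup_single when_def split: if_splits)
      have sT: "s \<in> terms_in {..<n}" using s keys_f[OF \<alpha>] by blast
      have "prec (u + s) t"
        using term_order_add[OF ord sT A_terms[OF \<alpha>] uT f_less[OF \<alpha> s]] by (simp add: t add.commute)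
      moreover have "tdeg (u + s) = tdeg t" using f_homogeneous[OF \<alpha> s(1)] t by simp
      ultimately show "single (u + s) 1 \<in> pm.span ?S"
        using step(2)[of "u + s"] uT sT by simp
    qed
    finally have "single u 1 * ?q \<in> pm.span ?S" .
    moreover have "single u 1 * f \<alpha> \<in> pm.span ?S"
    proof (rule pm.span_base, rule UnI1, unfold f_multiples_def, rule CollectI, intro exI conjI)
      show "tdeg (u + \<alpha>) = tdeg t" by (simp add: t)
    qed (use \<alpha> uT in auto)
    moreover have "single t 1 = single u 1 * f \<alpha> - single u 1 * ?q"
      by (simp add: algebra_simps mult_single t)
    ultimately show ?thesis by (simp add: pm.span_diff)
  qed
qed

text \<open>
  The remainder of the division of an element of \<open>H\<close> is a normal element of \<open>H\<close>, hence zero.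
\<close>
lemma homogeneous_H_span:
  assumes p: "p \<in> H" "\<And>t. t \<in> keys p \<Longrightarrow> tdeg t = d"
  shows "p \<in> pm.span (f_multiples d)"
proof -
  have "p = (\<Sum>t\<in>keys p. smul (lookup p t) (single t 1))"
    using poly_eq_sum_single[of p] by (simp add: smul_def mult_single)
  also have "\<dots> \<in> pm.span (f_multiples d \<union> normal_monomials d)"
    using division p keys_H[OF p(1)] by (intro pm.span_sum pm.span_scale) blast
  finally obtain a b where ab: "p = a + b" "a \<in> pm.span (f_multiples d)" "b \<in> pm.span (normal_monomials d)"
    by (auto simp: pm.span_Un)
  have "b \<in> H" using pm.subspace_diff[OF H_subspace p(1), of a] ab f_multiples_H by auto
  then have "b = 0" using normal_H_eq_0 normal_monomials_span(2)[OF ab(3)] by blast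
  then show ?thesis using ab by simp
qed

text \<open>
  \<open>H\<close> has a basis \<open>t - (normal form of t)\<close>, where \<open>t\<close> runs over the terms in the initial ideal.
  It is in echelon form, and so its elements stay independent after any change of scalars and modulo any ideal.
\<close>
lemma extended_H_coeffs:
  fixes \<theta> :: "'k \<Rightarrow> 'r::comm_ring_1"
  assumes \<theta>: "ring_map \<theta>" and \<aa>: "is_ideal \<aa>"
    and p: "p \<in> pm.span (map_coeffs \<theta> ` H)" "\<And>t. t \<in> terms_in {..<n} \<Longrightarrow> \<not> normal t \<Longrightarrow> lookup p t \<in> \<aa>"
  shows "lookup p t \<in> \<aa>"
proof -
  let ?I = "{t \<in> terms_in {..<n}. \<not> normal t}"
  have "\<forall>t\<in>?I. \<exists>w. w \<in> H \<and> (\<forall>s\<in>?I. lookup w s = (1 when s = t))"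
  proof
    fix t assume t: "t \<in> ?I"
    with division[of t] obtain a b where ab: "single t 1 = a + b" "a \<in> pm.span (f_multiples (tdeg t))"
       "b \<in> pm.span (normal_monomials (tdeg t))"
      by (auto simp: pm.span_Un)
    have "lookup a s = (1 when s = t)" if "s \<in> ?I" for s
    proof -
      have "lookup b s = 0" using normal_monomials_span(2)[OF ab(3), of s] that by (auto simp: in_keys_iff)
      then have "lookup a s = lookup (single t 1) s" by (simp add: ab(1) lookup_add)
      then show ?thesis by (simp add: lookup_single when_def eq_commute)
    qed
    then show "\<exists>w. w \<in> H \<and> (\<forall>s\<in>?I. lookup w s = (1 when s = t))" using ab(2) f_multiples_H by blast
  qed
  from bchoice[OF this] obtain w where
    "\<forall>t\<in>?I. w t \<in> H \<and> (\<forall>s\<in>?I. lookup (w t) s = (1 when s = t))" ..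
  then have w: "\<And>t. t \<in> ?I \<Longrightarrow> w t \<in> H"
      "\<And>t s. t \<in> ?I \<Longrightarrow> s \<in> ?I \<Longrightarrow> lookup (w t) s = (1 when s = t)"
    by simp_all
  have H_span: "h \<in> pm.span (w ` ?I)" if h: "h \<in> H" for h
  proof -
    let ?g = "\<Sum>t\<in>keys h \<inter> ?I. smul (lookup h t) (w t)"
    have g: "?g \<in> pm.span (w ` ?I)" by (intro pm.span_sum pm.span_scale pm.span_base) auto
    have "?g \<in> H" by (intro pm.subspace_sum[OF H_subspace] pm.subspace_scale[OF H_subspace] w) auto
    then have diff: "h - ?g \<in> H" by (rule pm.subspace_diff[OF H_subspace h])
    have "normal t" if "t \<in> keys (h - ?g)" for t
    proof (rule ccontr)
      assume nt: "\<not> normal t"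
      have tI: "t \<in> ?I" using that keys_H[OF diff] nt by auto
      have "lookup ?g t = (\<Sum>s\<in>keys h \<inter> ?I. lookup h s * lookup (w s) t)" by (simp add: lookup_sum)
      also have "\<dots> = (\<Sum>s\<in>keys h \<inter> ?I. if s = t then lookup h s else 0)"
        using w(2)[OF _ tI] by (intro sum.cong) (auto simp: when_def)
      also have "\<dots> = lookup h t" using tI by (auto simp: sum.delta in_keys_iff)
      finally show False using that by (simp add: in_keys_iff lookup_minus)
    qed
    then have "h - ?g = 0" by (rule normal_H_eq_0[OF diff])
    then show ?thesis using g by simp
  qed
  have "pm.span (map_coeffs \<theta> ` H) \<subseteq> pm.span ((\<lambda>t. map_coeffs \<theta> (w t)) ` ?I)"
  proof (rule pm.span_minimal[OF _ pm.subspace_span], rule image_subsetI)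
    fix h assume "h \<in> H"
    show "map_coeffs \<theta> h \<in> pm.span ((\<lambda>t. map_coeffs \<theta> (w t)) ` ?I)"
      by (rule span_semilinear[OF _ _ _ _ H_span[OF \<open>h \<in> H\<close>], where \<theta> = \<theta>])
        (auto simp: ring_map_add[OF map_coeffs_ring_map[OF \<theta>]] ring_map_0[OF map_coeffs_ring_map[OF \<theta>]]
          map_coeffs_smul[OF \<theta>] intro!: pm.span_base)
  qed
  then have p_span: "p \<in> pm.span ((\<lambda>t. map_coeffs \<theta> (w t)) ` ?I)" using p(1) by (rule subsetD)
  show ?thesis
  proof (rule echelon_coeffs[OF \<aa> _ _ _ _ p_span, where r = "\<lambda>s t. False"])
    fix s t assume "s \<in> ?I" "t \<in> ?I" "s \<noteq> t" "lookup (map_coeffs \<theta> (w s)) t \<noteq> 0"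
    then show False by (simp add: \<theta> w(2) ring_map_0[OF \<theta>])
  qed (simp_all add: \<theta> w(2) ring_map_1[OF \<theta>] p(2))
qed

text \<open>
  The generators of the initial ideal do not contain \<open>x\<^sub>n\<close>.
\<close>
lemma normal_xvar: "normal (xvar n + t) \<longleftrightarrow> normal t"
proof -
  have "tdvd \<alpha> (xvar n + t) \<longleftrightarrow> tdvd \<alpha> t" if "\<alpha> \<in> A" for \<alpha>
  proof
    assume *: "tdvd \<alpha> (xvar n + t)"
    have "t = \<alpha> + (t - \<alpha>)"
    proof (rule poly_mapping_eqI)
      fix v
      show "lookup t v = lookup (\<alpha> + (t - \<alpha>)) v"
        using arg_cong[OF tdvd_imp_minus[OF *], of "\<lambda>p. lookup p v"] A_terms[OF that]
        by (auto simp: terms_lessThan_iff lookup_add lookup_minus lookup_single when_def split: if_splits)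
    qed
    then show "tdvd \<alpha> t" unfolding tdvd_def by blast
  qed (rule tdvd_add)
  then show ?thesis by (auto simp: normal_def)
qed

end

section \<open>Liftings of a homogeneous ideal over a ring of parameters\<close>

lemma xterm_split: "0 < lookup t n \<Longrightarrow> t = xvar n + (t - xvar n)"
  by (rule poly_mapping_eqI) (auto simp: lookup_add lookup_minus lookup_single when_def)

lemma term_lcm_xterm:
  fixes s t u :: "'v \<Rightarrow>\<^sub>0 nat"
  shows "term_lcm s t - s = t - s" and "term_lcm s t - t = s - t"
    and "tdvd s u \<Longrightarrow> tdvd t u \<Longrightarrow> u = term_lcm s t + (u - term_lcm s t)"
    and "term_lcm s t = s + (t - s)" and "term_lcm s t = t + (s - t)"
proof -
  show "term_lcm s t - s = t - s" "term_lcm s t - t = s - t"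
    by (rule poly_mapping_eqI; simp add: term_lcm_def lookup_add lookup_minus)+
  show "term_lcm s t = s + (t - s)" by (simp add: term_lcm_def)
  show "term_lcm s t = t + (s - t)"
    by (rule poly_mapping_eqI) (simp add: term_lcm_def lookup_add lookup_minus)
  assume dvd: "tdvd s u" "tdvd t u"
  note u = dvd[THEN tdvd_imp_minus]
  show "u = term_lcm s t + (u - term_lcm s t)"
  proof (rule poly_mapping_eqI)
    fix x
    show "lookup u x = lookup (term_lcm s t + (u - term_lcm s t)) x"
      using arg_cong[OF u(1), of "\<lambda>p. lookup p x"] arg_cong[OF u(2), of "\<lambda>p. lookup p x"]
      unfolding term_lcm_def lookup_add lookup_minus by arith
  qed
qed

lemma span_keys:
  assumes "\<And>b. b \<in> B \<Longrightarrow> keys b \<subseteq> M" "p \<in> pm.span B" shows "keys p \<subseteq> M"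
  using assms(2)
proof (induction rule: pm.span_induct_alt)
  case (step c x y)
  have "keys (smul c x) \<subseteq> keys x" by (auto simp: in_keys_iff)
  then show ?case using step assms(1) by (intro keys_add_subset) auto
qed simp

lemma span_monomials: "(\<And>t. t \<in> keys p \<Longrightarrow> single t 1 \<in> pm.span B) \<Longrightarrow> p \<in> pm.span B"
proof -
  assume *: "\<And>t. t \<in> keys p \<Longrightarrow> single t 1 \<in> pm.span B"
  have "p = (\<Sum>t\<in>keys p. smul (lookup p t) (single t 1))"
    using poly_eq_sum_single[of p] by (simp add: smul_def mult_single)
  also have "\<dots> \<in> pm.span B" by (intro pm.span_sum pm.span_scale *)
  finally show ?thesis .
qed

lemma span_single_mult:
  assumes "\<And>b. b \<in> B \<Longrightarrow> single u 1 * b \<in> pm.span B'" "p \<in> pm.span B"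
  shows "single u 1 * p \<in> pm.span B'"
  by (rule span_semilinear[OF _ _ _ assms, where \<theta> = "\<lambda>c. c"]) (simp_all add: distrib_left smul_mult)

definition coeff_monomials :: "nat \<Rightarrow> 'r::comm_ring_1 set \<Rightarrow> (xterm \<Rightarrow>\<^sub>0 'r) set" where
  "coeff_monomials n \<aa> = {single t a | t a. t \<in> terms_in {..n} \<and> a \<in> \<aa>}"

lemma span_coeff_monomials:
  assumes \<aa>: "is_ideal \<aa>"
  shows "p \<in> pm.span (coeff_monomials n \<aa>) \<longleftrightarrow> keys p \<subseteq> terms_in {..n} \<and> (\<forall>t. lookup p t \<in> \<aa>)"
proof
  assume p: "p \<in> pm.span (coeff_monomials n \<aa>)"
  have "keys p \<subseteq> terms_in {..n}" by (rule span_keys[OF _ p]) (auto simp: coeff_monomials_def split: if_splits)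
  moreover have "\<forall>t. lookup p t \<in> \<aa>"
    using p
  proof (induction rule: pm.span_induct_alt)
    case (step c x y)
    then show ?case
      by (auto simp: coeff_monomials_def lookup_add lookup_single when_def is_ideal_0[OF \<aa>]
          intro!: is_ideal_add[OF \<aa>] is_ideal_mult[OF \<aa>])
  qed (simp add: is_ideal_0[OF \<aa>])
  ultimately show "keys p \<subseteq> terms_in {..n} \<and> (\<forall>t. lookup p t \<in> \<aa>)" ..
next
  assume "keys p \<subseteq> terms_in {..n} \<and> (\<forall>t. lookup p t \<in> \<aa>)"
  then have "(\<Sum>t\<in>keys p. single t (lookup p t)) \<in> pm.span (coeff_monomials n \<aa>)"
    by (intro pm.span_sum pm.span_base) (auto simp: coeff_monomials_def)
  then show "p \<in> pm.span (coeff_monomials n \<aa>)" using poly_eq_sum_single[of p] by simp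
qed

definition multiples :: "nat \<Rightarrow> xterm set \<Rightarrow> (xterm \<Rightarrow> xterm \<Rightarrow>\<^sub>0 'r::comm_ring_1) \<Rightarrow> (xterm \<Rightarrow>\<^sub>0 'r) set" where
  "multiples n A F = {single u 1 * F \<alpha> | u \<alpha>. u \<in> terms_in {..n} \<and> \<alpha> \<in> A}"

lemma multiples_single_mult:
  "u \<in> terms_in {..n} \<Longrightarrow> b \<in> multiples n A F \<Longrightarrow> single u 1 * b \<in> multiples n A F"
  unfolding multiples_def
proof clarify
  fix v \<alpha> assume "u \<in> terms_in {..n}" "v \<in> terms_in {..n}" "\<alpha> \<in> A"
  then show "\<exists>u' \<alpha>'. single u 1 * (single v 1 * F \<alpha>) = single u' 1 * F \<alpha>' \<and> u' \<in> terms_in {..n} \<and> \<alpha>' \<in> A"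
    by (intro exI[of _ "u + v"] exI[of _ \<alpha>]) (simp add: mult_single flip: mult.assoc)
qed

text \<open>
  \<open>F \<alpha>\<close> deforms \<open>f \<alpha>\<close> by terms divisible by \<open>x\<^sub>n\<close>.  The condition \<open>s_pairs\<close> is the hypothesis of Buchberger's criterion for
  the \<open>F \<alpha>\<close> over \<open>'r\<close> modulo \<open>\<aa>\<close>: up to coefficients in \<open>\<aa>\<close>, the S-polynomials are combinations of multiples with
  smaller head terms.
\<close>
locale lifting = homogeneous_gb n prec H f
  for n prec and H :: "(xterm \<Rightarrow>\<^sub>0 'k::field) set" and f +
  fixes \<theta> :: "'k \<Rightarrow> 'r::comm_ring_1" and \<aa> :: "'r set" and F :: "xterm \<Rightarrow> (xterm \<Rightarrow>\<^sub>0 'r)"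
  assumes \<theta>: "ring_map \<theta>" and \<aa>: "is_ideal \<aa>"
    and F: "\<alpha> \<in> in_gens n prec H \<Longrightarrow> t \<in> keys (F \<alpha> - map_coeffs \<theta> (f \<alpha>)) \<Longrightarrow>
      t \<in> terms_in {..n} \<and> 0 < lookup t n \<and> tdeg t = tdeg \<alpha>"
    and s_pairs: "\<alpha> \<in> in_gens n prec H \<Longrightarrow> \<beta> \<in> in_gens n prec H \<Longrightarrow>
      single (\<beta> - \<alpha>) 1 * F \<alpha> - single (\<alpha> - \<beta>) 1 * F \<beta> \<in> pm.span
        ({single u 1 * F \<gamma> | u \<gamma>. u \<in> terms_in {..n} \<and> \<gamma> \<in> in_gens n prec H \<and>
            graded_ext n prec (u + \<gamma>) (term_lcm \<alpha> \<beta>)} \<union> coeff_monomials n \<aa>)"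
begin

abbreviation T :: "xterm set" where "T \<equiv> terms_in {..n}"

lemma T0_T: "t \<in> terms_in {..<n} \<Longrightarrow> t \<in> T" and T0_n: "t \<in> terms_in {..<n} \<Longrightarrow> lookup t n = 0"
  by (simp_all add: terms_lessThan_iff)

lemma xvar_T: "xvar n \<in> T"
  by (rule terms_in_single) simp

lemma A_T: "\<alpha> \<in> A \<Longrightarrow> \<alpha> \<in> T"
  by (rule T0_T[OF A_terms])

definition lifted_ideal :: "(xterm \<Rightarrow>\<^sub>0 'r) set" where
  "lifted_ideal = pm.span (multiples n A F \<union> coeff_monomials n \<aa>)"

lemma keys_F:
  assumes "\<alpha> \<in> A" "t \<in> keys (F \<alpha>)"
  shows "t \<in> T" "tdeg t = tdeg \<alpha>" "t \<noteq> \<alpha> \<Longrightarrow> graded_ext n prec t \<alpha>"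
proof -
  let ?D = "F \<alpha> - map_coeffs \<theta> (f \<alpha>)"
  have "keys (F \<alpha>) \<subseteq> keys (map_coeffs \<theta> (f \<alpha>)) \<union> keys ?D"
    using keys_add[of "map_coeffs \<theta> (f \<alpha>)" ?D] by simp
  then have "t \<in> keys (map_coeffs \<theta> (f \<alpha>)) \<or> t \<in> keys ?D" using assms(2) by blast
  then consider "t \<in> keys (f \<alpha>)" | "t \<in> keys ?D" using keys_map_coeffs[OF \<theta>] by blast
  then have "t \<in> T \<and> tdeg t = tdeg \<alpha> \<and> (t \<noteq> \<alpha> \<longrightarrow> graded_ext n prec t \<alpha>)"
  proof cases
    case 1
    then have "t \<in> terms_in {..<n}" using keys_f[OF assms(1)] by blast
    then show ?thesis using f_less[OF assms(1) 1] f_homogeneous[OF assms(1) 1] T0_T T0_n A_terms[OF assms(1)]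
      by (simp add: graded_ext_def update_0_id)
  next
    case 2
    then show ?thesis using F[OF assms(1) 2] T0_n[OF A_terms[OF assms(1)]] by (simp add: graded_ext_def)
  qed
  then show "t \<in> T" "tdeg t = tdeg \<alpha>" "t \<noteq> \<alpha> \<Longrightarrow> graded_ext n prec t \<alpha>" by auto
qed

lemma F_xn_free: "\<alpha> \<in> A \<Longrightarrow> lookup t n = 0 \<Longrightarrow> lookup (F \<alpha>) t = \<theta> (lookup (f \<alpha>) t)"
  using F[of \<alpha> t] by (auto simp: in_keys_iff lookup_minus \<theta>)

lemma F_lc: "\<alpha> \<in> A \<Longrightarrow> lookup (F \<alpha>) \<alpha> = 1"
  by (simp add: F_xn_free T0_n[OF A_terms] f_lc ring_map_1[OF \<theta>])

lemma multiples_T: "b \<in> multiples n A F \<Longrightarrow> keys b \<subseteq> T"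
  using keys_single_mult keys_F(1) by (fastforce simp: multiples_def)

lemma lifted_ideal_T: "p \<in> lifted_ideal \<Longrightarrow> keys p \<subseteq> T"
  unfolding lifted_ideal_def
  by (erule span_keys[rotated]) (auto simp: coeff_monomials_def split: if_splits dest: multiples_T)

lemma lifted_ideal_add: "p \<in> lifted_ideal \<Longrightarrow> q \<in> lifted_ideal \<Longrightarrow> p + q \<in> lifted_ideal"
  and lifted_ideal_diff: "p \<in> lifted_ideal \<Longrightarrow> q \<in> lifted_ideal \<Longrightarrow> p - q \<in> lifted_ideal"
  and lifted_ideal_smul: "p \<in> lifted_ideal \<Longrightarrow> smul c p \<in> lifted_ideal"
  and lifted_ideal_0: "0 \<in> lifted_ideal"
  unfolding lifted_ideal_def by (rule pm.span_add pm.span_diff pm.span_scale pm.span_zero; assumption)+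

lemma span_multiples_lifted_ideal: "p \<in> pm.span (multiples n A F) \<Longrightarrow> p \<in> lifted_ideal"
  unfolding lifted_ideal_def by (rule subsetD[OF pm.span_mono]) auto

lemma F_lifted_ideal: "\<alpha> \<in> A \<Longrightarrow> F \<alpha> \<in> lifted_ideal"
proof (rule span_multiples_lifted_ideal, rule pm.span_base)
  assume "\<alpha> \<in> A"
  then show "F \<alpha> \<in> multiples n A F"
    unfolding multiples_def by (intro CollectI exI[of _ 0] exI[of _ \<alpha>]) simp
qed

lemma coeffs_lifted_ideal: "keys p \<subseteq> T \<Longrightarrow> (\<And>t. lookup p t \<in> \<aa>) \<Longrightarrow> p \<in> lifted_ideal"
  unfolding lifted_ideal_def
  by (rule subsetD[OF pm.span_mono[of "coeff_monomials n \<aa>"]]) (auto simp: span_coeff_monomials[OF \<aa>])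

lemma coeff_monomials_single_mult: "u \<in> T \<Longrightarrow> b \<in> coeff_monomials n \<aa> \<Longrightarrow> single u 1 * b \<in> coeff_monomials n \<aa>"
  unfolding coeff_monomials_def by (clarsimp simp: mult_single) (metis terms_in_add)

lemma lifted_ideal_mult: 
  assumes "u \<in> T" "p \<in> lifted_ideal" shows "single u c * p \<in> lifted_ideal"
proof -
  have "single u 1 * p \<in> lifted_ideal"
    using assms(2) unfolding lifted_ideal_def
    by (rule span_single_mult[rotated])
      (use multiples_single_mult[OF assms(1)] coeff_monomials_single_mult[OF assms(1)] in \<open>blast intro: pm.span_base\<close>)
  then show ?thesis by (subst single_mult_smul) (rule lifted_ideal_smul)
qed

text \<open>
  Buchberger's criterion modulo \<open>\<aa>\<close>.  For every non-normal term \<open>t\<close> fix one multiple \<open>w t\<close> of some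
  \<open>F \<alpha>\<close> with head term \<open>t\<close>.  Two multiples with the same head term differ by a multiple of an
  S-polynomial, hence by multiples with smaller head terms; so the \<open>w t\<close> generate everything, and
  they are in echelon form.
\<close>
theorem buchberger_modulo:
  assumes p: "p \<in> lifted_ideal" "\<And>t. t \<in> T \<Longrightarrow> \<not> normal t \<Longrightarrow> lookup p t \<in> \<aa>"
  shows "lookup p t \<in> \<aa>"
proof -
  let ?I = "{t \<in> T. \<not> normal t}"
  obtain \<sigma> where \<sigma>: "\<And>t. t \<in> ?I \<Longrightarrow> \<sigma> t \<in> A" "\<And>t. t \<in> ?I \<Longrightarrow> t = \<sigma> t + (t - \<sigma> t)"
  proof -
    have "\<forall>t\<in>?I. \<exists>\<alpha>. \<alpha> \<in> A \<and> t = \<alpha> + (t - \<alpha>)"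
      using tdvd_imp_minus unfolding normal_def by blast
    from bchoice[OF this] show thesis using that by blast
  qed
  define w where "w = (\<lambda>t. single (t - \<sigma> t) 1 * F (\<sigma> t))"
  let ?W = "w ` ?I \<union> coeff_monomials n \<aa>"
  have gen: "\<forall>u \<alpha>. u \<in> T \<longrightarrow> \<alpha> \<in> A \<longrightarrow> u + \<alpha> = t \<longrightarrow> single u 1 * F \<alpha> \<in> pm.span ?W" if "t \<in> T" for t
    using that
  proof (induction t rule: graded_ext_induct[OF ord, consumes 1, case_names step])
    case (step t)
    show ?case
    proof (intro allI impI)
      fix u \<alpha> assume u: "u \<in> T" and \<alpha>: "\<alpha> \<in> A" and t: "u + \<alpha> = t"
      have dvd\<alpha>: "tdvd \<alpha> t" using t unfolding tdvd_def by (metis add.commute)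
      then have tI: "t \<in> ?I" using step(1) \<alpha> by (auto simp: normal_def)
      define \<beta> where "\<beta> = \<sigma> t"
      have \<beta>: "\<beta> \<in> A" "t = \<beta> + (t - \<beta>)" using \<sigma>[OF tI] by (simp_all add: \<beta>_def)
      define z where "z = t - term_lcm \<alpha> \<beta>"
      have "tdvd \<beta> t" using \<beta>(2) unfolding tdvd_def by blast
      then have tz: "t = term_lcm \<alpha> \<beta> + z" unfolding z_def by (rule term_lcm_xterm(3)[OF dvd\<alpha>])
      have zT: "z \<in> T" unfolding z_def by (rule terms_in_minus[OF step(1)])
      have "\<alpha> + u = \<alpha> + (z + (\<beta> - \<alpha>))" using t tz term_lcm_xterm(4)[of \<alpha> \<beta>] by (simp add: ac_simps)
      then have uz: "u = z + (\<beta> - \<alpha>)" by simp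
      have "\<beta> + (t - \<beta>) = \<beta> + (z + (\<alpha> - \<beta>))" using \<beta>(2) tz term_lcm_xterm(5)[of \<alpha> \<beta>] by (simp add: ac_simps)
      then have vz: "t - \<beta> = z + (\<alpha> - \<beta>)" by (rule add_left_imp_eq)
      have "single z 1 * (single (\<beta> - \<alpha>) 1 * F \<alpha> - single (\<alpha> - \<beta>) 1 * F \<beta>) \<in> pm.span ?W"
      proof (rule span_single_mult[OF _ s_pairs[OF \<alpha> \<beta>(1)]])
        fix b
        assume "b \<in> {single u 1 * F \<gamma> | u \<gamma>. u \<in> T \<and> \<gamma> \<in> A \<and> graded_ext n prec (u + \<gamma>) (term_lcm \<alpha> \<beta>)}
            \<union> coeff_monomials n \<aa>"
        then show "single z 1 * b \<in> pm.span ?W"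
        proof
          assume "b \<in> {single u 1 * F \<gamma> | u \<gamma>. u \<in> T \<and> \<gamma> \<in> A \<and> graded_ext n prec (u + \<gamma>) (term_lcm \<alpha> \<beta>)}"
          then obtain v \<gamma> where b: "b = single v 1 * F \<gamma>" "v \<in> T" "\<gamma> \<in> A"
              "graded_ext n prec (v + \<gamma>) (term_lcm \<alpha> \<beta>)" by blast
          have lT: "term_lcm \<alpha> \<beta> \<in> T" and vT: "v + \<gamma> \<in> T" using step(1) tz b(2) A_T[OF b(3)] by auto
          have "graded_ext n prec (z + (v + \<gamma>)) t"
            using graded_ext_add[OF ord vT lT zT b(4)] by (simp add: tz add.commute)
          from step(2)[OF _ this] have "single (z + v) 1 * F \<gamma> \<in> pm.span ?W"
            using zT vT b by (simp add: add.assoc)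
          then show ?thesis by (simp add: b(1) mult_single flip: mult.assoc)
        next
          assume "b \<in> coeff_monomials n \<aa>"
          then show ?thesis using coeff_monomials_single_mult[OF zT] by (blast intro: pm.span_base)
        qed
      qed
      moreover have "single z 1 * (single (\<beta> - \<alpha>) 1 * F \<alpha> - single (\<alpha> - \<beta>) 1 * F \<beta>) = single u 1 * F \<alpha> - w t"
        unfolding w_def \<beta>_def[symmetric] uz vz by (simp add: right_diff_distrib mult_single flip: mult.assoc)
      moreover have "w t \<in> pm.span ?W" using tI by (intro pm.span_base) blast
      ultimately show "single u 1 * F \<alpha> \<in> pm.span ?W" using pm.span_add by fastforce
    qed
  qed
  have "lifted_ideal \<subseteq> pm.span ?W"
    unfolding lifted_ideal_def
  proof (rule pm.span_minimal[OF _ pm.subspace_span], rule Un_least)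
    show "multiples n A F \<subseteq> pm.span ?W"
    proof
      fix b assume "b \<in> multiples n A F"
      then obtain u \<alpha> where "b = single u 1 * F \<alpha>" "u \<in> T" "\<alpha> \<in> A" by (auto simp: multiples_def)
      then show "b \<in> pm.span ?W" using gen[of "u + \<alpha>"] A_T by simp
    qed
    show "coeff_monomials n \<aa> \<subseteq> pm.span ?W" by (rule order_trans[OF _ pm.span_superset]) blast
  qed
  then obtain p1 p2 where p12: "p = p1 + p2" "p1 \<in> pm.span (w ` ?I)" "p2 \<in> pm.span (coeff_monomials n \<aa>)"
    using p(1) unfolding pm.span_Un by blast
  have p2: "lookup p2 s \<in> \<aa>" for s using p12(3) span_coeff_monomials[OF \<aa>] by blast
  have "lookup p1 t \<in> \<aa>"
  proof (rule echelon_coeffs[OF \<aa> _ _ _ _ p12(2), where r = "graded_ext n prec"])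
    fix s assume s: "s \<in> ?I"
    have "lookup (w s) (s - \<sigma> s + \<sigma> s) = 1"
      unfolding w_def lookup_single_mult using F_lc[OF \<sigma>(1)[OF s]] by simp
    then show "lookup (w s) s = 1" using \<sigma>(2)[OF s] by (metis add.commute)
    have "lookup p s = lookup p1 s + lookup p2 s" by (simp add: p12(1) lookup_add)
    then show "lookup p1 s \<in> \<aa>" using is_ideal_diff[OF \<aa> p(2)[of s] p2[of s]] s by simp
  next
    fix s t assume st: "s \<in> ?I" "t \<in> ?I" "s \<noteq> t" "lookup (w s) t \<noteq> 0"
    note \<sigma>s = \<sigma>[OF st(1)]
    from st(4) have "t \<in> keys (w s)" by (simp add: in_keys_iff)
    then obtain k where k: "k \<in> keys (F (\<sigma> s))" "t = s - \<sigma> s + k"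
      using keys_single_mult unfolding w_def by blast
    then have "k \<noteq> \<sigma> s" using st(3) \<sigma>s(2) by (metis add.commute)
    then have "graded_ext n prec k (\<sigma> s)" by (rule keys_F(3)[OF \<sigma>s(1) k(1)])
    from graded_ext_add[OF ord keys_F(1)[OF \<sigma>s(1) k(1)] A_T[OF \<sigma>s(1)] terms_in_minus this]
    have "graded_ext n prec (s - \<sigma> s + k) (s - \<sigma> s + \<sigma> s)" using st(1) by blast
    then show "graded_ext n prec t s" using k(2) \<sigma>s(2) by (metis add.commute)
  next
    show "\<And>t. t \<in> ?I \<Longrightarrow> \<not> graded_ext n prec t t" using graded_ext_irrefl[OF ord] by blast
    show "\<And>s t u. s \<in> ?I \<Longrightarrow> t \<in> ?I \<Longrightarrow> u \<in> ?I \<Longrightarrow> graded_ext n prec s t \<Longrightarrow> graded_ext n prec t u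
        \<Longrightarrow> graded_ext n prec s u"
      using graded_ext_trans[OF ord] by blast
  qed
  then show ?thesis by (simp add: p12(1) lookup_add is_ideal_add[OF \<aa> _ p2])
qed


subsection \<open>Comparison with a second term order\<close>

definition normal_multiples :: "(xterm \<Rightarrow> xterm \<Rightarrow> bool) \<Rightarrow> nat \<Rightarrow> (xterm \<Rightarrow>\<^sub>0 'r) set" where
  "normal_multiples prec' d = {single s 1 | s. s \<in> T \<and> homogeneous_gb.normal n prec' H s \<and> tdeg s = d}"

lemma multiples_xvar: "b \<in> multiples n A F \<Longrightarrow> single (xvar n) 1 * b \<in> multiples n A F"
  by (rule multiples_single_mult[OF xvar_T])

text \<open>
  Replace \<open>f \<alpha>\<close> by \<open>F \<alpha>\<close> in a representation of \<open>p\<close> by multiples of degree \<open>d\<close>.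
\<close>
lemma lift_H:
  assumes p: "p \<in> H" "\<And>t. t \<in> keys p \<Longrightarrow> tdeg t = d"
  obtains q where "q \<in> pm.span (multiples n A F)"
    "\<forall>t\<in>keys (q - map_coeffs \<theta> p). t \<in> T \<and> 0 < lookup t n \<and> tdeg t = d"
proof -
  let ?M = "{t \<in> T. 0 < lookup t n \<and> tdeg t = d}"
  note m = map_coeffs_ring_map[OF \<theta>]
  have "p \<in> pm.span (f_multiples d)" by (rule homogeneous_H_span[OF p])
  then have "\<exists>q\<in>pm.span (multiples n A F). keys (q - map_coeffs \<theta> p) \<subseteq> ?M"
  proof (induction rule: pm.span_induct_alt)
    case base
    show ?case by (rule bexI[OF _ pm.span_zero]) (simp add: ring_map_0[OF m])
  next
    case (step c x y)
    obtain u \<alpha> where x: "x = single u 1 * f \<alpha>" "u \<in> terms_in {..<n}" "\<alpha> \<in> A" "tdeg (u + \<alpha>) = d"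
      using step(1) by (auto simp: f_multiples_def)
    have uT: "u \<in> T" using x(2) by (rule T0_T)
    obtain q where q: "q \<in> pm.span (multiples n A F)" "keys (q - map_coeffs \<theta> y) \<subseteq> ?M" using step(2) by blast
    let ?D = "single u 1 * (F \<alpha> - map_coeffs \<theta> (f \<alpha>))"
    have D: "keys ?D \<subseteq> ?M"
    proof
      fix t assume "t \<in> keys ?D"
      then obtain k where "t = u + k" "k \<in> keys (F \<alpha> - map_coeffs \<theta> (f \<alpha>))"
        using keys_single_mult by blast
      then show "t \<in> ?M" using F[OF x(3), of k] uT x(4) by (auto simp: lookup_add)
    qed
    let ?q = "smul (\<theta> c) (single u 1 * F \<alpha>) + q"
    have "single u 1 * F \<alpha> \<in> multiples n A F" using uT x(3) by (auto simp: multiples_def)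
    then have 1: "?q \<in> pm.span (multiples n A F)" by (intro pm.span_add pm.span_scale q pm.span_base)
    have "map_coeffs \<theta> x = single u 1 * map_coeffs \<theta> (f \<alpha>)"
      by (simp add: x(1) ring_map_mult[OF m] map_coeffs_single[OF \<theta>] ring_map_1[OF \<theta>])
    then have "?q - map_coeffs \<theta> (smul c x + y) = smul (\<theta> c) ?D + (q - map_coeffs \<theta> y)"
      by (simp add: ring_map_add[OF m] map_coeffs_smul[OF \<theta>] right_diff_distrib pm.scale_right_diff_distrib)
    moreover have "keys (smul (\<theta> c) ?D + (q - map_coeffs \<theta> y)) \<subseteq> ?M"
      by (rule keys_add_subset[OF order_trans[OF _ D] q(2)]) (auto simp: in_keys_iff)
    ultimately have "keys (?q - map_coeffs \<theta> (smul c x + y)) \<subseteq> ?M" by (simp only:)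
    then show ?case using 1 by (rule bexI)
  qed
  then show thesis using that by blast
qed

text \<open>
  \<open>K[x]\<close> is the sum of \<open>H\<close> and the span of the terms that are normal for the second order.  An element
  of \<open>H\<close> lifts to the ideal up to a multiple of \<open>x\<^sub>n\<close>, and the multiple is treated by induction
  on the degree.
\<close>
lemma complement:
  assumes gb': "homogeneous_gb n prec' H f'" and "t \<in> T"
  shows "single t 1 \<in> pm.span (multiples n A F \<union> normal_multiples prec' (tdeg t))"
proof -
  interpret B: homogeneous_gb n prec' H f' by fact
  let ?S = "\<lambda>d. multiples n A F \<union> normal_multiples prec' d"
  have xn: "single (xvar n) 1 * p \<in> pm.span (?S (Suc d))" if "p \<in> pm.span (?S d)" for p d
  proof (rule span_single_mult[OF _ that], rule pm.span_base)
    fix b assume "b \<in> ?S d"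
    then show "single (xvar n) 1 * b \<in> ?S (Suc d)"
    proof
      assume "b \<in> normal_multiples prec' d"
      then obtain s where "b = single s 1" "s \<in> T" "B.normal s" "tdeg s = d" by (auto simp: normal_multiples_def)
      then have "single (xvar n) 1 * b \<in> normal_multiples prec' (Suc d)"
        unfolding normal_multiples_def
        by (intro CollectI exI[of _ "xvar n + s"]) (simp add: mult_single xvar_T B.normal_xvar)
      then show ?thesis ..
    qed (use multiples_xvar in blast)
  qed
  have "single t 1 \<in> pm.span (?S d)" if "t \<in> T" "tdeg t = d" for t d
    using that
  proof (induction d arbitrary: t rule: less_induct)
    case (less d)
    have xcase: "single s 1 \<in> pm.span (?S d)" if s: "s \<in> T" "0 < lookup s n" "tdeg s = d" for s
    proof -
      let ?s = "s - xvar n"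
      have s': "s = xvar n + ?s" by (rule xterm_split[OF s(2)])
      have d: "d = Suc (tdeg ?s)" using arg_cong[OF s', of tdeg] s(3) by simp
      have "single ?s 1 \<in> pm.span (?S (tdeg ?s))"
        by (rule less.IH) (simp_all add: d[symmetric] terms_in_minus[OF s(1)], simp add: d)
      from xn[OF this] show ?thesis using s' d by (simp add: mult_single)
    qed
    show ?case
    proof (cases "lookup t n = 0")
      case False
      then show ?thesis using xcase less.prems by simp
    next
      case True
      then have t0: "t \<in> terms_in {..<n}" using less.prems by (simp add: terms_lessThan_iff)
      have "map_coeffs \<theta> (single t 1) \<in> pm.span (?S d)"
      proof (rule span_semilinear[OF _ _ _ _ B.division[OF t0], where \<theta> = \<theta>])
        fix b assume "b \<in> B.f_multiples (tdeg t) \<union> B.normal_monomials (tdeg t)"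
        then show "map_coeffs \<theta> b \<in> pm.span (?S d)"
        proof
          assume b: "b \<in> B.f_multiples (tdeg t)"
          then have bH: "b \<in> H" using B.f_multiples_H pm.span_superset by blast
          obtain q where q: "q \<in> pm.span (multiples n A F)"
            "\<forall>s\<in>keys (q - map_coeffs \<theta> b). s \<in> T \<and> 0 < lookup s n \<and> tdeg s = tdeg t"
            by (rule lift_H[OF bH B.f_multiples_tdeg[OF b]])
          have "q \<in> pm.span (?S d)" by (rule subsetD[OF pm.span_mono q(1)]) simp
          moreover have "q - map_coeffs \<theta> b \<in> pm.span (?S d)"
          proof (rule span_monomials)
            fix s assume "s \<in> keys (q - map_coeffs \<theta> b)"
            with q(2) show "single s 1 \<in> pm.span (?S d)" unfolding less.prems(2) by (intro xcase) simp_all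
          qed
          ultimately have "q - (q - map_coeffs \<theta> b) \<in> pm.span (?S d)" by (rule pm.span_diff)
          then show ?thesis by simp
        next
          assume "b \<in> B.normal_monomials (tdeg t)"
          then obtain s where "b = single s 1" "s \<in> terms_in {..<n}" "B.normal s" "tdeg s = d"
            using less.prems by (auto simp: B.normal_monomials_def)
          then have "map_coeffs \<theta> b \<in> normal_multiples prec' d"
            unfolding normal_multiples_def
            by (intro CollectI exI[of _ s]) (simp add: map_coeffs_single[OF \<theta>] ring_map_1[OF \<theta>] T0_T)
          then show ?thesis by (intro pm.span_base) simp
        qed
      qed (simp_all add: ring_map_add[OF map_coeffs_ring_map[OF \<theta>]] ring_map_0[OF map_coeffs_ring_map[OF \<theta>]]
          map_coeffs_smul[OF \<theta>])
      then show ?thesis by (simp add: map_coeffs_single[OF \<theta>] ring_map_1[OF \<theta>])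
    qed
  qed
  then show ?thesis using assms(2) by blast
qed

text \<open>
  Modulo the ideal, every polynomial is a combination of normal terms, and these stay normal after
  multiplication with \<open>x\<^sub>n\<close>; so Buchberger's criterion makes \<open>x\<^sub>n\<close> a nonzerodivisor.
\<close>
lemma xvar_nonzerodivisor:
  assumes p: "keys p \<subseteq> T" "single (xvar n) 1 * p \<in> lifted_ideal"
  shows "p \<in> lifted_ideal"
proof -
  let ?N = "{single s 1 | s. s \<in> T \<and> normal s}"
  have "p \<in> pm.span (multiples n A F \<union> ?N)"
  proof (rule span_monomials)
    fix t assume "t \<in> keys p"
    then have "single t 1 \<in> pm.span (multiples n A F \<union> normal_multiples prec (tdeg t))"
      using p(1) by (intro complement[OF homogeneous_gb_axioms]) auto
    then show "single t 1 \<in> pm.span (multiples n A F \<union> ?N)"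
      by (rule subsetD[OF pm.span_mono, rotated]) (auto simp: normal_multiples_def)
  qed
  then obtain i \<nu> where p_eq: "p = i + \<nu>" and i: "i \<in> pm.span (multiples n A F)" and \<nu>: "\<nu> \<in> pm.span ?N"
    unfolding pm.span_Un by blast
  have i_in: "i \<in> lifted_ideal" by (rule span_multiples_lifted_ideal[OF i])
  have \<nu>_keys: "keys \<nu> \<subseteq> {t \<in> T. normal t}" by (rule span_keys[OF _ \<nu>]) auto
  have "single (xvar n) 1 * p - single (xvar n) 1 * i \<in> lifted_ideal"
    by (rule lifted_ideal_diff[OF p(2) lifted_ideal_mult[OF xvar_T i_in]])
  then have x\<nu>: "single (xvar n) 1 * \<nu> \<in> lifted_ideal" by (simp add: p_eq distrib_left)
  have "lookup (single (xvar n) 1 * \<nu>) (xvar n + t) \<in> \<aa>" for t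
  proof (rule buchberger_modulo[OF x\<nu>])
    fix s assume s: "\<not> normal s"
    have "s \<notin> keys (single (xvar n) 1 * \<nu>)"
    proof
      assume "s \<in> keys (single (xvar n) 1 * \<nu>)"
      then obtain k where "s = xvar n + k" "k \<in> keys \<nu>" using keys_single_mult by blast
      then show False using s \<nu>_keys by (auto simp: normal_xvar)
    qed
    then show "lookup (single (xvar n) 1 * \<nu>) s \<in> \<aa>" by (simp add: in_keys_iff is_ideal_0[OF \<aa>])
  qed
  then have "\<nu> \<in> lifted_ideal" using \<nu>_keys by (intro coeffs_lifted_ideal) (auto simp: lookup_single_mult)
  then show ?thesis unfolding p_eq by (rule lifted_ideal_add[OF i_in])
qed

text \<open>
  At \<open>x\<^sub>n = 0\<close> the multiples of \<open>F \<alpha>\<close> become multiples of \<open>f \<alpha>\<close> or zero.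
\<close>
lemma lifted_ideal_mod_xvar:
  assumes "p \<in> lifted_ideal"
  obtains h where "h \<in> pm.span (map_coeffs \<theta> ` H)" "\<And>t. lookup t n = 0 \<Longrightarrow> lookup p t - lookup h t \<in> \<aa>"
proof -
  note m = map_coeffs_ring_map[OF \<theta>]
  have "\<exists>h\<in>pm.span (map_coeffs \<theta> ` H). \<forall>t. lookup t n = 0 \<longrightarrow> lookup p t - lookup h t \<in> \<aa>"
    using assms unfolding lifted_ideal_def
  proof (induction rule: pm.span_induct_alt)
    case base
    show ?case by (rule bexI[OF _ pm.span_zero]) (simp add: is_ideal_0[OF \<aa>])
  next
    case (step c x y)
    have "\<exists>g\<in>pm.span (map_coeffs \<theta> ` H). \<forall>t. lookup t n = 0 \<longrightarrow> lookup x t - lookup g t \<in> \<aa>"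
      using step(1)
    proof
      assume "x \<in> coeff_monomials n \<aa>"
      then show ?thesis
        by (intro bexI[OF _ pm.span_zero]) (auto simp: coeff_monomials_def lookup_single when_def is_ideal_0[OF \<aa>])
    next
      assume "x \<in> multiples n A F"
      then obtain u \<alpha> where x: "x = single u 1 * F \<alpha>" "u \<in> T" "\<alpha> \<in> A" by (auto simp: multiples_def)
      show ?thesis
      proof (cases "lookup u n = 0")
        case True
        then have "single u 1 * f \<alpha> \<in> H"
          using x ideal_single_mult[OF H_ideal f_in_H[OF x(3)]] by (simp add: terms_lessThan_iff)
        moreover have "lookup x t = lookup (map_coeffs \<theta> (single u 1 * f \<alpha>)) t" if t: "lookup t n = 0" for t
        proof (cases "\<exists>s. t = u + s")
          case True
          then obtain s where s: "t = u + s" by blast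
          then have "lookup s n = 0" using t by (simp add: lookup_add)
          then show ?thesis
            by (simp add: x(1) s lookup_single_mult F_xn_free[OF x(3)] \<theta>)
        next
          case False
          then show ?thesis by (simp add: x(1) lookup_single_mult_eq_0 \<theta> ring_map_0[OF \<theta>])
        qed
        ultimately show ?thesis
          by (intro bexI[OF _ pm.span_base[OF imageI]]) (auto simp: is_ideal_0[OF \<aa>])
      next
        case False
        have "lookup x t = 0" if "lookup t n = 0" for t
          unfolding x(1) by (rule lookup_single_mult_eq_0) (use that False in \<open>auto simp: lookup_add\<close>)
        then show ?thesis by (intro bexI[OF _ pm.span_zero]) (simp add: is_ideal_0[OF \<aa>])
      qed
    qed
    then obtain g where g: "g \<in> pm.span (map_coeffs \<theta> ` H)" "\<And>t. lookup t n = 0 \<Longrightarrow> lookup x t - lookup g t \<in> \<aa>"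
      by blast
    obtain h where h: "h \<in> pm.span (map_coeffs \<theta> ` H)" "\<And>t. lookup t n = 0 \<Longrightarrow> lookup y t - lookup h t \<in> \<aa>"
      using step(2) by blast
    have "lookup (smul c x + y) t - lookup (smul c g + h) t \<in> \<aa>" if "lookup t n = 0" for t
    proof -
      have "lookup (smul c x + y) t - lookup (smul c g + h) t
          = c * (lookup x t - lookup g t) + (lookup y t - lookup h t)"
        by (simp add: lookup_add algebra_simps)
      then show ?thesis using is_ideal_add[OF \<aa> is_ideal_mult[OF \<aa> g(2)[OF that]] h(2)[OF that]] by simp
    qed
    then show ?case by (intro bexI[of _ "smul c g + h"]) (auto intro: pm.span_add pm.span_scale g h)
  qed
  then show thesis using that by blast
qed

text \<open>
  The conclusion of Buchberger's criterion holds for the normal terms of every other term order.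
  Put \<open>x\<^sub>n = 0\<close>: the result lies in \<open>H\<close> modulo \<open>\<aa>\<close>, so it vanishes modulo \<open>\<aa>\<close>; then divide by \<open>x\<^sub>n\<close>.
\<close>
theorem normal_elements_vanish:
  assumes gb': "homogeneous_gb n prec' H f'"
    and p: "p \<in> lifted_ideal" "\<And>t. t \<in> T \<Longrightarrow> \<not> homogeneous_gb.normal n prec' H t \<Longrightarrow> lookup p t \<in> \<aa>"
  shows "lookup p t \<in> \<aa>"
proof -
  interpret B: homogeneous_gb n prec' H f' by fact
  have "lookup p t \<in> \<aa>" if "p \<in> lifted_ideal" "\<And>t. t \<in> T \<Longrightarrow> \<not> B.normal t \<Longrightarrow> lookup p t \<in> \<aa>"
    "\<And>t. t \<in> keys p \<Longrightarrow> tdeg t < d" for p d t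
    using that
  proof (induction d arbitrary: p t)
    case 0
    then have "t \<notin> keys p" by auto
    then show ?case by (simp add: in_keys_iff is_ideal_0[OF \<aa>])
  next
    case (Suc d)
    obtain h where h: "h \<in> pm.span (map_coeffs \<theta> ` H)" "\<And>t. lookup t n = 0 \<Longrightarrow> lookup p t - lookup h t \<in> \<aa>"
      using lifted_ideal_mod_xvar[OF Suc.prems(1)] by blast
    have xfree: "lookup p t \<in> \<aa>" if t: "lookup t n = 0" for t
    proof -
      \<comment> \<open>At the terms in the second initial ideal, \<open>h\<close> agrees with \<open>p\<close> modulo \<open>\<aa>\<close>.\<close>
      have "lookup h t \<in> \<aa>"
      proof (rule B.extended_H_coeffs[OF \<theta> \<aa> h(1)])
        fix s assume s: "s \<in> terms_in {..<n}" "\<not> B.normal s"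
        have "lookup p s - (lookup p s - lookup h s) \<in> \<aa>"
          by (rule is_ideal_diff[OF \<aa> Suc.prems(2)[OF T0_T[OF s(1)] s(2)] h(2)[OF T0_n[OF s(1)]]])
        then show "lookup h s \<in> \<aa>" by simp
      qed
      from is_ideal_add[OF \<aa> h(2)[OF t] this] show ?thesis by simp
    qed
    let ?x = "xvar n"
    have inj: "inj ((+) ?x)" by (rule injI) simp
    define p0 where "p0 = part (\<lambda>t. lookup t n = 0) p"
    define p' where "p' = Poly_Mapping.map_key ((+) ?x) p"
    have p': "lookup p' s = lookup p (?x + s)" for s unfolding p'_def map_key.rep_eq[OF inj] by (rule comp_apply)
    have "p - p0 = single ?x 1 * p'"
    proof (rule poly_mapping_eqI)
      fix t
      show "lookup (p - p0) t = lookup (single ?x 1 * p') t"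
      proof (cases "lookup t n = 0")
        case True
        have "lookup (single ?x 1 * p') t = 0"
          by (rule lookup_single_mult_eq_0) (use True in \<open>auto simp: lookup_add\<close>)
        then show ?thesis using True by (simp add: lookup_minus p0_def)
      next
        case False
        then have t: "t = ?x + (t - ?x)" by (intro xterm_split) simp
        have "lookup (single ?x 1 * p') (?x + (t - ?x)) = lookup p (?x + (t - ?x))"
          unfolding lookup_single_mult by (simp add: p')
        then show ?thesis using False unfolding t[symmetric] by (simp add: lookup_minus p0_def)
      qed
    qed
    moreover have "p0 \<in> lifted_ideal"
      using lifted_ideal_T[OF Suc.prems(1)] xfree
      by (intro coeffs_lifted_ideal) (auto simp: p0_def keys_part when_def is_ideal_0[OF \<aa>])
    ultimately have xp': "single ?x 1 * p' \<in> lifted_ideal"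
      using lifted_ideal_diff[OF Suc.prems(1), of p0] by simp
    have keys_p': "?x + s \<in> keys p" if "s \<in> keys p'" for s using that by (simp add: in_keys_iff p')
    then have "keys p' \<subseteq> T" using lifted_ideal_T[OF Suc.prems(1)] by (fastforce dest: subsetD)
    then have p'_in: "p' \<in> lifted_ideal" using xp' by (rule xvar_nonzerodivisor)
    have *: "lookup p' s \<in> \<aa>" for s
    proof (rule Suc.IH[OF p'_in])
      fix s assume "s \<in> T" "\<not> B.normal s"
      then show "lookup p' s \<in> \<aa>" unfolding p' by (intro Suc.prems(2)) (simp_all add: xvar_T B.normal_xvar)
    next
      fix s assume "s \<in> keys p'"
      then show "tdeg s < d" using Suc.prems(3)[OF keys_p'] by fastforce
    qed
    show ?case
    proof (cases "lookup t n = 0")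
      case False
      then have t: "t = ?x + (t - ?x)" by (intro xterm_split) simp
      show ?thesis using *[of "t - ?x"] unfolding p' t[symmetric] .
    qed (rule xfree)
  qed
  note * = this
  have "\<exists>d. \<forall>t\<in>keys p. tdeg t < d"
    by (rule exI[of _ "Suc (\<Sum>t\<in>keys p. tdeg t)"]) (auto simp: less_Suc_eq_le intro: member_le_sum)
  then obtain d where "\<And>t. t \<in> keys p \<Longrightarrow> tdeg t < d" by blast
  from *[OF p this] show ?thesis .
qed

text \<open>
  A lift of \<open>p\<close> can be changed by elements of the ideal until its terms divisible by \<open>x\<^sub>n\<close> are normal for the second
  order.
\<close>
lemma lift_normal:
  assumes gb': "homogeneous_gb n prec' H f'" and p: "p \<in> H" "\<And>t. t \<in> keys p \<Longrightarrow> tdeg t = d"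
  obtains q where "q \<in> lifted_ideal"
    "\<forall>t\<in>keys (q - map_coeffs \<theta> p).
      t \<in> T \<and> 0 < lookup t n \<and> tdeg t = d \<and> homogeneous_gb.normal n prec' H t"
proof -
  interpret B: homogeneous_gb n prec' H f' by fact
  obtain q where q: "q \<in> pm.span (multiples n A F)"
    "\<forall>t\<in>keys (q - map_coeffs \<theta> p). t \<in> T \<and> 0 < lookup t n \<and> tdeg t = d"
    by (rule lift_H[OF p])
  let ?M = "{t. t \<in> T \<and> 0 < lookup t n \<and> tdeg t = d \<and> B.normal t}"
  have "q - map_coeffs \<theta> p \<in> pm.span (multiples n A F \<union> (\<lambda>t. single t 1) ` ?M)"
  proof (rule span_monomials)
    fix t assume "t \<in> keys (q - map_coeffs \<theta> p)"
    with q(2) have t: "t \<in> T" "0 < lookup t n" "tdeg t = d" by auto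
    let ?t = "t - xvar n"
    have t': "t = xvar n + ?t" by (rule xterm_split[OF t(2)])
    have d: "d = Suc (tdeg ?t)" using arg_cong[OF t', of tdeg] t(3) by simp
    have "single (xvar n) 1 * single ?t 1 \<in> pm.span (multiples n A F \<union> (\<lambda>t. single t (1 :: 'r)) ` ?M)"
    proof (rule span_single_mult[OF _ complement[OF gb' terms_in_minus[OF t(1)]]], rule pm.span_base)
      fix b assume "b \<in> multiples n A F \<union> normal_multiples prec' (tdeg ?t)"
      then show "single (xvar n) 1 * b \<in> multiples n A F \<union> (\<lambda>t. single t (1 :: 'r)) ` ?M"
      proof
        assume "b \<in> normal_multiples prec' (tdeg ?t)"
        then obtain s where s: "b = single s 1" "s \<in> T" "B.normal s" "tdeg s = tdeg ?t"
          by (auto simp: normal_multiples_def)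
        have "xvar n + s \<in> ?M" using s d by (simp add: xvar_T B.normal_xvar lookup_add)
        then show ?thesis by (intro UnI2 image_eqI[of _ _ "xvar n + s"]) (simp_all add: s(1) mult_single)
      qed (use multiples_xvar in blast)
    qed
    then show "single t 1 \<in> pm.span (multiples n A F \<union> (\<lambda>t. single t (1 :: 'r)) ` ?M)"
      unfolding mult_single t'[symmetric] by simp
  qed
  then obtain i \<nu> where D: "q - map_coeffs \<theta> p = i + \<nu>" and i: "i \<in> pm.span (multiples n A F)"
    and \<nu>: "\<nu> \<in> pm.span ((\<lambda>t. single t (1 :: 'r)) ` ?M)"
    unfolding pm.span_Un by blast
  have "keys \<nu> \<subseteq> ?M" by (rule span_keys[OF _ \<nu>]) auto
  moreover have "\<nu> = (q - i) - map_coeffs \<theta> p" using D by (simp add: algebra_simps)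
  moreover have "q - i \<in> lifted_ideal" by (rule span_multiples_lifted_ideal[OF pm.span_diff[OF q(1) i]])
  ultimately show thesis using that by blast
qed

end

section \<open>Substitutions\<close>


definition term_eval :: "('v \<Rightarrow> 's::comm_ring_1) \<Rightarrow> ('v \<Rightarrow>\<^sub>0 nat) \<Rightarrow> 's" where
  "term_eval \<sigma> m = (\<Prod>v\<in>keys m. \<sigma> v ^ lookup m v)"

lemma term_eval_superset: "finite B \<Longrightarrow> keys m \<subseteq> B \<Longrightarrow> term_eval \<sigma> m = (\<Prod>v\<in>B. \<sigma> v ^ lookup m v)"
  unfolding term_eval_def by (rule prod.mono_neutral_left) (auto simp: in_keys_iff)

lemma term_eval_0: "term_eval \<sigma> 0 = 1"
  by (simp add: term_eval_def)

lemma term_eval_add: "term_eval \<sigma> (s + t) = term_eval \<sigma> s * term_eval \<sigma> t"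
  by (simp add: term_eval_superset[of "keys s \<union> keys t"] keys_plus_nat lookup_add power_add prod.distrib)

lemma term_eval_single: "term_eval \<sigma> (single v 1) = \<sigma> v"
  by (simp add: term_eval_def)

definition subst ::
  "('v \<Rightarrow> ('w \<Rightarrow>\<^sub>0 nat) \<Rightarrow>\<^sub>0 'k::comm_ring_1) \<Rightarrow> (('v \<Rightarrow>\<^sub>0 nat) \<Rightarrow>\<^sub>0 'k) \<Rightarrow> (('w \<Rightarrow>\<^sub>0 nat) \<Rightarrow>\<^sub>0 'k)" where
  "subst \<sigma> = poly_eval (single 0) (term_eval \<sigma>)"

lemma subst_ring_map: "ring_map (subst \<sigma>)"
  unfolding subst_def by (rule poly_eval_ring_map[OF ring_map_single]) (simp_all add: term_eval_0 term_eval_add)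

lemma subst_const: "subst \<sigma> (single 0 c) = single 0 c"
  by (simp add: subst_def ring_map_single term_eval_0)

lemma subst_var: "subst \<sigma> (single (single v 1) 1) = \<sigma> v"
  by (simp only: subst_def poly_eval_single[OF ring_map_single] term_eval_single) simp

text \<open>
  Used for comparing homomorphisms on \<open>K[V]\<close>: they agree, also modulo an ideal, if they do so on constants and
  variables.
\<close>
lemma poly_ring_induct [consumes 1, case_names const var add mult]:
  fixes r :: "('v \<Rightarrow>\<^sub>0 nat) \<Rightarrow>\<^sub>0 'k::comm_ring_1"
  assumes r: "keys r \<subseteq> terms_in V"
    and const: "\<And>c. Q (single 0 c)" and var: "\<And>v. v \<in> V \<Longrightarrow> Q (single (single v 1) 1)"
    and add: "\<And>p q. keys p \<subseteq> terms_in V \<Longrightarrow> keys q \<subseteq> terms_in V \<Longrightarrow> Q p \<Longrightarrow> Q q \<Longrightarrow> Q (p + q)"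
    and mult: "\<And>p q. keys p \<subseteq> terms_in V \<Longrightarrow> keys q \<subseteq> terms_in V \<Longrightarrow> Q p \<Longrightarrow> Q q \<Longrightarrow> Q (p * q)"
  shows "Q r"
proof -
  have mon: "Q (single m 1)" if "m \<in> terms_in V" for m
    using that
  proof (induction "tdeg m" arbitrary: m)
    case 0
    then show ?case using const[of 1] by simp
  next
    case (Suc d)
    then have "m \<noteq> 0" by auto
    then obtain v where v: "v \<in> keys m" by (metis keys_eq_empty ex_in_conv)
    let ?m = "m - single v 1"
    have m: "m = single v 1 + ?m"
      using v by (intro poly_mapping_eqI) (auto simp: lookup_add lookup_minus lookup_single when_def in_keys_iff)
    have "d = tdeg ?m" using arg_cong[OF m, of tdeg] Suc(2) by simp
    then have Qm: "Q (single ?m 1)" by (rule Suc(1)) (rule terms_in_minus[OF Suc.prems])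
    have vV: "v \<in> V" using v Suc.prems by (auto simp: terms_in_def)
    have "Q (single (single v 1) 1 * single ?m 1)"
      by (rule mult[OF _ _ var[OF vV] Qm]) (auto simp: terms_in_single[OF vV] terms_in_minus[OF Suc.prems])
    then show ?case unfolding mult_single m[symmetric] by simp
  qed
  have "finite B \<Longrightarrow> B \<subseteq> terms_in V \<Longrightarrow> Q (\<Sum>t\<in>B. single t (lookup r t))
      \<and> keys (\<Sum>t\<in>B. single t (lookup r t)) \<subseteq> terms_in V" for B
  proof (induction B rule: finite_induct)
    case empty
    then show ?case using const[of 0] by simp
  next
    case (insert t B)
    have t: "t \<in> terms_in V" using insert by blast
    have "Q (single 0 (lookup r t) * single t 1)"
      by (rule mult[OF _ _ const mon[OF t]]) (use t in auto)
    then have Qt: "Q (single t (lookup r t))" by (simp add: mult_single)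
    have kt: "keys (single t (lookup r t)) \<subseteq> terms_in V" using t by auto
    show ?case using insert add[OF kt _ Qt] keys_add_subset[OF kt] by simp
  qed
  from this[of "keys r"] show ?thesis using r poly_eq_sum_single[of r] by simp
qed

lemma ring_maps_eq_on:
  assumes "ring_map \<chi>" "ring_map \<eta>" "keys r \<subseteq> terms_in V"
    and "\<And>c. \<chi> (single 0 c) = \<eta> (single 0 c)"
    and "\<And>v. v \<in> V \<Longrightarrow> \<chi> (single (single v 1) 1) = \<eta> (single (single v 1) 1)"
  shows "\<chi> r = \<eta> r"
  using assms(3) by (induction r rule: poly_ring_induct) (simp_all add: assms ring_map_add ring_map_mult)

lemma subst_keys:
  assumes "keys r \<subseteq> terms_in V" "\<And>v. v \<in> V \<Longrightarrow> keys (\<sigma> v) \<subseteq> terms_in W"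
  shows "keys (subst \<sigma> r) \<subseteq> terms_in W"
  using assms(1)
  by (induction r rule: poly_ring_induct)
    (simp_all add: subst_const subst_var assms(2) ring_map_add[OF subst_ring_map] ring_map_mult[OF subst_ring_map]
      keys_add_subset keys_mult_subset)

text \<open>
  The retraction, which sends the variables outside \<open>V\<close> to zero, leads from the polynomials of the whole type
  back to \<open>K[V]\<close>.
\<close>
definition retract :: "'v set \<Rightarrow> (('v \<Rightarrow>\<^sub>0 nat) \<Rightarrow>\<^sub>0 'k::comm_ring_1) \<Rightarrow> (('v \<Rightarrow>\<^sub>0 nat) \<Rightarrow>\<^sub>0 'k)" where
  "retract V = subst (\<lambda>v. if v \<in> V then single (single v 1) 1 else 0)"

lemma retract_ring_map: "ring_map (retract V)"
  unfolding retract_def by (rule subst_ring_map)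

lemma retract_keys: "keys (retract V r) \<subseteq> terms_in V"
  unfolding retract_def by (rule subst_keys[of _ UNIV]) (auto simp: terms_in_def)

lemma retract_id: "keys r \<subseteq> terms_in V \<Longrightarrow> retract V r = r"
proof (rule ring_maps_eq_on[OF retract_ring_map, of "\<lambda>r. r"])
  show "ring_map (\<lambda>r :: ('a \<Rightarrow>\<^sub>0 nat) \<Rightarrow>\<^sub>0 'b. r)" by (simp add: ring_map_def)
qed (auto simp: retract_def subst_const subst_var)

lemma subst_retract: "(\<And>v. v \<notin> V \<Longrightarrow> \<sigma> v = 0) \<Longrightarrow> subst \<sigma> (retract V r) = subst \<sigma> r"
  unfolding retract_def
  by (rule ring_maps_eq_on[where V = UNIV and \<eta> = "subst \<sigma>"])
    (auto simp: subst_ring_map ring_map_comp subst_const subst_var terms_in_def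
      ring_map_0[OF subst_ring_map])

text \<open>
  Extending an ideal of \<open>K[V]\<close> along the retraction, instead of generating an ideal, makes the
  contraction back to \<open>K[V]\<close> immediate.
\<close>
definition retract_ideal :: "'v set \<Rightarrow> (('v \<Rightarrow>\<^sub>0 nat) \<Rightarrow>\<^sub>0 'k::field) set \<Rightarrow> (('v \<Rightarrow>\<^sub>0 nat) \<Rightarrow>\<^sub>0 'k) set" where
  "retract_ideal V I = {r. retract V r \<in> I}"

lemma retract_ideal_is_ideal: "ideal I (poly_ring (terms_in V)) \<Longrightarrow> is_ideal (retract_ideal V I)"
  unfolding is_ideal_def retract_ideal_def
  by (simp add: ring_map_0[OF retract_ring_map] ring_map_add[OF retract_ring_map]
      ring_map_mult[OF retract_ring_map] ideal_zero ideal_add ideal_mult[OF _ _ retract_keys])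

lemma retract_ideal_iff: "keys r \<subseteq> terms_in V \<Longrightarrow> r \<in> retract_ideal V I \<longleftrightarrow> r \<in> I"
  by (simp add: retract_ideal_def retract_id)

lemma retract_ideal_diff: "ideal I (poly_ring (terms_in V)) \<Longrightarrow> retract V r - r \<in> retract_ideal V I"
  by (simp add: retract_ideal_def ring_map_diff[OF retract_ring_map] retract_id[OF retract_keys] ideal_zero)

section \<open>Polynomials in two groups of variables\<close>

text \<open>
  The isomorphism of \<open>K[C][x]\<close>, with terms in both groups of variables, onto the polynomials in \<open>x\<close>
  with coefficients in \<open>K[C]\<close>.
\<close>
definition curry_poly ::
  "('a::comm_monoid_add \<times> 'b::comm_monoid_add \<Rightarrow>\<^sub>0 'k::comm_ring_1) \<Rightarrow> 'a \<Rightarrow>\<^sub>0 ('b \<Rightarrow>\<^sub>0 'k)" where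
  "curry_poly = poly_eval (\<lambda>k. single 0 (single 0 k)) (\<lambda>(t, c). single t (single c 1))"

lemma single_single_ring_map:
  "ring_map (\<lambda>k. single 0 (single 0 k) :: 'a::comm_monoid_add \<Rightarrow>\<^sub>0 ('b::comm_monoid_add \<Rightarrow>\<^sub>0 'k::comm_ring_1))"
  by (rule ring_map_comp[OF ring_map_single ring_map_single])

lemma curry_poly_ring_map: "ring_map curry_poly"
  unfolding curry_poly_def
  by (rule poly_eval_ring_map[OF single_single_ring_map]) (auto simp: mult_single zero_prod_def split: prod.splits)

lemma curry_poly_single: "curry_poly (single (t, c) k) = single t (single c k)"
  by (simp add: curry_poly_def poly_eval_single[OF single_single_ring_map] mult_single)

lemma lookup_curry_poly: "lookup (lookup (curry_poly p) t) c = lookup p (t, c)"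
proof (induction p rule: poly_induct)
  case (add s k p)
  obtain s1 s2 where "s = (s1, s2)" by force
  then show ?case using add
    by (auto simp: ring_map_add[OF curry_poly_ring_map] curry_poly_single lookup_add lookup_single when_def)
qed (simp add: ring_map_0[OF curry_poly_ring_map])

lemma keys_curry_poly: "t \<in> keys (curry_poly p) \<longleftrightarrow> (\<exists>c. (t, c) \<in> keys p)"
proof -
  have "t \<notin> keys (curry_poly p) \<longleftrightarrow> (\<forall>c. (t, c) \<notin> keys p)"
    by (simp add: in_keys_iff poly_mapping_eq_iff fun_eq_iff lookup_curry_poly)
  then show ?thesis by blast
qed

lemma coeff_x_eq: "coeff_x p t = lookup (curry_poly p) t"
proof (rule poly_mapping_eqI)
  fix c
  have "inj (Pair t :: cterm \<Rightarrow> _)" by (rule injI) simp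
  then show "lookup (coeff_x p t) c = lookup (lookup (curry_poly p) t) c"
    by (simp add: coeff_x_def map_key.rep_eq lookup_curry_poly)
qed

lemma lookup_emb_x: "lookup (emb_x p) (t, c) = (lookup p t when c = 0)"
proof -
  have "lookup (emb_x p) (t, c) = (\<Sum>s\<in>keys p. if s = t then (lookup p t when c = 0) else 0)"
    unfolding emb_x_def by (auto simp: lookup_sum lookup_single when_def intro!: sum.cong)
  also have "\<dots> = (lookup p t when c = 0)" by (simp add: in_keys_iff)
  finally show ?thesis .
qed

lemma lookup_emb_c: "lookup (emb_c p) (t, c) = (lookup p c when t = 0)"
proof -
  have "lookup (emb_c p) (t, c) = (\<Sum>s\<in>keys p. if s = c then (lookup p c when t = 0) else 0)"
    unfolding emb_c_def by (auto simp: lookup_sum lookup_single when_def intro!: sum.cong)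
  also have "\<dots> = (lookup p c when t = 0)" by (simp add: in_keys_iff)
  finally show ?thesis .
qed

lemma curry_poly_emb_x: "curry_poly (emb_x p) = map_coeffs (single 0) p"
  by (rule poly_mapping_eqI, rule poly_mapping_eqI)
    (auto simp: lookup_curry_poly lookup_emb_x ring_map_single lookup_single when_def)

lemma curry_poly_emb_c: "curry_poly (emb_c p) = single 0 p"
  by (rule poly_mapping_eqI, rule poly_mapping_eqI)
    (auto simp: lookup_curry_poly lookup_emb_c lookup_single when_def)

lemma curry_poly_inj: "curry_poly p = curry_poly q \<longleftrightarrow> p = q"
proof
  assume *: "curry_poly p = curry_poly q"
  show "p = q"
  proof (rule poly_mapping_eqI)
    fix s show "lookup p s = lookup q s"
      using lookup_curry_poly[of p "fst s" "snd s"] lookup_curry_poly[of q "fst s" "snd s"] * by simp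
  qed
qed simp

lemma emb_c_ring_map: "ring_map (emb_c :: (cterm \<Rightarrow>\<^sub>0 'k::field) \<Rightarrow> _)"
  unfolding ring_map_def
  by (simp add: curry_poly_emb_c single_add mult_single ring_map_1[OF curry_poly_ring_map]
      ring_map_add[OF curry_poly_ring_map] ring_map_mult[OF curry_poly_ring_map] flip: curry_poly_inj)

section \<open>Reductions\<close>

context homogeneous_gb
begin

text \<open>
  The polynomials \<open>f \<alpha> + g \<alpha>\<close> and the \<open>p \<beta>\<close> agree with a member of the reduced Groebner basis at \<open>x\<^sub>n = 0\<close>,
  and this alone determines their head terms: the graded order puts every term divisible by \<open>x\<^sub>n\<close> below the
  other terms of the same degree.
\<close>
definition deforms :: "xterm \<Rightarrow> (xterm \<times> cterm \<Rightarrow>\<^sub>0 'k) \<Rightarrow> bool" where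
  "deforms \<alpha> P \<longleftrightarrow> (\<forall>t c. (t, c) \<in> keys P \<longrightarrow> t \<in> terms_in {..n} \<and> tdeg t = tdeg \<alpha>) \<and>
    (\<forall>t c. lookup t n = 0 \<longrightarrow> lookup P (t, c) = (lookup (f \<alpha>) t when c = 0))"

lemma deforms_key:
  assumes \<alpha>: "\<alpha> \<in> A" and P: "deforms \<alpha> P" and t: "(t, c) \<in> keys P" "(t, c) \<noteq> (\<alpha>, 0)"
  shows "graded_ext n prec t \<alpha>" "t \<noteq> \<alpha>"
proof -
  have \<alpha>n: "lookup \<alpha> n = 0" using A_terms[OF \<alpha>] by (simp add: terms_lessThan_iff)
  have td: "tdeg t = tdeg \<alpha>" using P t by (auto simp: deforms_def)
  have "graded_ext n prec t \<alpha> \<and> t \<noteq> \<alpha>"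
  proof (cases "lookup t n = 0")
    case True
    then have "lookup P (t, c) = (lookup (f \<alpha>) t when c = 0)" using P unfolding deforms_def by blast
    then have "c = 0" "t \<in> keys (f \<alpha>)" using t(1) by (auto simp: in_keys_iff when_def split: if_splits)
    then have "prec t \<alpha>" "t \<noteq> \<alpha>" using t(2) f_less[OF \<alpha>] by auto
    then show ?thesis using td True \<alpha>n by (simp add: graded_ext_def update_0_id)
  next
    case False
    then show ?thesis using td \<alpha>n by (auto simp: graded_ext_def)
  qed
  then show "graded_ext n prec t \<alpha>" "t \<noteq> \<alpha>" by auto
qed

lemma deforms_lc: "\<alpha> \<in> A \<Longrightarrow> deforms \<alpha> P \<Longrightarrow> lookup P (\<alpha>, 0) = 1"
  using A_terms[of \<alpha>] f_lc[of \<alpha>] by (simp add: deforms_def terms_lessThan_iff)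

lemma deforms_head:
  assumes \<alpha>: "\<alpha> \<in> A" and P: "deforms \<alpha> P"
  shows "head_term (elim_order (graded_ext n prec) precC) P = (\<alpha>, 0)"
    "head_coeff (elim_order (graded_ext n prec) precC) P = 1"
proof -
  show "head_term (elim_order (graded_ext n prec) precC) P = (\<alpha>, 0)"
  proof (rule head_termI)
    show "(\<alpha>, 0) \<in> keys P" using deforms_lc[OF \<alpha> P] by (simp add: in_keys_iff)
    fix s assume s: "s \<in> keys P" "s \<noteq> (\<alpha>, 0)"
    obtain t c where tc: "s = (t, c)" by force
    note st = deforms_key[OF \<alpha> P s[unfolded tc]]
    have T: "t \<in> terms_in {..n}" "\<alpha> \<in> terms_in {..n}"
      using P s(1) A_terms[OF \<alpha>] by (auto simp: tc deforms_def terms_lessThan_iff)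
    have "\<not> graded_ext n prec \<alpha> t"
      using graded_ext_trans[OF ord T(1,2,1) st(1)] graded_ext_irrefl[OF ord T(1)] by blast
    then show "elim_order (graded_ext n prec) precC s (\<alpha>, 0)
        \<and> \<not> elim_order (graded_ext n prec) precC (\<alpha>, 0) s"
      using st by (simp add: tc elim_order_def)
  qed
  then show "head_coeff (elim_order (graded_ext n prec) precC) P = 1"
    by (simp add: head_coeff_def deforms_lc[OF \<alpha> P])
qed

lemma finite_param_terms: "finite (param_terms n prec H \<alpha>)"
  by (rule finite_subset[OF _ finite_terms_tdeg_le[of "{..n}" "tdeg \<alpha>"]]) (auto simp: param_terms_def)

lemma param_terms_iff: "\<gamma> \<in> param_terms n prec H \<alpha> \<longleftrightarrow>
    xvar n + \<gamma> \<in> terms_in {..n} \<and> normal (xvar n + \<gamma>) \<and> tdeg (xvar n + \<gamma>) = tdeg \<alpha>"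
  unfolding param_terms_def normal_ext_iff by auto

lemma curry_g_poly:
  "curry_poly (g_poly n prec H \<alpha>)
    = (\<Sum>\<gamma>\<in>param_terms n prec H \<alpha>. single (xvar n + \<gamma>) (single (single (\<alpha>, \<gamma>) 1) (1 :: 'k)))"
  unfolding g_poly_def ring_map_sum[OF curry_poly_ring_map] curry_poly_single ..

lemma keys_g_poly:
  assumes "(t, c) \<in> keys (g_poly n prec H \<alpha> :: _ \<Rightarrow>\<^sub>0 'k)"
  obtains \<gamma> where "\<gamma> \<in> param_terms n prec H \<alpha>" "t = xvar n + \<gamma>" "c = single (\<alpha>, \<gamma>) 1"
proof -
  have "(t, c) \<in> (\<Union>\<gamma>\<in>param_terms n prec H \<alpha>. keys (single (xvar n + \<gamma>, single (\<alpha>, \<gamma>) (1::nat)) (1 :: 'k)))"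
    using assms unfolding g_poly_def by (rule subsetD[OF keys_sum])
  then obtain \<gamma> where \<gamma>: "\<gamma> \<in> param_terms n prec H \<alpha>"
      "(t, c) \<in> keys (single (xvar n + \<gamma>, single (\<alpha>, \<gamma>) (1::nat)) (1 :: 'k))" by (rule UN_E)
  from \<gamma>(2) have "t = xvar n + \<gamma>" "c = single (\<alpha>, \<gamma>) 1" by simp_all
  with \<gamma>(1) show thesis by (rule that)
qed

abbreviation fg :: "xterm \<Rightarrow> (xterm \<times> cterm \<Rightarrow>\<^sub>0 'k)" where "fg \<equiv> fg_poly n prec H f"

lemma keys_fg:
  assumes "\<alpha> \<in> A" "(t, c) \<in> keys (fg \<alpha>)"
  shows "t \<in> terms_in {..n}" "tdeg t = tdeg \<alpha>" "c \<in> terms_in (params n prec H)"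
proof -
  have "(t, c) \<in> keys (emb_x (f \<alpha>)) \<or> (t, c) \<in> keys (g_poly n prec H \<alpha> :: _ \<Rightarrow>\<^sub>0 'k)"
    using assms(2) unfolding fg_poly_def Un_iff[symmetric] by (rule subsetD[OF keys_add])
  then have "t \<in> terms_in {..n} \<and> tdeg t = tdeg \<alpha> \<and> c \<in> terms_in (params n prec H)"
  proof
    assume "(t, c) \<in> keys (emb_x (f \<alpha>))"
    then have "t \<in> keys (f \<alpha>)" "c = 0" by (auto simp: in_keys_iff lookup_emb_x when_def split: if_splits)
    then show ?thesis using keys_f[OF assms(1)] f_homogeneous[OF assms(1)]
      by (auto simp: terms_lessThan_iff)
  next
    assume "(t, c) \<in> keys (g_poly n prec H \<alpha> :: _ \<Rightarrow>\<^sub>0 'k)"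
    then obtain \<gamma> where \<gamma>: "\<gamma> \<in> param_terms n prec H \<alpha>" "t = xvar n + \<gamma>" "c = single (\<alpha>, \<gamma>) 1"
      by (rule keys_g_poly)
    have "(\<alpha>, \<gamma>) \<in> params n prec H" using \<gamma>(1) assms(1) by (simp add: params_def)
    then have "c \<in> terms_in (params n prec H)" unfolding \<gamma>(3) by (rule terms_in_single)
    then show ?thesis using \<gamma>(1)[unfolded param_terms_iff] by (simp add: \<gamma>(2))
  qed
  then show "t \<in> terms_in {..n}" "tdeg t = tdeg \<alpha>" "c \<in> terms_in (params n prec H)" by auto
qed

lemma deforms_fg: "\<alpha> \<in> A \<Longrightarrow> deforms \<alpha> (fg \<alpha>)"
  unfolding deforms_def
proof (intro conjI allI impI)
  fix t :: xterm and c :: cterm assume "\<alpha> \<in> A" "lookup t n = 0"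
  have "(t, c) \<notin> keys (g_poly n prec H \<alpha> :: _ \<Rightarrow>\<^sub>0 'k)"
    using \<open>lookup t n = 0\<close> by (auto simp: lookup_add elim!: keys_g_poly)
  then show "lookup (fg \<alpha>) (t, c) = (lookup (f \<alpha>) t when c = 0)"
    by (simp add: fg_poly_def lookup_add lookup_emb_x in_keys_iff)
qed (auto dest: keys_fg)

end

context homogeneous_gb
begin

lemma lookup_curry_fg:
  assumes \<alpha>: "\<alpha> \<in> A"
  shows "lookup (curry_poly (fg \<alpha>)) t =
    (if lookup t n = 0 then single 0 (lookup (f \<alpha>) t)
     else single (single (\<alpha>, t - xvar n) 1) 1 when t \<in> terms_in {..n} \<and> normal t \<and> tdeg t = tdeg \<alpha>)"
proof (cases "lookup t n = 0")
  case True
  then show ?thesis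
    using deforms_fg[OF \<alpha>] by (intro poly_mapping_eqI) (auto simp: deforms_def lookup_curry_poly lookup_single when_def)
next
  case False
  then have t: "t = xvar n + (t - xvar n)" by (intro xterm_split) simp
  have "t \<notin> keys (f \<alpha>)" using keys_f[OF \<alpha>] False by (auto simp: terms_lessThan_iff)
  then have "lookup (curry_poly (fg \<alpha>)) t
      = (\<Sum>\<gamma>\<in>param_terms n prec H \<alpha>. lookup (single (xvar n + \<gamma>) (single (single (\<alpha>, \<gamma>) 1) (1 :: 'k))) t)"
    by (simp add: fg_poly_def ring_map_add[OF curry_poly_ring_map] curry_poly_emb_x curry_g_poly lookup_add
        ring_map_single lookup_sum in_keys_iff)
  also have "\<dots> = (\<Sum>\<gamma>\<in>param_terms n prec H \<alpha>. if \<gamma> = t - xvar n then single (single (\<alpha>, t - xvar n) 1) 1 else 0)"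
  proof (rule sum.cong[OF refl])
    fix \<gamma>
    have "xvar n + \<gamma> = t \<longleftrightarrow> \<gamma> = t - xvar n" using t by (metis add_left_cancel)
    then show "lookup (single (xvar n + \<gamma>) (single (single (\<alpha>, \<gamma>) 1) (1 :: 'k))) t
        = (if \<gamma> = t - xvar n then single (single (\<alpha>, t - xvar n) 1) 1 else 0)"
      by (simp add: lookup_single when_def)
  qed
  also have "\<dots> = (single (single (\<alpha>, t - xvar n) 1) 1 when t - xvar n \<in> param_terms n prec H \<alpha>)"
    by (simp add: finite_param_terms when_def)
  also have "t - xvar n \<in> param_terms n prec H \<alpha> \<longleftrightarrow> t \<in> terms_in {..n} \<and> normal t \<and> tdeg t = tdeg \<alpha>"
    unfolding param_terms_iff t[symmetric] ..
  finally show ?thesis using False by simp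
qed

lemma param_iff:
  assumes "\<alpha> \<in> A"
  shows "(\<alpha>, \<gamma>) \<in> params n prec H \<longleftrightarrow>
    xvar n + \<gamma> \<in> terms_in {..n} \<and> normal (xvar n + \<gamma>) \<and> tdeg (xvar n + \<gamma>) = tdeg \<alpha>"
  using assms by (simp add: params_def param_terms_iff)

text \<open>
  Since the head term of \<open>P\<close> is \<open>\<alpha>\<close> with trivial parameter part, every multiple of \<open>\<alpha>\<close> can be reduced by \<open>P\<close>,
  whatever its parameter part is.
\<close>
lemma irreducible_not_divisible:
  assumes irred: "\<not> (\<exists>r'. red_step (elim_order (graded_ext n prec) precC) G r r')"
    and P: "\<alpha> \<in> A" "deforms \<alpha> P" "P \<in> G" and t: "(t, c) \<in> keys r"
  shows "\<not> tdvd \<alpha> t"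
proof
  assume "tdvd \<alpha> t"
  then have t': "t = \<alpha> + (t - \<alpha>)" by (rule tdvd_imp_minus)
  let ?o = "elim_order (graded_ext n prec) precC"
  have "(t - \<alpha>, c) + head_term ?o P \<in> keys r"
    unfolding deforms_head(1)[OF P(1,2)] using t t' by (simp add: add.commute)
  moreover have "P \<noteq> 0" using deforms_lc[OF P(1,2)] by auto
  ultimately show False using irred P(3) unfolding red_step_def by blast
qed

lemma spoly_fg:
  assumes "\<alpha> \<in> A" "\<beta> \<in> A"
  shows "spoly (elim_order (graded_ext n prec) precC) (fg \<alpha>) (fg \<beta>)
    = single (\<beta> - \<alpha>, 0) 1 * fg \<alpha> - single (\<alpha> - \<beta>, 0) 1 * fg \<beta>"
proof -
  have "term_lcm (\<alpha>, 0 :: cterm) (\<beta>, 0) = (term_lcm \<alpha> \<beta>, 0)" by (simp add: term_lcm_def)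
  then show ?thesis
    by (simp add: spoly_def Let_def deforms_head[OF _ deforms_fg] assms term_lcm_xterm(1,2))
qed

text \<open>
  A reduction of an S-polynomial only uses multiples whose head terms lie below the least common multiple,
  because the head terms cancel.
\<close>
lemma spoly_reduction:
  fixes precC
  defines "ordxc \<equiv> elim_order (graded_ext n prec) precC"
  assumes \<alpha>: "\<alpha> \<in> A" and \<beta>: "\<beta> \<in> A"
    and red: "complete_reduction ordxc (fg ` A) (spoly ordxc (fg \<alpha>) (fg \<beta>)) \<rho>"
  shows "single (\<beta> - \<alpha>) 1 * curry_poly (fg \<alpha>) - single (\<alpha> - \<beta>) 1 * curry_poly (fg \<beta>) - curry_poly \<rho>
      \<in> pm.span {single u 1 * curry_poly (fg \<gamma>) | u \<gamma>. u \<in> terms_in {..n} \<and> \<gamma> \<in> A \<and>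
          graded_ext n prec (u + \<gamma>) (term_lcm \<alpha> \<beta>)}" (is "_ \<in> pm.span ?S")
    and "(t, c) \<in> keys \<rho> \<Longrightarrow> t \<in> terms_in {..n} \<and> c \<in> terms_in (params n prec H) \<and> normal t"
proof -
  let ?l = "term_lcm \<alpha> \<beta>" and ?T = "terms_in {..n}" and ?U = "terms_in (params n prec H)"
  define S where "S = single (\<beta> - \<alpha>, 0) 1 * fg \<alpha> - single (\<alpha> - \<beta>, 0) 1 * fg \<beta>"
  note cm = curry_poly_ring_map
  have cS: "curry_poly S = single (\<beta> - \<alpha>) 1 * curry_poly (fg \<alpha>) - single (\<alpha> - \<beta>) 1 * curry_poly (fg \<beta>)"
    by (simp add: S_def ring_map_diff[OF cm] ring_map_mult[OF cm] curry_poly_single)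
  have \<alpha>T: "\<alpha> \<in> ?T" and \<beta>T: "\<beta> \<in> ?T" using A_terms \<alpha> \<beta> by (simp_all add: terms_lessThan_iff)
  have lT: "?l \<in> ?T" unfolding term_lcm_xterm(4) using \<alpha>T terms_in_minus[OF \<beta>T] by simp
  have mult_key: "t \<in> ?T \<and> c \<in> ?U \<and> graded_ext n prec t (u + \<gamma>)"
    if tc: "(t, c) \<in> keys (single (u, v) k * fg \<gamma>)" "t \<noteq> u + \<gamma> \<or> c \<noteq> v"
      and \<gamma>: "\<gamma> \<in> A" and u: "u \<in> ?T" "v \<in> ?U" for t c u v k \<gamma>
  proof -
    obtain s where s: "(t, c) = (u, v) + s" "s \<in> keys (fg \<gamma>)" using tc(1) keys_single_mult by blast
    obtain s1 s2 where s12: "s = (s1, s2)" by force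
    have t: "t = u + s1" "c = v + s2" using s(1) by (simp_all add: s12)
    have "(s1, s2) \<noteq> (\<gamma>, 0)" using tc(2) t by auto
    note sk = s(2)[unfolded s12]
    have "graded_ext n prec s1 \<gamma>" by (rule deforms_key(1)[OF \<gamma> deforms_fg[OF \<gamma>] sk]) fact
    moreover have "\<gamma> \<in> ?T" using A_terms[OF \<gamma>] by (simp add: terms_lessThan_iff)
    ultimately show ?thesis
      using graded_ext_add[OF ord keys_fg(1)[OF \<gamma> sk] _ u(1)] keys_fg(1,3)[OF \<gamma> sk] u by (simp add: t)
  qed
  have lc: "lookup (single (u, v) k * fg \<gamma>) (u + \<gamma>, v) = k" if "\<gamma> \<in> A" for u v k \<gamma>
    using lookup_single_mult[of "(u, v)" k "fg \<gamma>" "(\<gamma>, 0)"] deforms_lc[OF that deforms_fg[OF that]] by simp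
  \<comment> \<open>The two multiples have the same head coefficient at \<open>(?l, 0)\<close>, so it cancels in \<open>S\<close>.\<close>
  have start: "t \<in> ?T \<and> c \<in> ?U \<and> graded_ext n prec t ?l" if tc: "(t, c) \<in> keys S" for t c
  proof -
    have l: "?l = \<beta> - \<alpha> + \<alpha>" "?l = \<alpha> - \<beta> + \<beta>" using term_lcm_xterm(4,5)[of \<alpha> \<beta>] by (simp_all add: add.commute)
    have "lookup S (?l, 0) = 0"
      unfolding S_def lookup_minus using lc[OF \<alpha>, of "\<beta> - \<alpha>" 0 1] lc[OF \<beta>, of "\<alpha> - \<beta>" 0 1]
      by (simp flip: l)
    then have ne: "t \<noteq> ?l \<or> c \<noteq> 0" using tc by (auto simp: in_keys_iff)
    have "(t, c) \<in> keys (single (\<beta> - \<alpha>, 0) 1 * fg \<alpha>) \<or> (t, c) \<in> keys (single (\<alpha> - \<beta>, 0) 1 * fg \<beta>)"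
      using tc unfolding S_def Un_iff[symmetric] by (rule subsetD[OF keys_minus_subset])
    then show ?thesis
    proof
      assume "(t, c) \<in> keys (single (\<beta> - \<alpha>, 0) 1 * fg \<alpha>)"
      from mult_key[OF this ne[unfolded l(1)] \<alpha> terms_in_minus[OF \<beta>T] terms_in_0]
      show ?thesis by (simp flip: l)
    next
      assume "(t, c) \<in> keys (single (\<alpha> - \<beta>, 0) 1 * fg \<beta>)"
      from mult_key[OF this ne[unfolded l(2)] \<beta> terms_in_minus[OF \<alpha>T] terms_in_0]
      show ?thesis by (simp flip: l)
    qed
  qed
  have red': "(red_step ordxc (fg ` A))\<^sup>*\<^sup>* S \<rho>" and irred: "\<not> (\<exists>r'. red_step ordxc (fg ` A) \<rho> r')"
    using red spoly_fg[OF \<alpha> \<beta>] unfolding complete_reduction_def ordxc_def S_def by auto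
  have inv: "curry_poly S - curry_poly p \<in> pm.span ?S \<and>
      (\<forall>t c. (t, c) \<in> keys p \<longrightarrow> t \<in> ?T \<and> c \<in> ?U \<and> graded_ext n prec t ?l)"
    if "(red_step ordxc (fg ` A))\<^sup>*\<^sup>* S p" for p
    using that
  proof (induction rule: rtranclp_induct)
    case base
    then show ?case using start by (simp add: pm.span_zero)
  next
    case (step p q)
    from step.hyps(2) obtain \<gamma> w where \<gamma>: "\<gamma> \<in> A" and w: "w + head_term ordxc (fg \<gamma>) \<in> keys p"
      and q: "q = p - single w (lookup p (w + head_term ordxc (fg \<gamma>)) / head_coeff ordxc (fg \<gamma>)) * fg \<gamma>"
      unfolding red_step_def by blast
    obtain u v where uv: "w = (u, v)" by force
    define k where "k = lookup p (u + \<gamma>, v)"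
    have key: "(u + \<gamma>, v) \<in> keys p" and q': "q = p - single (u, v) k * fg \<gamma>"
      using w q deforms_head[OF \<gamma> deforms_fg[OF \<gamma>], of precC] by (simp_all add: uv k_def ordxc_def)
    from step.IH key have "u + \<gamma> \<in> ?T \<and> v \<in> ?U \<and> graded_ext n prec (u + \<gamma>) ?l" by blast
    then have uT: "u \<in> ?T" "v \<in> ?U" "graded_ext n prec (u + \<gamma>) ?l" "u + \<gamma> \<in> ?T" by simp_all
    have "single u 1 * curry_poly (fg \<gamma>) \<in> ?S" using uT \<gamma> by blast
    then have "smul (single v k) (single u 1 * curry_poly (fg \<gamma>)) \<in> pm.span ?S"
      by (intro pm.span_scale pm.span_base)
    moreover have "curry_poly S - curry_poly q
        = (curry_poly S - curry_poly p) + smul (single v k) (single u 1 * curry_poly (fg \<gamma>))"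
      by (simp add: q' ring_map_diff[OF cm] ring_map_mult[OF cm] curry_poly_single single_mult_smul[of u "single v k"])
    ultimately have 1: "curry_poly S - curry_poly q \<in> pm.span ?S"
      using step.IH by (simp only: pm.span_add)
    have 2: "t \<in> ?T \<and> c \<in> ?U \<and> graded_ext n prec t ?l" if tc: "(t, c) \<in> keys q" for t c
    proof -
      have "(t, c) \<in> keys p \<or> (t, c) \<in> keys (single (u, v) k * fg \<gamma>)"
        using tc unfolding q' Un_iff[symmetric] by (rule subsetD[OF keys_minus_subset])
      then show ?thesis
      proof
        assume *: "(t, c) \<in> keys (single (u, v) k * fg \<gamma>)"
        show ?thesis
        proof (cases "t = u + \<gamma> \<and> c = v")
          case True
          then show ?thesis using uT by simp
        next
          case False
          then have "t \<in> ?T \<and> c \<in> ?U \<and> graded_ext n prec t (u + \<gamma>)"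
            using mult_key[OF * _ \<gamma> uT(1,2)] by blast
          then show ?thesis using graded_ext_trans[OF ord _ uT(4) lT _ uT(3)] by blast
        qed
      qed (use step.IH in blast)
    qed
    show ?case using 1 2 by blast
  qed
  from inv[OF red'] show "single (\<beta> - \<alpha>) 1 * curry_poly (fg \<alpha>) - single (\<alpha> - \<beta>) 1 * curry_poly (fg \<beta>) - curry_poly \<rho>
      \<in> pm.span ?S" by (simp only: cS)
  assume t: "(t, c) \<in> keys \<rho>"
  have "normal t"
    unfolding normal_def using irreducible_not_divisible[OF irred[unfolded ordxc_def] _ deforms_fg _ t] by blast
  then show "t \<in> ?T \<and> c \<in> ?U \<and> normal t" using inv[OF red'] t by blast
qed

end

locale construction = homogeneous_gb n prec H f
  for n prec and H :: "(xterm \<Rightarrow>\<^sub>0 'k::field) set" and f +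
  fixes precC and h0 :: "(cterm \<Rightarrow>\<^sub>0 'k) set"
  assumes constructed: "constructed_ideal n prec precC H f h0"
begin

abbreviation V :: "cvar set" where "V \<equiv> params n prec H"

abbreviation "order_xc \<equiv> elim_order (graded_ext n prec) precC"

text \<open>
  The coefficients of the reductions at all \<open>x\<close>-terms lie in \<open>h0\<close>, not only those at the terms used for generating it:
  the remaining ones are zero.
\<close>
lemma constructed_reductions:
  obtains \<rho> where
    "\<And>\<alpha> \<beta>. \<alpha> \<in> A \<Longrightarrow> \<beta> \<in> A \<Longrightarrow> complete_reduction order_xc (fg ` A) (spoly order_xc (fg \<alpha>) (fg \<beta>)) (\<rho> \<alpha> \<beta>)"
    "ideal h0 (poly_ring (terms_in V))"
    "\<And>\<alpha> \<beta> t. \<alpha> \<in> A \<Longrightarrow> \<beta> \<in> A \<Longrightarrow> lookup (curry_poly (\<rho> \<alpha> \<beta>)) t \<in> h0"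
    "\<And>I. ideal I (poly_ring (terms_in V)) \<Longrightarrow>
       (\<And>\<alpha> \<beta> t. \<alpha> \<in> A \<Longrightarrow> \<beta> \<in> A \<Longrightarrow> lookup (curry_poly (\<rho> \<alpha> \<beta>)) t \<in> I) \<Longrightarrow> h0 \<subseteq> I"
proof -
  from constructed obtain \<rho> where
    \<rho>: "\<forall>\<alpha>\<in>A. \<forall>\<beta>\<in>A. complete_reduction order_xc (fg ` A) (spoly order_xc (fg \<alpha>) (fg \<beta>)) (\<rho> \<alpha> \<beta>)"
    and h0: "h0 = Idl\<^bsub>poly_ring (terms_in V)\<^esub>
      {coeff_x (\<rho> \<alpha> \<beta>) t | \<alpha> \<beta> t. \<alpha> \<in> A \<and> \<beta> \<in> A \<and> t \<in> terms_in {..n}}"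
    unfolding constructed_ideal_def Let_def by blast
  let ?G = "{coeff_x (\<rho> \<alpha> \<beta>) t | \<alpha> \<beta> t. \<alpha> \<in> A \<and> \<beta> \<in> A \<and> t \<in> terms_in {..n}}"
  note key = spoly_reduction(2)[OF _ _ \<rho>[rule_format]]
  have "?G \<subseteq> carrier (poly_ring (terms_in V))"
  proof
    fix r assume "r \<in> ?G"
    then obtain \<alpha> \<beta> t where r: "r = coeff_x (\<rho> \<alpha> \<beta>) t" "\<alpha> \<in> A" "\<beta> \<in> A" by blast
    have "c \<in> terms_in V" if "c \<in> keys r" for c
    proof -
      have "(t, c) \<in> keys (\<rho> \<alpha> \<beta>)" using that by (simp add: r(1) coeff_x_eq in_keys_iff lookup_curry_poly)
      from key[OF r(2,3) r(2,3) this] show ?thesis by blast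
    qed
    then show "r \<in> carrier (poly_ring (terms_in V))" by auto
  qed
  note gen = genideal_poly_ring[OF add_closed_terms_in this, folded h0]
  show thesis
  proof (rule that[of \<rho>])
    fix \<alpha> \<beta> t assume \<alpha>\<beta>: "\<alpha> \<in> A" "\<beta> \<in> A"
    show "complete_reduction order_xc (fg ` A) (spoly order_xc (fg \<alpha>) (fg \<beta>)) (\<rho> \<alpha> \<beta>)"
      using \<rho> \<alpha>\<beta> by blast
    show "lookup (curry_poly (\<rho> \<alpha> \<beta>)) t \<in> h0"
    proof (cases "t \<in> keys (curry_poly (\<rho> \<alpha> \<beta>))")
      case True
      then obtain c where "(t, c) \<in> keys (\<rho> \<alpha> \<beta>)" by (auto simp: keys_curry_poly)
      from key[OF \<alpha>\<beta> \<alpha>\<beta> this] show ?thesis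
        using \<alpha>\<beta> by (intro subsetD[OF gen(2)] CollectI exI[of _ \<alpha>] exI[of _ \<beta>] exI[of _ t]) (simp add: coeff_x_eq)
    next
      case False
      then show ?thesis by (simp add: in_keys_iff ideal_zero[OF gen(1)])
    qed
  next
    show "ideal h0 (poly_ring (terms_in V))" by (rule gen)
  next
    fix I assume I: "ideal I (poly_ring (terms_in V))"
      and *: "\<And>\<alpha> \<beta> t. \<alpha> \<in> A \<Longrightarrow> \<beta> \<in> A \<Longrightarrow> lookup (curry_poly (\<rho> \<alpha> \<beta>)) t \<in> I"
    have "?G \<subseteq> I" using * by (auto simp: coeff_x_eq)
    then show "h0 \<subseteq> I" by (rule gen(3)[OF I])
  qed
qed

lemma h0_ideal: "ideal h0 (poly_ring (terms_in V))"
  by (rule constructed_reductions)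

text \<open>
  The reductions of the S-polynomials have coefficients in \<open>h0\<close>, so Buchberger's criterion holds modulo \<open>h0\<close>.
\<close>
lemma universal_lifting: "lifting n prec H f (single 0) (retract_ideal V h0) (\<lambda>\<alpha>. curry_poly (fg \<alpha>))"
proof (unfold_locales)
  show "ring_map (single 0 :: 'k \<Rightarrow> cterm \<Rightarrow>\<^sub>0 'k)" by (rule ring_map_single)
  show aa: "is_ideal (retract_ideal V h0)" by (rule retract_ideal_is_ideal[OF h0_ideal])
  fix \<alpha> assume \<alpha>: "\<alpha> \<in> in_gens n prec H"
  {
    fix t assume "t \<in> keys (curry_poly (fg \<alpha>) - map_coeffs (single 0) (f \<alpha>))"
    then obtain c where "(t, c) \<in> keys (g_poly n prec H \<alpha> :: _ \<Rightarrow>\<^sub>0 'k)"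
      by (auto simp: fg_poly_def ring_map_add[OF curry_poly_ring_map] curry_poly_emb_x keys_curry_poly)
    then obtain \<gamma> where \<gamma>: "\<gamma> \<in> param_terms n prec H \<alpha>" "t = xvar n + \<gamma>" by (rule keys_g_poly)
    show "t \<in> terms_in {..n} \<and> 0 < lookup t n \<and> tdeg t = tdeg \<alpha>"
      using \<gamma>(1) unfolding param_terms_iff \<gamma>(2)[symmetric] by (simp add: \<gamma>(2) lookup_add)
  }
  fix \<beta> assume \<beta>: "\<beta> \<in> in_gens n prec H"
  let ?S = "{single u 1 * curry_poly (fg \<gamma>) | u \<gamma>. u \<in> terms_in {..n} \<and> \<gamma> \<in> A \<and>
          graded_ext n prec (u + \<gamma>) (term_lcm \<alpha> \<beta>)}"
  obtain \<rho> where \<rho>: "complete_reduction order_xc (fg ` A) (spoly order_xc (fg \<alpha>) (fg \<beta>)) \<rho>"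
    "\<And>t. lookup (curry_poly \<rho>) t \<in> h0"
  proof (rule constructed_reductions)
    fix \<rho>
    assume "\<And>\<alpha> \<beta>. \<alpha> \<in> A \<Longrightarrow> \<beta> \<in> A \<Longrightarrow> complete_reduction order_xc (fg ` A) (spoly order_xc (fg \<alpha>) (fg \<beta>)) (\<rho> \<alpha> \<beta>)"
      "\<And>\<alpha> \<beta> t. \<alpha> \<in> A \<Longrightarrow> \<beta> \<in> A \<Longrightarrow> lookup (curry_poly (\<rho> \<alpha> \<beta>)) t \<in> h0"
    from that[OF this(1)[OF \<alpha> \<beta>] this(2)[OF \<alpha> \<beta>]] show thesis .
  qed
  note red = spoly_reduction[OF \<alpha> \<beta> \<rho>(1)]
  have "keys (curry_poly \<rho>) \<subseteq> terms_in {..n}" using red(2) by (auto simp: keys_curry_poly)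
  moreover have "lookup (curry_poly \<rho>) t \<in> retract_ideal V h0" for t
    using \<rho>(2)[of t] retract_ideal_iff[OF ideal_keys[OF h0_ideal \<rho>(2)]] by blast
  ultimately have "curry_poly \<rho> \<in> pm.span (coeff_monomials n (retract_ideal V h0))"
    by (simp add: span_coeff_monomials[OF aa])
  from pm.span_add[OF subsetD[OF pm.span_mono[OF Un_upper1] red(1)] subsetD[OF pm.span_mono[OF Un_upper2] this]]
  show "single (\<beta> - \<alpha>) 1 * curry_poly (fg \<alpha>) - single (\<alpha> - \<beta>) 1 * curry_poly (fg \<beta>)
      \<in> pm.span (?S \<union> coeff_monomials n (retract_ideal V h0))"
    by simp
qed

end

sublocale construction \<subseteq> lifting n prec H f "single 0" "retract_ideal V h0" "\<lambda>\<alpha>. curry_poly (fg \<alpha>)"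
  by (rule universal_lifting)

section \<open>Isomorphic parameter rings\<close>

lemma map_coeffs_comp:
  "ring_map \<chi> \<Longrightarrow> ring_map \<eta> \<Longrightarrow> map_coeffs \<chi> (map_coeffs \<eta> p) = map_coeffs (\<lambda>r. \<chi> (\<eta> r)) p"
  by (rule poly_mapping_eqI) (simp add: ring_map_comp)

lemma (in lifting) lifted_ideal_congruent:
  assumes "q \<in> lifted_ideal" "keys p \<subseteq> T" "\<And>t. lookup p t - lookup q t \<in> \<aa>"
  shows "p \<in> lifted_ideal"
proof -
  have "p - q \<in> lifted_ideal"
    using assms(2) lifted_ideal_T[OF assms(1)] assms(3)
    by (intro coeffs_lifted_ideal keys_diff_subset) (auto simp: lookup_minus)
  from lifted_ideal_add[OF this assms(1)] show ?thesis by simp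
qed

lemma (in lifting) lifted_ideal_mult_poly:
  assumes "keys p \<subseteq> T" "q \<in> lifted_ideal" shows "p * q \<in> lifted_ideal"
proof -
  have "finite B \<Longrightarrow> B \<subseteq> T \<Longrightarrow> (\<Sum>t\<in>B. single t (lookup p t) * q) \<in> lifted_ideal" for B
    by (induction B rule: finite_induct) (auto intro: lifted_ideal_0 lifted_ideal_add lifted_ideal_mult assms)
  from this[of "keys p"] show ?thesis
    using assms(1) poly_eq_sum_single[of p] by (simp flip: sum_distrib_right)
qed

lemma (in lifting) lifted_ideal_sum: "(\<And>i. i \<in> B \<Longrightarrow> g i \<in> lifted_ideal) \<Longrightarrow> sum g B \<in> lifted_ideal"
  unfolding lifted_ideal_def by (rule pm.span_sum)

context construction
begin

text \<open>
  This is the universal property of \<open>K[C]/h0\<close>: sending the \<open>f \<alpha> + g \<alpha>\<close> into the ideal of a lifting, for whatever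
  term order it was built, kills \<open>h0\<close>.  Indeed the reductions of the S-polynomials are then
  combinations of normal terms in that ideal.
\<close>
theorem h0_killed:
  fixes \<chi> :: "(cterm \<Rightarrow>\<^sub>0 'k) \<Rightarrow> 'r::comm_ring_1"
  assumes L2: "lifting n prec2 H f2 \<theta>2 \<aa>2 F2" and \<chi>: "ring_map \<chi>"
    and F: "\<And>\<alpha>. \<alpha> \<in> A \<Longrightarrow> map_coeffs \<chi> (curry_poly (fg \<alpha>)) \<in> lifting.lifted_ideal n prec2 H \<aa>2 F2"
    and r: "r \<in> h0"
  shows "\<chi> r \<in> \<aa>2"
proof -
  interpret L2: lifting n prec2 H f2 \<theta>2 \<aa>2 F2 by fact
  note m = map_coeffs_ring_map[OF \<chi>]
  let ?I = "{r. keys r \<subseteq> terms_in V \<and> \<chi> r \<in> \<aa>2}"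
  have I: "ideal ?I (poly_ring (terms_in V))"
  proof (rule ideal_poly_ringI[OF add_closed_terms_in], goal_cases)
    case (4 u c p)
    then have "keys (single u c * p) \<subseteq> terms_in V" by (intro keys_mult_subset) auto
    then show ?case using 4 is_ideal_mult[OF L2.\<aa>] by (simp add: ring_map_mult[OF \<chi>])
  qed (auto simp: ring_map_0[OF \<chi>] ring_map_add[OF \<chi>] is_ideal_0[OF L2.\<aa>] is_ideal_add[OF L2.\<aa>]
      dest: subsetD[OF keys_add])
  have "h0 \<subseteq> ?I"
  proof (rule constructed_reductions)
    fix \<rho>
    assume red: "\<And>\<alpha> \<beta>. \<alpha> \<in> A \<Longrightarrow> \<beta> \<in> A \<Longrightarrow> complete_reduction order_xc (fg ` A) (spoly order_xc (fg \<alpha>) (fg \<beta>)) (\<rho> \<alpha> \<beta>)"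
      and h0: "ideal h0 (poly_ring (terms_in V))"
        "\<And>\<alpha> \<beta> t. \<alpha> \<in> A \<Longrightarrow> \<beta> \<in> A \<Longrightarrow> lookup (curry_poly (\<rho> \<alpha> \<beta>)) t \<in> h0"
      and min: "\<And>I. ideal I (poly_ring (terms_in V)) \<Longrightarrow>
       (\<And>\<alpha> \<beta> t. \<alpha> \<in> A \<Longrightarrow> \<beta> \<in> A \<Longrightarrow> lookup (curry_poly (\<rho> \<alpha> \<beta>)) t \<in> I) \<Longrightarrow> h0 \<subseteq> I"
    show "h0 \<subseteq> ?I"
    proof (rule min[OF I])
      fix \<alpha> \<beta> t assume \<alpha>: "\<alpha> \<in> A" and \<beta>: "\<beta> \<in> A"
      let ?r = "curry_poly (\<rho> \<alpha> \<beta>)"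
      let ?S = "single (\<beta> - \<alpha>) 1 * curry_poly (fg \<alpha>) - single (\<alpha> - \<beta>) 1 * curry_poly (fg \<beta>)"
      note sp = spoly_reduction[OF \<alpha> \<beta> red[OF \<alpha> \<beta>]]
      have mult: "map_coeffs \<chi> (single u 1 * curry_poly (fg \<gamma>)) \<in> L2.lifted_ideal" if "u \<in> T" "\<gamma> \<in> A" for u \<gamma>
        using L2.lifted_ideal_mult[OF that(1) F[OF that(2)]]
        by (simp add: ring_map_mult[OF m] map_coeffs_single[OF \<chi>])
      have 1: "map_coeffs \<chi> ?S \<in> L2.lifted_ideal"
        unfolding ring_map_diff[OF m]
        by (intro L2.lifted_ideal_diff mult terms_in_minus A_T \<alpha> \<beta>)
      have 2: "map_coeffs \<chi> (?S - ?r) \<in> L2.lifted_ideal"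
        unfolding L2.lifted_ideal_def
      proof (rule span_semilinear[OF _ _ _ _ sp(1), where \<theta> = \<chi>])
        fix b assume "b \<in> {single u 1 * curry_poly (fg \<gamma>) | u \<gamma>. u \<in> T \<and> \<gamma> \<in> A \<and> graded_ext n prec (u + \<gamma>) (term_lcm \<alpha> \<beta>)}"
        then obtain u \<gamma> where b: "b = single u 1 * curry_poly (fg \<gamma>)" "u \<in> T" "\<gamma> \<in> A" by blast
        show "map_coeffs \<chi> b \<in> pm.span (multiples n L2.A F2 \<union> coeff_monomials n \<aa>2)"
          unfolding b(1) L2.lifted_ideal_def[symmetric] by (rule mult[OF b(2,3)])
      qed (simp_all add: ring_map_add[OF m] ring_map_0[OF m] map_coeffs_smul[OF \<chi>])
      have "map_coeffs \<chi> ?r = map_coeffs \<chi> ?S - map_coeffs \<chi> (?S - ?r)" by (simp add: ring_map_diff[OF m])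
      then have r: "map_coeffs \<chi> ?r \<in> L2.lifted_ideal" using L2.lifted_ideal_diff[OF 1 2] by (simp only:)
      have "lookup (map_coeffs \<chi> ?r) t \<in> \<aa>2"
      proof (rule L2.normal_elements_vanish[OF homogeneous_gb_axioms r])
        fix s assume "\<not> normal s"
        then have "s \<notin> keys ?r" using sp(2) by (auto simp: keys_curry_poly)
        then show "lookup (map_coeffs \<chi> ?r) s \<in> \<aa>2"
          by (simp add: \<chi> in_keys_iff ring_map_0[OF \<chi>] is_ideal_0[OF L2.\<aa>])
      qed
      then have "\<chi> (lookup ?r t) \<in> \<aa>2" by (simp add: \<chi>)
      then show "lookup ?r t \<in> ?I" using ideal_keys[OF h0(1) h0(2)[OF \<alpha> \<beta>]] by blast
    qed
  qed
  then show ?thesis using r by blast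
qed

text \<open>
  Generators go into the second ideal by assumption, and coefficients in \<open>h0\<close> go to \<open>\<aa>2\<close> by \<open>h0_killed\<close>.
\<close>
lemma lifted_ideal_mapped:
  fixes \<chi> :: "(cterm \<Rightarrow>\<^sub>0 'k) \<Rightarrow> 'r::comm_ring_1"
  assumes L2: "lifting n prec2 H f2 \<theta>2 \<aa>2 F2" and \<chi>: "ring_map \<chi>" "\<And>r. \<chi> (retract V r) = \<chi> r"
    and F: "\<And>\<alpha>. \<alpha> \<in> A \<Longrightarrow> map_coeffs \<chi> (curry_poly (fg \<alpha>)) \<in> lifting.lifted_ideal n prec2 H \<aa>2 F2"
    and p: "p \<in> lifted_ideal"
  shows "map_coeffs \<chi> p \<in> lifting.lifted_ideal n prec2 H \<aa>2 F2"
proof -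
  interpret L2: lifting n prec2 H f2 \<theta>2 \<aa>2 F2 by fact
  note m = map_coeffs_ring_map[OF \<chi>(1)]
  show ?thesis
    unfolding L2.lifted_ideal_def
  proof (rule span_semilinear[OF _ _ _ _ p[unfolded lifted_ideal_def], where \<theta> = \<chi>])
    fix b assume "b \<in> multiples n A (\<lambda>\<alpha>. curry_poly (fg \<alpha>)) \<union> coeff_monomials n (retract_ideal V h0)"
    then have "map_coeffs \<chi> b \<in> L2.lifted_ideal"
    proof
      assume "b \<in> multiples n A (\<lambda>\<alpha>. curry_poly (fg \<alpha>))"
      then obtain u \<gamma> where b: "b = single u 1 * curry_poly (fg \<gamma>)" "u \<in> T" "\<gamma> \<in> A" by (auto simp: multiples_def)
      show ?thesis
        using L2.lifted_ideal_mult[OF b(2) F[OF b(3)]]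
        by (simp add: b(1) ring_map_mult[OF m] map_coeffs_single[OF \<chi>(1)])
    next
      assume "b \<in> coeff_monomials n (retract_ideal V h0)"
      then obtain t a where b: "b = single t a" "t \<in> T" "retract V a \<in> h0"
        by (auto simp: coeff_monomials_def retract_ideal_def)
      have a: "\<chi> a \<in> \<aa>2" using h0_killed[OF L2 \<chi>(1) F b(3)] by (simp add: \<chi>(2))
      show ?thesis unfolding b(1) map_coeffs_single[OF \<chi>(1)]
        by (rule L2.coeffs_lifted_ideal) (use b(2) a in \<open>auto simp: lookup_single when_def is_ideal_0[OF L2.\<aa>] split: if_splits\<close>)
    qed
    then show "map_coeffs \<chi> b \<in> pm.span (multiples n L2.A F2 \<union> coeff_monomials n \<aa>2)"
      by (simp only: L2.lifted_ideal_def)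
  qed (simp_all add: ring_map_add[OF m] ring_map_0[OF m] map_coeffs_smul[OF \<chi>(1)])
qed

lemma lookup_map_coeffs_fg:
  assumes "ring_map \<chi>" "\<And>c. \<chi> (single 0 c) = single 0 c" "\<alpha> \<in> A"
  shows "lookup (map_coeffs \<chi> (curry_poly (fg \<alpha>))) t =
    (if lookup t n = 0 then single 0 (lookup (f \<alpha>) t)
     else \<chi> (single (single (\<alpha>, t - xvar n) 1) 1) when t \<in> T \<and> normal t \<and> tdeg t = tdeg \<alpha>)"
  by (simp add: assms lookup_curry_fg ring_map_0[OF assms(1)] when_def)

text \<open>
  An endomorphism of the parameter ring that maps the universal lifting into itself is the identity modulo \<open>h0\<close>:
  a generator and its image differ by a combination of normal terms in the ideal, and the coefficients in it
  are the differences of the parameters and their images.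
\<close>
lemma endomorphism_identity:
  assumes \<chi>: "ring_map \<chi>" "\<And>c. \<chi> (single 0 c) = single 0 c"
    and F: "\<And>\<alpha>. \<alpha> \<in> A \<Longrightarrow> map_coeffs \<chi> (curry_poly (fg \<alpha>)) \<in> lifted_ideal"
    and r: "keys r \<subseteq> terms_in V"
  shows "\<chi> r - r \<in> retract_ideal V h0"
  using r
proof (induction r rule: poly_ring_induct)
  case (const c)
  then show ?case by (simp add: \<chi>(2) is_ideal_0[OF \<aa>])
next
  case (var v)
  obtain \<alpha> \<gamma> where v: "v = (\<alpha>, \<gamma>)" by force
  have \<alpha>: "\<alpha> \<in> A" using var by (simp add: v params_def)
  have \<gamma>: "xvar n + \<gamma> \<in> T" "normal (xvar n + \<gamma>)" "tdeg (xvar n + \<gamma>) = tdeg \<alpha>"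
    using var unfolding v param_iff[OF \<alpha>] by auto
  let ?D = "map_coeffs \<chi> (curry_poly (fg \<alpha>)) - curry_poly (fg \<alpha>)"
  have D: "?D \<in> lifted_ideal" by (rule lifted_ideal_diff[OF F[OF \<alpha>] F_lifted_ideal[OF \<alpha>]])
  have "lookup ?D (xvar n + \<gamma>) \<in> retract_ideal V h0"
  proof (rule buchberger_modulo[OF D])
    fix t assume "\<not> normal t"
    then have "lookup ?D t = 0"
      by (simp add: lookup_minus lookup_map_coeffs_fg[OF \<chi> \<alpha>] lookup_curry_fg[OF \<alpha>] del: lookup_map_coeffs)
    then show "lookup ?D t \<in> retract_ideal V h0" by (simp add: is_ideal_0[OF \<aa>])
  qed
  moreover have "lookup ?D (xvar n + \<gamma>) = \<chi> (single (single (\<alpha>, \<gamma>) 1) 1) - single (single (\<alpha>, \<gamma>) 1) 1"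
    using \<gamma> by (simp add: lookup_minus lookup_map_coeffs_fg[OF \<chi> \<alpha>] lookup_curry_fg[OF \<alpha>] lookup_add del: lookup_map_coeffs)
  ultimately show ?case by (simp add: v)
next
  case (add p q)
  have eq: "\<chi> (p + q) - (p + q) = (\<chi> p - p) + (\<chi> q - q)" by (simp add: ring_map_add[OF \<chi>(1)])
  show ?case unfolding eq by (rule is_ideal_add[OF \<aa> add.IH])
next
  case (mult p q)
  have "\<chi> (p * q) - p * q = \<chi> p * (\<chi> q - q) + q * (\<chi> p - p)" by (simp add: ring_map_mult[OF \<chi>(1)] algebra_simps)
  then show ?case using is_ideal_add[OF \<aa> is_ideal_mult[OF \<aa> mult.IH(2)] is_ideal_mult[OF \<aa> mult.IH(1)]] by simp
qed

text \<open>
  For every other term order, the reduced Groebner basis lifts to the ideal with normal terms divisible by \<open>x\<^sub>n\<close>.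
  Their coefficients are the values of the parameters.
\<close>
lemma parameters_exist:
  assumes gb': "homogeneous_gb n prec' H f'"
  obtains \<sigma> :: "cvar \<Rightarrow> (cterm \<Rightarrow>\<^sub>0 'k)" where "\<forall>v. keys (\<sigma> v) \<subseteq> terms_in V"
    "\<forall>v. v \<notin> params n prec' H \<longrightarrow> \<sigma> v = 0"
    "\<forall>\<beta>\<in>in_gens n prec' H.
      map_coeffs (subst \<sigma>) (curry_poly (fg_poly n prec' H f' \<beta>)) \<in> lifted_ideal"
proof -
  interpret B: homogeneous_gb n prec' H f' by fact
  have "\<forall>\<beta>\<in>B.A. \<exists>q. q \<in> lifted_ideal \<and> (\<forall>t\<in>keys (q - map_coeffs (single 0) (f' \<beta>)).
      t \<in> T \<and> 0 < lookup t n \<and> tdeg t = tdeg \<beta> \<and> B.normal t)"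
  proof
    fix \<beta> assume \<beta>: "\<beta> \<in> B.A"
    obtain q where "q \<in> lifted_ideal" "\<forall>t\<in>keys (q - map_coeffs (single 0) (f' \<beta>)).
        t \<in> T \<and> 0 < lookup t n \<and> tdeg t = tdeg \<beta> \<and> B.normal t"
      by (rule lift_normal[OF gb' B.f_in_H[OF \<beta>] B.f_homogeneous[OF \<beta>]])
    then show "\<exists>q. q \<in> lifted_ideal \<and> (\<forall>t\<in>keys (q - map_coeffs (single 0) (f' \<beta>)).
      t \<in> T \<and> 0 < lookup t n \<and> tdeg t = tdeg \<beta> \<and> B.normal t)" by (intro exI conjI)
  qed
  from bchoice[OF this] obtain q where q: "\<forall>\<beta>\<in>B.A. q \<beta> \<in> lifted_ideal \<and>
      (\<forall>t\<in>keys (q \<beta> - map_coeffs (single 0) (f' \<beta>)). t \<in> T \<and> 0 < lookup t n \<and> tdeg t = tdeg \<beta> \<and> B.normal t)" ..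
  define \<sigma> where "\<sigma> = (\<lambda>v. if v \<in> params n prec' H then retract V (lookup (q (fst v)) (xvar n + snd v)) else 0)"
  show thesis
  proof (rule that)
    show "\<forall>v. keys (\<sigma> v) \<subseteq> terms_in V" by (simp add: \<sigma>_def retract_keys)
    show "\<forall>v. v \<notin> params n prec' H \<longrightarrow> \<sigma> v = 0" by (simp add: \<sigma>_def)
  next
    show "\<forall>\<beta>\<in>B.A. map_coeffs (subst \<sigma>) (curry_poly (B.fg \<beta>)) \<in> lifted_ideal"
    proof
      fix \<beta> assume \<beta>: "\<beta> \<in> B.A"
      let ?p = "map_coeffs (subst \<sigma>) (curry_poly (B.fg \<beta>))"
      have lp: "lookup ?p t = (if lookup t n = 0 then single 0 (lookup (f' \<beta>) t)
          else \<sigma> (\<beta>, t - xvar n) when t \<in> T \<and> B.normal t \<and> tdeg t = tdeg \<beta>)" for t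
        by (simp add: subst_ring_map B.lookup_curry_fg[OF \<beta>] subst_const subst_var when_def ring_map_0[OF subst_ring_map])
      show "?p \<in> lifted_ideal"
      proof (rule lifted_ideal_congruent)
        show "q \<beta> \<in> lifted_ideal" using q \<beta> by blast
        show "keys ?p \<subseteq> T"
          using B.keys_fg(1)[OF \<beta>]
          by (intro order_trans[OF keys_map_coeffs[OF subst_ring_map]]) (auto simp: keys_curry_poly)
        fix t
        have D: "lookup (q \<beta>) t = single 0 (lookup (f' \<beta>) t)"
          if "\<not> (t \<in> T \<and> 0 < lookup t n \<and> tdeg t = tdeg \<beta> \<and> B.normal t)"
        proof -
          have "t \<notin> keys (q \<beta> - map_coeffs (single 0) (f' \<beta>))" using q \<beta> that by blast
          then show ?thesis by (simp add: in_keys_iff lookup_minus ring_map_single)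
        qed
        show "lookup ?p t - lookup (q \<beta>) t \<in> retract_ideal V h0"
        proof (cases "lookup t n = 0")
          case True
          then show ?thesis using D by (simp add: lp is_ideal_0[OF \<aa>])
        next
          case False
          then have t: "t = xvar n + (t - xvar n)" by (intro xterm_split) simp
          show ?thesis
          proof (cases "t \<in> T \<and> B.normal t \<and> tdeg t = tdeg \<beta>")
            case True
            then have "(\<beta>, t - xvar n) \<in> params n prec' H" unfolding B.param_iff[OF \<beta>] t[symmetric] .
            then have "\<sigma> (\<beta>, t - xvar n) = retract V (lookup (q \<beta>) t)" by (simp add: \<sigma>_def flip: t)
            then have "lookup ?p t = retract V (lookup (q \<beta>) t)" using False True by (simp add: lp del: lookup_map_coeffs)
            then show ?thesis using retract_ideal_diff[OF h0_ideal] by simp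
          next
            case nn: False
            have "t \<notin> keys (f' \<beta>)" using False B.keys_f[OF \<beta>] by (auto simp: terms_lessThan_iff)
            then have "lookup (q \<beta>) t = 0" using D nn by (auto simp: in_keys_iff)
            moreover have "lookup ?p t = 0" using False nn by (simp add: lp del: lookup_map_coeffs)
            ultimately show ?thesis by (simp add: is_ideal_0[OF \<aa>])
          qed
        qed
      qed
    qed
  qed
qed

end

text \<open>
  One inverse law shows that \<open>\<chi>\<close> followed by the projection has kernel \<open>I\<close>, the other one that it is surjective.
\<close>
lemma quotient_isomorphism:
  fixes \<chi> \<eta> :: "(('v \<Rightarrow>\<^sub>0 nat) \<Rightarrow>\<^sub>0 'k::field) \<Rightarrow> (('v \<Rightarrow>\<^sub>0 nat) \<Rightarrow>\<^sub>0 'k)"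
  defines "R V \<equiv> poly_ring (terms_in V)"
  assumes I: "ideal I (R V)" and J: "ideal J (R W)"
    and \<chi>: "ring_map \<chi>" "\<And>r. keys r \<subseteq> terms_in V \<Longrightarrow> keys (\<chi> r) \<subseteq> terms_in W" "\<And>r. r \<in> I \<Longrightarrow> \<chi> r \<in> J"
    and \<eta>: "ring_map \<eta>" "\<And>s. keys s \<subseteq> terms_in W \<Longrightarrow> keys (\<eta> s) \<subseteq> terms_in V" "\<And>s. s \<in> J \<Longrightarrow> \<eta> s \<in> I"
    and inverse: "\<And>r. keys r \<subseteq> terms_in V \<Longrightarrow> \<eta> (\<chi> r) - r \<in> I"
      "\<And>s. keys s \<subseteq> terms_in W \<Longrightarrow> \<chi> (\<eta> s) - s \<in> J"
  obtains \<psi> where "\<psi> \<in> ring_iso (R V Quot I) (R W Quot J)"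
    "\<forall>r. keys r \<subseteq> terms_in V \<longrightarrow> \<psi> (I +>\<^bsub>R V\<^esub> r) = J +>\<^bsub>R W\<^esub> \<chi> r"
proof -
  interpret I: ideal I "R V" by (rule I)
  interpret J: ideal J "R W" by (rule J)
  have car: "carrier (R U) = {p. keys p \<subseteq> terms_in U}" and ops: "mult (R U) = (*)" "one (R U) = 1"
    "zero (R U) = 0" "add (R U) = (+)" for U by (simp_all add: R_def)
  have neg: "- x \<in> K" if "ideal K (R U)" "x \<in> K" for K U x
    using ideal_mult[OF that[unfolded R_def], of "-1"] by simp
  have coset: "K +>\<^bsub>R U\<^esub> x = K +>\<^bsub>R U\<^esub> y \<longleftrightarrow> x - y \<in> K" if K: "ideal K (R U)" for K U x y
  proof
    have c: "K +>\<^bsub>R U\<^esub> z = {i + z | i. i \<in> K}" for z by (auto simp: a_r_coset_def r_coset_def ops)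
    {
      assume "K +>\<^bsub>R U\<^esub> x = K +>\<^bsub>R U\<^esub> y"
      moreover have "0 + x \<in> K +>\<^bsub>R U\<^esub> x" unfolding c using ideal_zero[OF K[unfolded R_def]] by blast
      ultimately have "x \<in> {i + y | i. i \<in> K}" unfolding c by simp
      then show "x - y \<in> K" by auto
    next
      assume xy: "x - y \<in> K"
      have "i + x \<in> K +>\<^bsub>R U\<^esub> y" "i + y \<in> K +>\<^bsub>R U\<^esub> x" if "i \<in> K" for i
      proof -
        have "i + (x - y) \<in> K" "i + - (x - y) \<in> K"
          by (rule ideal_add[OF K[unfolded R_def] that]; intro neg[OF K] xy)+
        moreover have "i + x = (i + (x - y)) + y" "i + y = (i + - (x - y)) + x" by simp_all
        ultimately show "i + x \<in> K +>\<^bsub>R U\<^esub> y" "i + y \<in> K +>\<^bsub>R U\<^esub> x" unfolding c by blast+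
      qed
      then show "K +>\<^bsub>R U\<^esub> x = K +>\<^bsub>R U\<^esub> y" unfolding c[of x] c[of y] by blast
    }
  qed
  define g where "g = (\<lambda>r. J +>\<^bsub>R W\<^esub> \<chi> r)"
  have "\<chi> \<in> ring_hom (R V) (R W)"
    by (rule ring_hom_memI) (auto simp: car ops ring_map_mult[OF \<chi>(1)] ring_map_add[OF \<chi>(1)] ring_map_1[OF \<chi>(1)]
        dest!: \<chi>(2))
  from ring_hom_trans[OF this J.rcos_ring_hom] have g: "g \<in> ring_hom (R V) (R W Quot J)"
    by (simp add: g_def comp_def)
  interpret g: ring_hom_ring "R V" "R W Quot J" g
    by (rule ring_hom_ringI2[OF I.ring_axioms J.quotient_is_ring g])
  have zero: "\<zero>\<^bsub>R W Quot J\<^esub> = J +>\<^bsub>R W\<^esub> 0"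
    by (auto simp: FactRing_def a_r_coset_def r_coset_def ops)
  have "a_kernel (R V) (R W Quot J) g = I"
  proof
    show "I \<subseteq> a_kernel (R V) (R W Quot J) g"
      using ideal_keys[OF I[unfolded R_def]] \<chi>(3) by (auto simp: a_kernel_def' car zero g_def coset[OF J])
    show "a_kernel (R V) (R W Quot J) g \<subseteq> I"
    proof
      fix r assume "r \<in> a_kernel (R V) (R W Quot J) g"
      then have r: "keys r \<subseteq> terms_in V" "\<chi> r \<in> J" by (auto simp: a_kernel_def' car zero g_def coset[OF J])
      have "\<eta> (\<chi> r) + - (\<eta> (\<chi> r) - r) \<in> I"
        by (rule ideal_add[OF I[unfolded R_def] \<eta>(3)[OF r(2)] neg[OF I inverse(1)[OF r(1)]]])
      then show "r \<in> I" by simp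
    qed
  qed
  note ker = this
  have "g ` carrier (R V) = carrier (R W Quot J)"
  proof
    show "g ` carrier (R V) \<subseteq> carrier (R W Quot J)" using g.hom_closed by blast
    show "carrier (R W Quot J) \<subseteq> g ` carrier (R V)"
    proof
      fix X assume "X \<in> carrier (R W Quot J)"
      then obtain s where s: "keys s \<subseteq> terms_in W" "X = J +>\<^bsub>R W\<^esub> s"
        by (auto simp: FactRing_def A_RCOSETS_def' car)
      have "X = g (\<eta> s)" unfolding s(2) g_def coset[OF J] using neg[OF J inverse(2)[OF s(1)]] by simp
      then show "X \<in> g ` carrier (R V)" using \<eta>(2)[OF s(1)] by (auto simp: car)
    qed
  qed
  from g.FactRing_iso_set[OF this] have "(\<lambda>X. the_elem (g ` X)) \<in> ring_iso (R V Quot I) (R W Quot J)"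
    unfolding ker .
  moreover have "\<forall>r. keys r \<subseteq> terms_in V \<longrightarrow> the_elem (g ` (I +>\<^bsub>R V\<^esub> r)) = J +>\<^bsub>R W\<^esub> \<chi> r"
    using g.the_elem_simp unfolding ker by (simp add: car g_def)
  ultimately show thesis by (rule that)
qed

section \<open>The explicit morphism\<close>

lemma emb_x_ring_map: "ring_map (emb_x :: (xterm \<Rightarrow>\<^sub>0 'k::field) \<Rightarrow> _)"
  unfolding ring_map_def
  by (simp add: curry_poly_emb_x ring_map_1[OF curry_poly_ring_map]
      ring_map_add[OF curry_poly_ring_map] ring_map_mult[OF curry_poly_ring_map]
      ring_map_1[OF map_coeffs_ring_map[OF ring_map_single]] ring_map_add[OF map_coeffs_ring_map[OF ring_map_single]]
      ring_map_mult[OF map_coeffs_ring_map[OF ring_map_single]] flip: curry_poly_inj)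

lemma keys_emb_x: "(t, c) \<in> keys (emb_x p) \<longleftrightarrow> t \<in> keys p \<and> c = 0"
  by (auto simp: in_keys_iff lookup_emb_x)

lemma keys_emb_c: "(t, c) \<in> keys (emb_c p) \<longleftrightarrow> c \<in> keys p \<and> t = 0"
  by (auto simp: in_keys_iff lookup_emb_c)

text \<open>
  The \<open>x\<close>-parts of all terms are trivial, so the order on the parameters decides.
\<close>
lemma head_term_emb_c:
  assumes "term_order U precC" "keys p \<subseteq> U" "p \<noteq> 0" "\<not> precX 0 0"
  shows "head_term (elim_order precX precC) (emb_c p) = (0, head_term precC p)"
proof (rule head_termI)
  note ht = head_term_exists[OF assms(1-3)]
  show "(0, head_term precC p) \<in> keys (emb_c p)" using ht(1) by (simp add: keys_emb_c)
  fix s assume s: "s \<in> keys (emb_c p)" "s \<noteq> (0, head_term precC p)"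
  obtain t c where tc: "s = (t, c)" by force
  have c: "t = 0" "c \<in> keys p" "c \<noteq> head_term precC p" using s by (auto simp: tc keys_emb_c)
  have U: "c \<in> U" "head_term precC p \<in> U" using c ht(1) assms(2) by auto
  have "\<not> precC (head_term precC p) c"
    using ht(2)[OF c(2,3)] term_order_trans[OF assms(1) U(1,2,1)] term_order_irrefl[OF assms(1) U(1)] by blast
  then show "elim_order precX precC s (0, head_term precC p) \<and> \<not> elim_order precX precC (0, head_term precC p) s"
    using ht(2)[OF c(2,3)] assms(4) by (simp add: tc c(1) elim_order_def)
qed

context homogeneous_gb
begin

lemma A_minimal: "\<alpha> \<in> A \<Longrightarrow> \<beta> \<in> A \<Longrightarrow> tdvd \<alpha> \<beta> \<Longrightarrow> \<alpha> = \<beta>"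
  by (auto simp: in_gens_def min_gens_def)

lemma deforms_diff:
  assumes "deforms \<beta> p"
    and "\<And>t c. (t, c) \<in> keys d \<Longrightarrow> t \<in> terms_in {..n} \<and> tdeg t = tdeg \<beta> \<and> 0 < lookup t n"
  shows "deforms \<beta> (p - d)"
  unfolding deforms_def
proof (intro conjI allI impI)
  fix t c assume "(t, c) \<in> keys (p - d)"
  then have "(t, c) \<in> keys p \<or> (t, c) \<in> keys d" unfolding Un_iff[symmetric] by (rule subsetD[OF keys_minus_subset])
  then show "t \<in> terms_in {..n}" "tdeg t = tdeg \<beta>" using assms unfolding deforms_def by blast+
next
  fix t :: xterm and c :: cterm assume t: "lookup t n = 0"
  then have "(t, c) \<notin> keys d" using assms(2) by fastforce
  then show "lookup (p - d) (t, c) = (lookup (f \<beta>) t when c = 0)"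
    using assms(1) t by (simp add: deforms_def lookup_minus in_keys_iff)
qed

text \<open>
  No term of \<open>f \<beta>\<close> is reducible by the other \<open>f \<alpha>\<close> or by a nonconstant polynomial in the parameters, so a
  reduction step only changes terms divisible by \<open>x\<^sub>n\<close>.
\<close>
lemma deforms_red_step:
  fixes precC
  defines "ordxc \<equiv> elim_order (graded_ext n prec) precC"
  assumes \<beta>: "\<beta> \<in> A" and p: "deforms \<beta> p" and step: "red_step ordxc (P ` (A - {\<beta>}) \<union> emb_c ` \<H>) p q"
    and P: "\<And>\<alpha>. \<alpha> \<in> A \<Longrightarrow> deforms \<alpha> (P \<alpha>)"
    and precC: "term_order U precC" and \<H>: "\<And>h. h \<in> \<H> \<Longrightarrow> keys h \<subseteq> U \<and> h \<noteq> 0 \<and> keys h \<noteq> {0}"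
  shows "deforms \<beta> q"
proof -
  obtain g w k where g: "g \<in> P ` (A - {\<beta>}) \<union> emb_c ` \<H>" "w + head_term ordxc g \<in> keys p"
    and q: "q = p - single w k * g"
    using step unfolding red_step_def by blast
  obtain u v where w: "w = (u, v)" by force
  have xn_free: "c = 0 \<and> t \<in> keys (f \<beta>)" if "(t, c) \<in> keys p" "lookup t n = 0" for t c
    using p that by (auto simp: deforms_def in_keys_iff when_def split: if_splits)
  have pk: "t \<in> terms_in {..n} \<and> tdeg t = tdeg \<beta>" if "(t, c) \<in> keys p" for t c
    using p that unfolding deforms_def by blast
  show ?thesis
    unfolding q
  proof (rule deforms_diff[OF p])
    fix t c assume "(t, c) \<in> keys (single w k * g)"
    then obtain s where s: "(t, c) = w + s" "s \<in> keys g" using keys_single_mult by blast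
    obtain s1 s2 where s12: "s = (s1, s2)" by force
    have t: "t = u + s1" using s(1) by (simp add: w s12)
    from g(1) show "t \<in> terms_in {..n} \<and> tdeg t = tdeg \<beta> \<and> 0 < lookup t n"
    proof
      assume "g \<in> P ` (A - {\<beta>})"
      then obtain \<alpha> where \<alpha>: "\<alpha> \<in> A" "\<alpha> \<noteq> \<beta>" "g = P \<alpha>" by blast
      have key: "(u + \<alpha>, v) \<in> keys p"
        using g(2) deforms_head(1)[OF \<alpha>(1) P[OF \<alpha>(1)], of precC] by (simp add: \<alpha>(3) w ordxc_def)
      have "0 < lookup u n"
      proof (rule ccontr)
        assume "\<not> 0 < lookup u n"
        then have "lookup (u + \<alpha>) n = 0"
          using A_terms[OF \<alpha>(1)] by (simp add: lookup_add terms_lessThan_iff)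
        then have k: "u + \<alpha> \<in> keys (f \<beta>)" using xn_free[OF key] by blast
        have dvd: "tdvd \<alpha> (u + \<alpha>)" unfolding tdvd_def by (metis add.commute)
        then show False
          using f_reduced[OF \<beta> k] A_minimal[OF \<alpha>(1) \<beta>] \<alpha>(1,2) unfolding normal_def by metis
      qed
      moreover have "s1 \<in> terms_in {..n} \<and> tdeg s1 = tdeg \<alpha>"
        using P[OF \<alpha>(1)] s(2) unfolding \<alpha>(3) s12 deforms_def by blast
      ultimately show ?thesis using pk[OF key] by (simp add: t lookup_add)
    next
      assume "g \<in> emb_c ` \<H>"
      then obtain h where h: "h \<in> \<H>" "g = emb_c h" by blast
      note hp = \<H>[OF h(1)]
      let ?m = "head_term precC h"
      have "\<not> graded_ext n prec 0 0" by (rule graded_ext_irrefl[OF ord]) simp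
      then have "head_term ordxc g = (0, ?m)"
        unfolding h(2) ordxc_def using hp by (intro head_term_emb_c[OF precC]) auto
      then have key: "(u, v + ?m) \<in> keys p" using g(2) by (simp add: w)
      have s1: "s1 = 0" using s(2) by (simp add: h(2) s12 keys_emb_c)
      \<comment> \<open>The term \<open>1\<close> is the smallest one, so only a constant has it as its head term.\<close>
      have m: "?m \<noteq> 0"
      proof
        assume m0: "?m = 0"
        note ht = head_term_exists[OF precC, of h] hp
        have "c = 0" if "c \<in> keys h" for c
        proof (rule ccontr)
          assume "c \<noteq> 0"
          moreover have "c \<in> U" "0 \<in> U" using that ht(1) hp m0 by auto
          ultimately show False
            using ht(2)[of c] that hp m0 term_order_zero[OF precC, of c] term_order_trans[OF precC, of 0 c 0]
              term_order_irrefl[OF precC, of 0] by auto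
        qed
        moreover have "0 \<in> keys h" using ht(1) hp m0 by auto
        ultimately have "keys h = {0}" by blast
        then show False using hp by blast
      qed
      have "0 < lookup u n"
      proof (rule ccontr)
        assume "\<not> 0 < lookup u n"
        then have "v + ?m = 0" using xn_free[OF key] by simp
        then have "keys v \<union> keys ?m = {}" using keys_plus_nat[of v ?m] by simp
        then show False using m by simp
      qed
      then show ?thesis using pk[OF key] by (simp add: t s1)
    qed
  qed
qed

text \<open>
  The \<open>f\<close>-parts add up to \<open>f' \<beta>\<close>; the \<open>g\<close>-parts are divisible by \<open>x\<^sub>n\<close>, and the degrees of the \<open>h \<alpha> \<beta>\<close> are right.
\<close>
lemma p_poly_deforms:
  assumes gb': "homogeneous_gb n prec' H f'" and \<beta>: "\<beta> \<in> in_gens n prec' H"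
    and h: "\<And>\<alpha> t. \<alpha> \<in> A \<Longrightarrow> t \<in> keys (h \<alpha> \<beta>) \<Longrightarrow> t \<in> terms_in {..<n} \<and> int (tdeg t) = int (tdeg \<beta>) - int (tdeg \<alpha>)"
    and f'_h: "f' \<beta> = (\<Sum>\<alpha>\<in>A. h \<alpha> \<beta> * f \<alpha>)"
  shows "homogeneous_gb.deforms n f' \<beta> (p_poly n prec H f h \<beta>)"
proof -
  interpret B: homogeneous_gb n prec' H f' by fact
  let ?G = "\<Sum>\<alpha>\<in>A. emb_x (h \<alpha> \<beta>) * (- g_poly n prec H \<alpha>)"
  have "p_poly n prec H f h \<beta> = emb_x (f' \<beta>) - ?G"
    by (simp add: p_poly_def fg_poly_def f'_h ring_map_sum[OF emb_x_ring_map] ring_map_mult[OF emb_x_ring_map]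
        distrib_left sum.distrib sum_negf)
  moreover have "B.deforms \<beta> (emb_x (f' \<beta>) - ?G)"
  proof (rule B.deforms_diff)
    show "B.deforms \<beta> (emb_x (f' \<beta>))"
      using B.keys_f[OF \<beta>] B.f_homogeneous[OF \<beta>]
      by (auto simp: B.deforms_def keys_emb_x lookup_emb_x terms_lessThan_iff)
    fix t c assume "(t, c) \<in> keys ?G"
    then have "(t, c) \<in> (\<Union>\<alpha>\<in>A. keys (emb_x (h \<alpha> \<beta>) * (- g_poly n prec H \<alpha>)))" by (rule subsetD[OF keys_sum])
    then obtain \<alpha> where \<alpha>: "\<alpha> \<in> A" "(t, c) \<in> keys (emb_x (h \<alpha> \<beta>) * (- g_poly n prec H \<alpha>))" by (rule UN_E)
    from subsetD[OF keys_mult this(2)] obtain x y where xy: "(t, c) = x + y" "x \<in> keys (emb_x (h \<alpha> \<beta>))"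
      "y \<in> keys (- g_poly n prec H \<alpha> :: _ \<Rightarrow>\<^sub>0 'k)" by blast
    obtain u d where x: "x = (u, d)" by force
    obtain s e where y: "y = (s, e)" by force
    have t: "t = u + s" using xy(1) by (simp add: x y)
    have u: "u \<in> keys (h \<alpha> \<beta>)" using xy(2) by (simp add: x keys_emb_x)
    have "(s, e) \<in> keys (g_poly n prec H \<alpha> :: _ \<Rightarrow>\<^sub>0 'k)" using xy(3) by (simp add: y in_keys_iff)
    then obtain \<gamma> where \<gamma>: "\<gamma> \<in> param_terms n prec H \<alpha>" "s = xvar n + \<gamma>" by (rule keys_g_poly)
    have s: "s \<in> terms_in {..n}" "tdeg s = tdeg \<alpha>" using \<gamma>(1) unfolding param_terms_iff \<gamma>(2) by auto
    show "t \<in> terms_in {..n} \<and> tdeg t = tdeg \<beta> \<and> 0 < lookup t n"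
      using h[OF \<alpha>(1) u] s by (auto simp: t terms_lessThan_iff \<gamma>(2) lookup_add)
  qed
  ultimately show ?thesis by (simp only:)
qed

end

context construction
begin

text \<open>
  A multiplier that occurs in a reduction divides a term of the reduced polynomial, so it involves only
  \<open>x\<^sub>0,\<dots>,x\<^sub>n\<close>.
\<close>
lemma red_step_lifted_ideal:
  assumes p: "curry_poly p \<in> lifted_ideal" and step: "red_step ordxc G p q"
    and G: "\<And>g. g \<in> G \<Longrightarrow> curry_poly g \<in> lifted_ideal"
  shows "curry_poly q \<in> lifted_ideal"
proof -
  obtain g w k where g: "g \<in> G" "w + head_term ordxc g \<in> keys p" and q: "q = p - single w k * g"
    using step unfolding red_step_def by blast
  obtain u v where w: "w = (u, v)" by force
  obtain s d where ht: "head_term ordxc g = (s, d)" by force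
  have "u + s \<in> keys (curry_poly p)" using g(2) by (auto simp: w ht keys_curry_poly)
  then have "u \<in> T" using lifted_ideal_T[OF p] by auto
  from lifted_ideal_diff[OF p lifted_ideal_mult[OF this G[OF g(1)], of "single v k"]]
  show ?thesis
    by (simp add: q w ring_map_diff[OF curry_poly_ring_map] ring_map_mult[OF curry_poly_ring_map] curry_poly_single)
qed

text \<open>
  The values prescribed by the reduced polynomials \<open>q \<beta>\<close> send the universal lifting for the second order into the
  ideal for the first one.  If \<open>h0\<close> is the whole ring, then so is the ideal; otherwise \<open>q \<beta>\<close> is exactly the image.
\<close>
lemma reduced_parameters:
  fixes q :: "xterm \<Rightarrow> (xterm \<times> cterm \<Rightarrow>\<^sub>0 'k)" and prec'
  defines "\<sigma> \<equiv> (\<lambda>v. if v \<in> params n prec' H then coeff_x (q (fst v)) (xvar n + snd v) else 0)"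
  assumes gb': "homogeneous_gb n prec' H f'"
    and precC: "term_order (terms_in V) precC"
    and \<H>: "\<H> \<subseteq> h0" "0 \<notin> \<H>"
    and h: "\<And>\<alpha> \<beta> t. \<alpha> \<in> A \<Longrightarrow> \<beta> \<in> in_gens n prec' H \<Longrightarrow> t \<in> keys (h \<alpha> \<beta>) \<Longrightarrow>
              t \<in> terms_in {..<n} \<and> int (tdeg t) = int (tdeg \<beta>) - int (tdeg \<alpha>)"
    and f'_h: "\<And>\<beta>. \<beta> \<in> in_gens n prec' H \<Longrightarrow> f' \<beta> = (\<Sum>\<alpha>\<in>A. h \<alpha> \<beta> * f \<alpha>)"
    and q: "complete_reduction (elim_order (graded_ext n prec') precC)
              (p_poly n prec H f h ` (in_gens n prec' H - {\<beta>}) \<union> emb_c ` \<H>) (p_poly n prec H f h \<beta>) (q \<beta>)"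
    and \<beta>: "\<beta> \<in> in_gens n prec' H"
  shows "map_coeffs (subst \<sigma>) (curry_poly (fg_poly n prec' H f' \<beta>)) \<in> lifted_ideal"
proof -
  interpret B: homogeneous_gb n prec' H f' by fact
  let ?o = "elim_order (graded_ext n prec') precC"
  let ?P = "p_poly n prec H f h"
  let ?G = "?P ` (B.A - {\<beta>}) \<union> emb_c ` \<H>"
  let ?p = "map_coeffs (subst \<sigma>) (curry_poly (B.fg \<beta>))"
  have keys_p: "keys ?p \<subseteq> T"
    using B.keys_fg(1)[OF \<beta>]
    by (intro order_trans[OF keys_map_coeffs[OF subst_ring_map]]) (auto simp: keys_curry_poly)
  have P_deforms: "B.deforms \<alpha> (?P \<alpha>)" if "\<alpha> \<in> B.A" for \<alpha>
    by (rule p_poly_deforms[where h = h, OF gb' that h[OF _ that] f'_h[OF that]])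
  have P_in: "curry_poly (?P \<alpha>) \<in> lifted_ideal" if "\<alpha> \<in> B.A" for \<alpha>
    unfolding p_poly_def ring_map_sum[OF curry_poly_ring_map] ring_map_mult[OF curry_poly_ring_map] curry_poly_emb_x
  proof (intro lifted_ideal_sum lifted_ideal_mult_poly F_lifted_ideal)
    fix \<gamma> assume "\<gamma> \<in> A"
    then have "keys (h \<gamma> \<alpha>) \<subseteq> T" using h[OF _ that] by (auto simp: terms_lessThan_iff)
    then show "keys (map_coeffs (single 0) (h \<gamma> \<alpha>)) \<subseteq> T" using keys_map_coeffs[OF ring_map_single] by blast
  qed
  have red: "(red_step ?o ?G)\<^sup>*\<^sup>* (?P \<beta>) (q \<beta>)" and irred: "\<not> (\<exists>r'. red_step ?o ?G (q \<beta>) r')"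
    using q unfolding complete_reduction_def by auto
  have G_in: "curry_poly g \<in> lifted_ideal" if "g \<in> ?G" for g
    using that
  proof
    assume "g \<in> emb_c ` \<H>"
    then obtain r where r: "g = emb_c r" "r \<in> h0" using \<H>(1) by blast
    then have "r \<in> retract_ideal V h0" using retract_ideal_iff[OF ideal_keys[OF h0_ideal r(2)]] by blast
    then show ?thesis unfolding r(1) curry_poly_emb_c
      by (intro coeffs_lifted_ideal) (auto simp: lookup_single when_def is_ideal_0[OF \<aa>] split: if_splits)
  qed (use P_in in blast)
  have q_in: "curry_poly (q \<beta>) \<in> lifted_ideal"
    using red
  proof (induction rule: rtranclp_induct)
    case base
    show ?case by (rule P_in[OF \<beta>])
  next
    case (step p r)
    show ?case by (rule red_step_lifted_ideal[OF step.IH step.hyps(2) G_in])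
  qed
  show ?thesis
  proof (cases "1 \<in> h0")
    case True
    then have "1 \<in> retract_ideal V h0" by (simp add: retract_ideal_def ring_map_1[OF retract_ring_map])
    then have "c * 1 \<in> retract_ideal V h0" for c by (rule is_ideal_mult[OF \<aa>])
    then show ?thesis using keys_p by (intro coeffs_lifted_ideal) simp_all
  next
    case False
    have nonconst: "keys r \<subseteq> terms_in V \<and> r \<noteq> 0 \<and> keys r \<noteq> {0}" if r: "r \<in> \<H>" for r
    proof (intro conjI notI)
      have rh0: "r \<in> h0" using r \<H> by blast
      show "keys r \<subseteq> terms_in V" by (rule ideal_keys[OF h0_ideal rh0])
      show "r = 0 \<Longrightarrow> False" using r \<H> by blast
      assume k: "keys r = {0}"
      then have "r = single 0 (lookup r 0)" using poly_eq_sum_single[of r] by simp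
      moreover have "lookup r 0 \<noteq> 0" using k by (simp flip: in_keys_iff)
      ultimately have "single 0 (1 / lookup r 0) * r = 1" by (metis mult_single add_0 nonzero_eq_divide_eq single_one)
      then show False using ideal_single_mult[OF h0_ideal rh0, of 0 "1 / lookup r 0"] False by simp
    qed
    have q_deforms: "B.deforms \<beta> (q \<beta>)"
      using red
    proof (induction rule: rtranclp_induct)
      case base
      show ?case by (rule P_deforms[OF \<beta>])
    next
      case (step p r)
      show ?case by (rule B.deforms_red_step[OF \<beta> step.IH step.hyps(2) P_deforms precC nonconst])
    qed
    have q_normal: "B.normal t" if tc: "(t, c) \<in> keys (q \<beta>)" "0 < lookup t n" for t c
      unfolding B.normal_def
    proof
      fix \<alpha> assume \<alpha>: "\<alpha> \<in> B.A"
      show "\<not> tdvd \<alpha> t"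
      proof (cases "\<alpha> = \<beta>")
        case True
        have "tdeg t = tdeg \<beta>" using q_deforms tc(1) unfolding B.deforms_def by blast
        then show ?thesis using tdvd_same_tdeg[of \<beta> t] B.A_terms[OF \<beta>] tc(2) True
          by (auto simp: terms_lessThan_iff)
      next
        case False
        show ?thesis by (rule B.irreducible_not_divisible[OF irred \<alpha> P_deforms[OF \<alpha>] _ tc(1)]) (use \<alpha> False in blast)
      qed
    qed
    have "?p = curry_poly (q \<beta>)"
    proof (rule poly_mapping_eqI)
      fix t
      have lp: "lookup ?p t = (if lookup t n = 0 then single 0 (lookup (f' \<beta>) t)
        else \<sigma> (\<beta>, t - xvar n) when t \<in> T \<and> B.normal t \<and> tdeg t = tdeg \<beta>)"
        by (simp add: subst_ring_map B.lookup_curry_fg[OF \<beta>] subst_const subst_var when_def ring_map_0[OF subst_ring_map])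
      show "lookup ?p t = lookup (curry_poly (q \<beta>)) t"
      proof (cases "lookup t n = 0")
        case True
        have "single 0 (lookup (f' \<beta>) t) = lookup (curry_poly (q \<beta>)) t"
          using q_deforms True
          by (intro poly_mapping_eqI) (auto simp: B.deforms_def lookup_curry_poly lookup_single when_def)
        then show ?thesis using True unfolding lp by simp
      next
        case False
        then have t: "t = xvar n + (t - xvar n)" by (intro xterm_split) simp
        show ?thesis
        proof (cases "t \<in> T \<and> B.normal t \<and> tdeg t = tdeg \<beta>")
          case True
          then have "(\<beta>, t - xvar n) \<in> params n prec' H" unfolding B.param_iff[OF \<beta>] t[symmetric] .
          then have "\<sigma> (\<beta>, t - xvar n) = lookup (curry_poly (q \<beta>)) t" by (simp add: \<sigma>_def coeff_x_eq flip: t)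
          then show ?thesis using False True unfolding lp by simp
        next
          case nn: False
          have "t \<notin> keys (curry_poly (q \<beta>))"
          proof
            assume "t \<in> keys (curry_poly (q \<beta>))"
            then obtain c where tc: "(t, c) \<in> keys (q \<beta>)" by (auto simp: keys_curry_poly)
            then have "t \<in> T \<and> tdeg t = tdeg \<beta>" using q_deforms unfolding B.deforms_def by blast
            then show False using nn q_normal[OF tc] False by simp
          qed
          then show ?thesis using False nn unfolding lp by (simp add: in_keys_iff)
        qed
      qed
    qed
    then show ?thesis using q_in by simp
  qed
qed

end

theorem theorem5p2:
  fixes n :: nat
    and H :: "(xterm \<Rightarrow>\<^sub>0 'k::field) set"
    and prec prec' :: "xterm \<Rightarrow> xterm \<Rightarrow> bool"
    and precC precC' :: "cterm \<Rightarrow> cterm \<Rightarrow> bool"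
    and f f' :: "xterm \<Rightarrow> (xterm \<Rightarrow>\<^sub>0 'k)"
    and h0 h0' \<H> :: "(cterm \<Rightarrow>\<^sub>0 'k) set"
    and h :: "xterm \<Rightarrow> xterm \<Rightarrow> (xterm \<Rightarrow>\<^sub>0 'k)"
    and q :: "xterm \<Rightarrow> (xterm \<times> cterm \<Rightarrow>\<^sub>0 'k)"
    and \<phi> :: "(xterm \<times> cterm \<Rightarrow>\<^sub>0 'k) \<Rightarrow> (xterm \<times> cterm \<Rightarrow>\<^sub>0 'k)"
  assumes H: "homogeneous_ideal (terms_in {..<n}) H"
    and orders: "term_order (terms_in {..<n}) prec" "term_order (terms_in {..<n}) prec'"
    and orders_C: "term_order (terms_in (params n prec H)) precC" "term_order (terms_in (params n prec' H)) precC'"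
    and f: "reduced_gb_family n prec H f"
    and f': "reduced_gb_family n prec' H f'"
    and h0: "constructed_ideal n prec precC H f h0"
    and h0': "constructed_ideal n prec' precC' H f' h0'"
    and \<H>: "reduced_groebner_basis (terms_in (params n prec H)) precC h0 \<H>"
    and h: "\<And>\<alpha> \<beta> t. \<alpha> \<in> in_gens n prec H \<Longrightarrow> \<beta> \<in> in_gens n prec' H \<Longrightarrow> t \<in> Poly_Mapping.keys (h \<alpha> \<beta>) \<Longrightarrow>
              t \<in> terms_in {..<n} \<and> int (tdeg t) = int (tdeg \<beta>) - int (tdeg \<alpha>)"
    and f'_h: "\<And>\<beta>. \<beta> \<in> in_gens n prec' H \<Longrightarrow> f' \<beta> = (\<Sum>\<alpha>\<in>in_gens n prec H. h \<alpha> \<beta> * f \<alpha>)"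
    and q: "\<And>\<beta>. \<beta> \<in> in_gens n prec' H \<Longrightarrow>
              complete_reduction (elim_order (graded_ext n prec') precC)
                (p_poly n prec H f h ` (in_gens n prec' H - {\<beta>}) \<union> emb_c ` \<H>)
                (p_poly n prec H f h \<beta>) (q \<beta>)"
    and \<phi>: "alg_hom (terms_in {..n} \<times> terms_in (params n prec' H)) (terms_in {..n} \<times> terms_in (params n prec H)) \<phi>"
    and \<phi>_x: "\<And>i. i \<le> n \<Longrightarrow>
              \<phi> (emb_x (Poly_Mapping.single (xvar i) 1)) = emb_x (Poly_Mapping.single (xvar i) 1)"
    and \<phi>_C: "\<And>\<beta> \<gamma>. (\<beta>, \<gamma>) \<in> params n prec' H \<Longrightarrow>
              \<phi> (emb_c (Poly_Mapping.single (Poly_Mapping.single (\<beta>, \<gamma>) 1) 1)) =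
              emb_c (coeff_x (q \<beta>) (xvar n + \<gamma>))"
  shows "\<exists>\<psi> \<in> ring_iso ((param_ring n prec' H) Quot h0') ((param_ring n prec H) Quot h0).
           (\<forall>c. \<psi> (h0' +>\<^bsub>param_ring n prec' H\<^esub> Poly_Mapping.single 0 c) = h0 +>\<^bsub>param_ring n prec H\<^esub> Poly_Mapping.single 0 c) \<and>
           (\<forall>r\<in>carrier (param_ring n prec' H). \<exists>s\<in>carrier (param_ring n prec H).
              \<phi> (emb_c r) = emb_c s \<and> \<psi> (h0' +>\<^bsub>param_ring n prec' H\<^esub> r) = h0 +>\<^bsub>param_ring n prec H\<^esub> s)"
proof -
  interpret X: construction n prec H f precC h0
    by unfold_locales (rule H orders f h0)+
  interpret Y: construction n prec' H f' precC' h0'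
    by unfold_locales (rule H orders f' h0')+
  define \<sigma> where "\<sigma> = (\<lambda>v. if v \<in> Y.V then coeff_x (q (fst v)) (xvar n + snd v) else 0)"
  have gb\<H>: "\<H> \<subseteq> h0" "0 \<notin> \<H>"
    using \<H> by (auto simp: reduced_groebner_basis_def groebner_basis_def)
  have \<sigma>_in: "map_coeffs (subst \<sigma>) (curry_poly (Y.fg \<beta>)) \<in> X.lifted_ideal" if "\<beta> \<in> Y.A" for \<beta>
    unfolding \<sigma>_def
    by (rule X.reduced_parameters[where q = q and h = h, OF Y.homogeneous_gb_axioms orders_C(1) gb\<H> h f'_h q[OF that] that])
  have \<sigma>0: "\<sigma> v = 0" if "v \<notin> Y.V" for v using that by (simp add: \<sigma>_def)
  note \<chi> = subst_ring_map[of \<sigma>]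
  have \<chi>_retract: "subst \<sigma> (retract Y.V r) = subst \<sigma> r" for r by (rule subst_retract[OF \<sigma>0])

  \<comment> \<open>The inverse on parameters comes from lifting the \<open>f \<alpha>\<close> into the ideal of the second construction.\<close>
  obtain \<tau> where \<tau>: "\<forall>v. keys (\<tau> v) \<subseteq> terms_in Y.V" "\<forall>v. v \<notin> X.V \<longrightarrow> \<tau> v = 0"
    "\<forall>\<alpha>\<in>X.A. map_coeffs (subst \<tau>) (curry_poly (X.fg \<alpha>)) \<in> Y.lifted_ideal"
    by (rule Y.parameters_exist[OF X.homogeneous_gb_axioms])
  note \<tau>_keys = \<tau>(1)[rule_format] and \<tau>0 = \<tau>(2)[rule_format] and \<tau>_in = \<tau>(3)[rule_format]
  note \<eta> = subst_ring_map[of \<tau>]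
  have \<eta>_retract: "subst \<tau> (retract X.V r) = subst \<tau> r" for r by (rule subst_retract[OF \<tau>0])

  have \<phi>_hom: "\<phi> \<in> ring_hom (poly_ring (terms_in {..n} \<times> terms_in Y.V)) (poly_ring (terms_in {..n} \<times> terms_in X.V))"
    and \<phi>_const: "\<And>c. \<phi> (single 0 c) = single 0 c"
    using \<phi> by (auto simp: alg_hom_def)
  have emb_keys: "keys (emb_c r) \<subseteq> terms_in {..n} \<times> terms_in V \<longleftrightarrow> keys r \<subseteq> terms_in V" for r :: "cterm \<Rightarrow>\<^sub>0 'k" and V
  proof
    assume *: "keys (emb_c r) \<subseteq> terms_in {..n} \<times> terms_in V"
    show "keys r \<subseteq> terms_in V"
    proof
      fix c assume "c \<in> keys r"
      then have "(0, c) \<in> keys (emb_c r)" by (simp add: keys_emb_c)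
      then show "c \<in> terms_in V" using * by blast
    qed
  qed (auto simp: keys_emb_c)
  have emb_const: "emb_c (single 0 c) = single 0 (c :: 'k)" for c
    by (rule poly_mapping_eqI)
      (auto simp: lookup_emb_c lookup_single when_def zero_prod_def split: prod.splits if_splits)
  have \<sigma>_keys: "keys (\<sigma> v) \<subseteq> terms_in X.V" if v: "v \<in> Y.V" for v
  proof -
    obtain \<beta> \<gamma> where \<beta>\<gamma>: "v = (\<beta>, \<gamma>)" by force
    have "keys (single (single v (1::nat)) (1::'k)) \<subseteq> terms_in Y.V" using terms_in_single[OF v] by simp
    then have "emb_c (single (single v 1) (1::'k)) \<in> carrier (poly_ring (terms_in {..n} \<times> terms_in Y.V))"
      by (simp add: emb_keys)
    from ring_hom_closed[OF \<phi>_hom this] have "keys (emb_c (\<sigma> v)) \<subseteq> terms_in {..n} \<times> terms_in X.V"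
      using \<phi>_C v by (simp add: \<beta>\<gamma> \<sigma>_def)
    then show ?thesis by (simp add: emb_keys)
  qed
  have \<phi>_subst: "\<phi> (emb_c r) = emb_c (subst \<sigma> r)" if "keys r \<subseteq> terms_in Y.V" for r
    using that
  proof (induction r rule: poly_ring_induct)
    case (const c)
    show ?case by (simp add: subst_const emb_const \<phi>_const)
  next
    case (var v)
    obtain \<beta> \<gamma> where \<beta>\<gamma>: "v = (\<beta>, \<gamma>)" by force
    show ?case using \<phi>_C[of \<beta> \<gamma>] var by (simp add: subst_var \<beta>\<gamma> \<sigma>_def)
  next
    case (add p q)
    then show ?case using ring_hom_add[OF \<phi>_hom, of "emb_c p" "emb_c q"]
      by (simp add: emb_keys ring_map_add[OF emb_c_ring_map] ring_map_add[OF \<chi>])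
  next
    case (mult p q)
    then show ?case using ring_hom_mult[OF \<phi>_hom, of "emb_c p" "emb_c q"]
      by (simp add: emb_keys ring_map_mult[OF emb_c_ring_map] ring_map_mult[OF \<chi>])
  qed

  have \<chi>_keys: "keys (subst \<sigma> r) \<subseteq> terms_in X.V" if "keys r \<subseteq> terms_in Y.V" for r
    by (rule subst_keys[OF that \<sigma>_keys])
  have \<eta>_keys: "keys (subst \<tau> s) \<subseteq> terms_in Y.V" if "keys s \<subseteq> terms_in X.V" for s
    by (rule subst_keys[OF that \<tau>_keys])
  have \<chi>_h0: "subst \<sigma> r \<in> h0" if r: "r \<in> h0'" for r
    using Y.h0_killed[OF X.universal_lifting \<chi> \<sigma>_in r] retract_ideal_iff[OF \<chi>_keys[OF ideal_keys[OF Y.h0_ideal r]]] by blast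
  have \<eta>_h0: "subst \<tau> s \<in> h0'" if s: "s \<in> h0" for s
    using X.h0_killed[OF Y.universal_lifting \<eta> \<tau>_in s] retract_ideal_iff[OF \<eta>_keys[OF ideal_keys[OF X.h0_ideal s]]] by blast
  have inv1: "subst \<tau> (subst \<sigma> r) - r \<in> h0'" if r: "keys r \<subseteq> terms_in Y.V" for r
  proof -
    have "subst \<tau> (subst \<sigma> r) - r \<in> retract_ideal Y.V h0'"
    proof (rule Y.endomorphism_identity[OF ring_map_comp[OF \<eta> \<chi>] _ _ r])
      show "map_coeffs (\<lambda>x. subst \<tau> (subst \<sigma> x)) (curry_poly (Y.fg \<beta>)) \<in> Y.lifted_ideal" if "\<beta> \<in> Y.A" for \<beta>
        using X.lifted_ideal_mapped[OF Y.universal_lifting \<eta> \<eta>_retract \<tau>_in \<sigma>_in[OF that]]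
        by (simp add: map_coeffs_comp[OF \<eta> \<chi>])
    qed (simp add: subst_const)
    then show ?thesis using retract_ideal_iff[OF keys_diff_subset[OF \<eta>_keys[OF \<chi>_keys[OF r]] r]] by blast
  qed
  have inv2: "subst \<sigma> (subst \<tau> s) - s \<in> h0" if s: "keys s \<subseteq> terms_in X.V" for s
  proof -
    have "subst \<sigma> (subst \<tau> s) - s \<in> retract_ideal X.V h0"
    proof (rule X.endomorphism_identity[OF ring_map_comp[OF \<chi> \<eta>] _ _ s])
      show "map_coeffs (\<lambda>x. subst \<sigma> (subst \<tau> x)) (curry_poly (X.fg \<alpha>)) \<in> X.lifted_ideal" if "\<alpha> \<in> X.A" for \<alpha>
        using Y.lifted_ideal_mapped[OF X.universal_lifting \<chi> \<chi>_retract \<sigma>_in \<tau>_in[OF that]]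
        by (simp add: map_coeffs_comp[OF \<chi> \<eta>])
    qed (simp add: subst_const)
    then show ?thesis using retract_ideal_iff[OF keys_diff_subset[OF \<chi>_keys[OF \<eta>_keys[OF s]] s]] by blast
  qed
  obtain \<psi> where \<psi>: "\<psi> \<in> ring_iso (param_ring n prec' H Quot h0') (param_ring n prec H Quot h0)"
    "\<forall>r. keys r \<subseteq> terms_in Y.V \<longrightarrow>
      \<psi> (h0' +>\<^bsub>param_ring n prec' H\<^esub> r) = h0 +>\<^bsub>param_ring n prec H\<^esub> subst \<sigma> r"
    by (rule quotient_isomorphism[OF Y.h0_ideal X.h0_ideal \<chi> \<chi>_keys \<chi>_h0 \<eta> \<eta>_keys \<eta>_h0 inv1 inv2])
  show ?thesis
  proof (rule bexI[OF _ \<psi>(1)], intro conjI allI ballI)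
    fix c
    show "\<psi> (h0' +>\<^bsub>param_ring n prec' H\<^esub> single 0 c) = h0 +>\<^bsub>param_ring n prec H\<^esub> single 0 c"
      using \<psi>(2)[rule_format, of "single 0 c"] by (simp add: subst_const)
  next
    fix r assume "r \<in> carrier (param_ring n prec' H)"
    then have r: "keys r \<subseteq> terms_in Y.V" by simp
    show "\<exists>s\<in>carrier (param_ring n prec H). \<phi> (emb_c r) = emb_c s \<and>
        \<psi> (h0' +>\<^bsub>param_ring n prec' H\<^esub> r) = h0 +>\<^bsub>param_ring n prec H\<^esub> s"
      using \<chi>_keys[OF r] \<phi>_subst[OF r] \<psi>(2)[rule_format, OF r] by (intro bexI[of _ "subst \<sigma> r"]) auto
  qed
qed

end
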